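(* Let $a\in\mathbb{C}$ with $(a^2-1)(a^2-4)\neq 0$, and let $C_{a,0}\subset\mathbb{P}^2(\mathbb{C})$ be the smooth plane quartic $x^4+y^4+z^4+ax^2y^2=0$. Let $G$ be the group of order $16$ of projective transformations generated by $\sigma,\tau,\rho$ (defined in the context), acting on $C_{a,0}$. Then the $1$-Weierstrass points of $C_{a,0}$, together with their geometry and their decomposition into $G$-orbits, are as follows. (1) If $a=0$ or $a=6$, then $C_{a,0}$ has no ordinary flexes and exactly $12$ hyperflexes; the hyperflexes form one $G$-orbit of $4$ points and one $G$-orbit of $8$ points. (2) Otherwise, $C_{a,0}$ has exactly $16$ ordinary flexes, forming one $G$-orbit of $16$ points, and exactly $4$ hyperflexes, forming one $G$-orbit of $4$ points.
   Context: The group $G$ is generated by the projective transformations given by the matrices $\sigma=\mathrm{diag}(-1,1,1)$, $\tau=\mathrm{diag}(i,-i,1)$ and $\rho=\begin{pmatrix}0&-1&0\\1&0&0\\0&0&1\end{pmatrix}$, acting on $[x:y:z]$ (as column vectors). For a smooth projective curve $C$ with canonical divisor $K$ and $p\in C$, a positive integer $n$ is a $1$-gap at $p$ if $l(K-(n-1)p)>l(K-np)$, where $l(D)=\dim_{\mathbb{C}} L(D)$. If $n_1<\dots<n_g$ are the $1$-gaps at $p$ ($g$ the genus), the $1$-weight of $p$ is $\omega^{(1)}(p)=\sum_i (n_i-i)$, and $p$ is a $1$-Weierstrass point if $\omega^{(1)}(p)>0$. On a smooth plane quartic the $1$-Weierstrass points are exactly the flexes, i.e. the points $p$ whose tangent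 line $L_p$ satisfies $I_p(C,L_p)\ge 3$. A flex is an ordinary flex if $I_p(C,L_p)=3$ (equivalently $\omega^{(1)}(p)=1$, gap sequence $\{1,2,4\}$) and a hyperflex if $I_p(C,L_p)=4$ (equivalently $\omega^{(1)}(p)=2$, gap sequence $\{1,2,5\}$).
   Formalization: The value a = -6 is moved from case (2) to case (1): there the curve has no ordinary flexes and 12 hyperflexes (orbits of 4 and 8 points), so the statement as written, with only a = 0 or a = 6 in case (1), fails at a = -6. *)

theory Defs
  imports
    "HOL-Analysis.Analysis"
    "HOL-Computational_Algebra.Formal_Laurent_Series"
    "HOL-Library.Poly_Mapping"
    "HOL-Library.Function_Algebras"
    "HOL-Algebra.Bij"
    "HOL-Algebra.Elementary_Groups"
    "HOL-Algebra.Group_Action"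
begin

section \<open>The complex projective plane and its projective transformations\<close>

definition proj_rel :: "complex^3 \<Rightarrow> complex^3 \<Rightarrow> bool" where
  "proj_rel u v \<longleftrightarrow> u \<noteq> 0 \<and> (\<exists>c. c \<noteq> 0 \<and> v = c *s u)"

lemma part_equivp_proj_rel: "part_equivp proj_rel"
proof (rule part_equivpI)
  have "proj_rel 1 1"
    unfolding proj_rel_def by (intro conjI exI[of _ 1]) auto
  then show "\<exists>v. proj_rel v v" ..
  show "symp proj_rel"
  proof (rule sympI)
    fix u v :: "complex^3"
    assume "proj_rel u v"
    then obtain c where c: "u \<noteq> 0" "c \<noteq> 0" "v = c *s u"
      by (auto simp: proj_rel_def)
    then have "v \<noteq> 0" by simp
    moreover have "u = inverse c *s v" using c by (simp add: vector_smult_assoc)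
    ultimately show "proj_rel v u"
      using c(2) unfolding proj_rel_def by (metis nonzero_imp_inverse_nonzero)
  qed
  show "transp proj_rel"
  proof (rule transpI)
    fix u v w :: "complex^3"
    assume "proj_rel u v" "proj_rel v w"
    then obtain c d where "u \<noteq> 0" "c \<noteq> 0" "d \<noteq> 0" "w = (d * c) *s u"
      by (auto simp: proj_rel_def vector_smult_assoc)
    then show "proj_rel u w" unfolding proj_rel_def by (metis mult_eq_0_iff)
  qed
qed

text \<open>For \<open>v \<noteq> 0\<close>, \<open>abs_proj_plane v\<close> is the point with homogeneous coordinates
  \<open>v\<close>, and \<open>rep_proj_plane p\<close> is some vector of homogeneous coordinates of \<open>p\<close>;
  \<open>abs_proj_plane 0\<close> has no meaning.\<close>

quotient_type proj_plane = "complex^3" / partial: proj_rel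
  by (rule part_equivp_proj_rel)

text \<open>Only meaningful for invertible \<open>M\<close>.\<close>

definition proj_map :: "complex^3^3 \<Rightarrow> proj_plane \<Rightarrow> proj_plane" where
  "proj_map M p = abs_proj_plane (M *v rep_proj_plane p)"

definition sigma_mat :: "complex^3^3" where
  "sigma_mat = vector [vector [-1, 0, 0], vector [0, 1, 0], vector [0, 0, 1]]"

definition tau_mat :: "complex^3^3" where
  "tau_mat = vector [vector [\<i>, 0, 0], vector [0, -\<i>, 0], vector [0, 0, 1]]"

definition rho_mat :: "complex^3^3" where
  "rho_mat = vector [vector [0, -1, 0], vector [1, 0, 0], vector [0, 0, 1]]"

definition sym_group :: "(proj_plane \<Rightarrow> proj_plane) monoid" where
  "sym_group = subgroup_generated (BijGroup UNIV)
     {proj_map sigma_mat, proj_map tau_mat, proj_map rho_mat}"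


section \<open>Plane curves\<close>

text \<open>A polynomial in \<open>x, y, z\<close> maps the exponent triple \<open>(i, j, k)\<close> to the coefficient of
  \<open>x ^ i * y ^ j * z ^ k\<close>.\<close>

type_synonym tpoly = "(nat \<times> nat \<times> nat) \<Rightarrow>\<^sub>0 complex"

text \<open>Evaluation at a vector over any commutative ring \<open>R\<close>, where
  \<open>h :: complex \<Rightarrow> R\<close> is the structure map of the complex algebra \<open>R\<close>.\<close>

definition eval_tpoly :: "(complex \<Rightarrow> 'r) \<Rightarrow> tpoly \<Rightarrow> 'r^3 \<Rightarrow> 'r::comm_ring_1" where
  "eval_tpoly h A v = (\<Sum>(i, j, k) \<in> Poly_Mapping.keys A.
     h (Poly_Mapping.lookup A (i, j, k)) * (v $ 1) ^ i * (v $ 2) ^ j * (v $ 3) ^ k)"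

abbreviation value_at :: "tpoly \<Rightarrow> complex^3 \<Rightarrow> complex" where
  "value_at \<equiv> eval_tpoly (\<lambda>c. c)"

definition homogeneous :: "nat \<Rightarrow> tpoly \<Rightarrow> bool" where
  "homogeneous d A \<longleftrightarrow> (\<forall>(i, j, k) \<in> Poly_Mapping.keys A. i + j + k = d)"

definition gradient :: "tpoly \<Rightarrow> complex^3 \<Rightarrow> complex^3" where
  "gradient A v = (\<chi> m. deriv (\<lambda>s. value_at A (v + s *s axis m 1)) 0)"

definition curve :: "tpoly \<Rightarrow> proj_plane set" where
  "curve F = {abs_proj_plane v | v. v \<noteq> 0 \<and> value_at F v = 0}"

definition smooth_plane_curve :: "nat \<Rightarrow> tpoly \<Rightarrow> bool" where
  "smooth_plane_curve d F \<longleftrightarrow> F \<noteq> 0 \<and> homogeneous d F \<and>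
     (\<forall>v. v \<noteq> 0 \<and> value_at F v = 0 \<longrightarrow> gradient F v \<noteq> 0)"

definition curve_action ::
    "tpoly \<Rightarrow> (proj_plane \<Rightarrow> proj_plane) \<Rightarrow> proj_plane \<Rightarrow> proj_plane" where
  "curve_action F g = restrict g (curve F)"

definition quartic :: "complex \<Rightarrow> tpoly" where
  "quartic a = Poly_Mapping.single (4, 0, 0) 1 + Poly_Mapping.single (0, 4, 0) 1
     + Poly_Mapping.single (0, 0, 4) 1 + Poly_Mapping.single (2, 2, 0) a"

lemma eval_tpoly_quartic:
  fixes v :: "'r::comm_ring_1^3"
  assumes "h 0 = 0" "h 1 = 1"
  shows "eval_tpoly h (quartic a) v
    = (v $ 1) ^ 4 + (v $ 2) ^ 4 + (v $ 3) ^ 4 + h a * (v $ 1) ^ 2 * (v $ 2) ^ 2"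
proof -
  let ?S = "{(4, 0, 0), (0, 4, 0), (0, 0, 4), (2, 2, 0)} :: (nat \<times> nat \<times> nat) set"
  have "Poly_Mapping.keys (quartic a) \<subseteq> ?S"
    by (auto simp: quartic_def in_keys_iff lookup_add lookup_single when_def split: if_splits)
  then have "eval_tpoly h (quartic a) v = (\<Sum>(i, j, k) \<in> ?S.
     h (Poly_Mapping.lookup (quartic a) (i, j, k)) * (v $ 1) ^ i * (v $ 2) ^ j * (v $ 3) ^ k)"
    unfolding eval_tpoly_def
    by (intro sum.mono_neutral_left) (auto simp: in_keys_iff assms(1))
  also have "\<dots> = (v $ 1) ^ 4 + (v $ 2) ^ 4 + (v $ 3) ^ 4 + h a * (v $ 1) ^ 2 * (v $ 2) ^ 2"
    by (simp add: quartic_def lookup_add lookup_single when_def assms)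
  finally show ?thesis .
qed


section \<open>Local parameters, intersection with lines, flexes\<close>

text \<open>A formal parametrisation of the smooth curve \<open>F = 0\<close> at \<open>p\<close>: a power series
  solution of \<open>F = 0\<close> that starts at \<open>p\<close> with nonzero velocity in the projective plane
  (the coefficients of \<open>t ^ 0\<close> and \<open>t ^ 1\<close> are linearly independent). It identifies the
  completed local ring of the curve at \<open>p\<close> with the power series ring in \<open>t\<close>, so the
  order of vanishing at \<open>p\<close> is the order in \<open>t\<close>. Any two such parametrisations differ by
  a change of the parameter \<open>t\<close> and a unit factor, neither of which affects the orders
  below.\<close>

definition is_local_param :: "tpoly \<Rightarrow> proj_plane \<Rightarrow> complex fps^3 \<Rightarrow> bool" where
  "is_local_param F p \<gamma> \<longleftrightarrow>
     (let \<gamma>0 = (\<chi> m. fps_nth (\<gamma> $ m) 0); \<gamma>1 = (\<chi> m. fps_nth (\<gamma> $ m) 1)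
      in \<gamma>0 \<noteq> 0 \<and> abs_proj_plane \<gamma>0 = p \<and> (\<forall>c. \<gamma>1 \<noteq> c *s \<gamma>0) \<and> eval_tpoly fps_const F \<gamma> = 0)"

definition local_param :: "tpoly \<Rightarrow> proj_plane \<Rightarrow> complex fps^3" where
  "local_param F p = (SOME \<gamma>. is_local_param F p \<gamma>)"

text \<open>The intersection multiplicity at \<open>p\<close> of the curve \<open>F = 0\<close> with the line
  \<open>l $ 1 * x + l $ 2 * y + l $ 3 * z = 0\<close>: the order at \<open>p\<close> of the equation of the line
  along the curve. (The value is 0, instead of infinity, if the line is contained in the
  curve; this cannot happen on a smooth curve of degree at least 2.)\<close>

definition line_mult :: "tpoly \<Rightarrow> proj_plane \<Rightarrow> complex^3 \<Rightarrow> nat" where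
  "line_mult F p l = subdegree (\<Sum>m\<in>UNIV. fps_const (l $ m) * local_param F p $ m)"

text \<open>The coefficient vector of the tangent line at \<open>p\<close>, unique up to a scalar.\<close>

definition tangent_line :: "tpoly \<Rightarrow> proj_plane \<Rightarrow> complex^3" where
  "tangent_line F p = gradient F (rep_proj_plane p)"

definition ordinary_flexes :: "tpoly \<Rightarrow> proj_plane set" where
  "ordinary_flexes F = {p \<in> curve F. line_mult F p (tangent_line F p) = 3}"

definition hyperflexes :: "tpoly \<Rightarrow> proj_plane set" where
  "hyperflexes F = {p \<in> curve F. line_mult F p (tangent_line F p) = 4}"


section \<open>The function field, divisors and Riemann-Roch spaces\<close>

text \<open>A rational function on the smooth curve \<open>F = 0\<close> is a quotient \<open>A / B\<close> of forms of the
  same degree with \<open>B\<close> not vanishing identically on the curve, and \<open>A / B = A' / B'\<close> iff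
  \<open>A * B' - A' * B\<close> vanishes on the curve. It is represented here by the family of its
  Laurent expansions with respect to the chosen local parameters at all points of the curve
  (and 0 at the other points of the plane). This is the diagonal embedding of the function
  field into the product of the local fields; it is injective and respects the field
  operations, hence in particular the structure of a complex vector space.\<close>

type_synonym ratfun = "proj_plane \<Rightarrow> complex fls"

definition expansion :: "tpoly \<Rightarrow> tpoly \<Rightarrow> proj_plane \<Rightarrow> complex fls" where
  "expansion F A p = fps_to_fls (eval_tpoly fps_const A (local_param F p))"

definition function_field :: "tpoly \<Rightarrow> ratfun set" where
  "function_field F = {\<phi>. \<exists>d A B. homogeneous d A \<and> homogeneous d B \<and>
     (\<exists>v. v \<noteq> 0 \<and> value_at F v = 0 \<and> value_at B v \<noteq> 0) \<and>
     \<phi> = (\<lambda>p. if p \<in> curve F then expansion F A p / expansion F B p else 0)}"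

definition scale_ratfun :: "complex \<Rightarrow> ratfun \<Rightarrow> ratfun" where
  "scale_ratfun c \<phi> = (\<lambda>p. fls_const c * \<phi> p)"

lemma vector_space_scale_ratfun: "vector_space scale_ratfun"
  by unfold_locales
    (auto simp: scale_ratfun_def fun_eq_iff algebra_simps simp flip: fls_plus_const)

type_synonym divisor = "proj_plane \<Rightarrow> int"

text \<open>The nonzero rational differentials are the \<open>\<psi> d\<phi> \<noteq> 0\<close> with \<open>\<phi>\<close> and \<open>\<psi>\<close> in the
  function field. In the local parameter \<open>t\<close> at \<open>p\<close> such a differential reads
  \<open>\<psi> * (d\<phi> / dt) dt\<close>, so its order at \<open>p\<close> is that of the Laurent series
  \<open>\<psi> * d\<phi> / dt\<close>.\<close>

definition is_canonical_divisor :: "tpoly \<Rightarrow> divisor \<Rightarrow> bool" where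
  "is_canonical_divisor F K \<longleftrightarrow> (\<exists>\<phi>\<in>function_field F. \<exists>\<psi>\<in>function_field F.
     (\<exists>p\<in>curve F. \<psi> p * fls_deriv (\<phi> p) \<noteq> 0) \<and>
     K = (\<lambda>p. if p \<in> curve F then fls_subdegree (\<psi> p * fls_deriv (\<phi> p)) else 0))"

text \<open>Any two canonical divisors are linearly equivalent, so the choice does not affect the
  dimensions below.\<close>

definition canonical_divisor :: "tpoly \<Rightarrow> divisor" where
  "canonical_divisor F = (SOME K. is_canonical_divisor F K)"

definition RR_space :: "tpoly \<Rightarrow> divisor \<Rightarrow> ratfun set" where
  "RR_space F D = {\<phi> \<in> function_field F.
     \<phi> = (\<lambda>_. 0) \<or> (\<forall>p\<in>curve F. fls_subdegree (\<phi> p) \<ge> - D p)}"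

definition RR_dim :: "tpoly \<Rightarrow> divisor \<Rightarrow> nat" where
  "RR_dim F D = vector_space.dim scale_ratfun (RR_space F D)"


section \<open>Gaps and Weierstrass points\<close>

definition K_minus :: "tpoly \<Rightarrow> nat \<Rightarrow> proj_plane \<Rightarrow> divisor" where
  "K_minus F n p = (\<lambda>q. canonical_divisor F q - (if q = p then int n else 0))"

definition gaps :: "tpoly \<Rightarrow> proj_plane \<Rightarrow> nat set" where
  "gaps F p = {n. n \<ge> 1 \<and> RR_dim F (K_minus F (n - 1) p) > RR_dim F (K_minus F n p)}"

text \<open>The list index \<open>i\<close> starts at 0, and the length of the list is the genus.\<close>

definition weight :: "tpoly \<Rightarrow> proj_plane \<Rightarrow> int" where
  "weight F p = (let ns = sorted_list_of_set (gaps F p)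
     in \<Sum>i<length ns. int (ns ! i) - int (i + 1))"

definition weierstrass_points :: "tpoly \<Rightarrow> proj_plane set" where
  "weierstrass_points F = {p \<in> curve F. weight F p > 0}"

end

theory Submission
  imports Defs "HOL-Computational_Algebra.Fundamental_Theorem_Algebra"
begin

text \<open>
  Write the curve as \<open>z ^ 4 = - f x y\<close> with \<open>f = x ^ 4 + y ^ 4 + a x\<^sup>2 y\<^sup>2\<close> and let \<open>s\<close> be a root of \<open>f s 1\<close>.
  With the hyperflex tangent \<open>x = s y\<close> as line at infinity the curve becomes \<open>w ^ 4 = \<kappa> u\<close> for a cubic \<open>\<kappa>\<close>,
  with a single point at infinity, where \<open>u\<close> and \<open>w\<close> have poles of orders 4 and 3. Every rational
  function is \<open>(p\<^sub>0 + p\<^sub>1 w + p\<^sub>2 w\<^sup>2 + p\<^sub>3 w\<^sup>3) / b\<close> with polynomials in \<open>u\<close>; if it has no finite poles, then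
  \<open>b\<close> divides all \<open>p\<^sub>j\<close> (compare the four points over each root of \<open>b\<close>), and a pole of order at most 4 at
  infinity then leaves only the combinations of \<open>1, u, w\<close>. As \<open>du / w\<^sup>3\<close> has divisor \<open>4 \<infinity>\<close>, the
  space of \<open>K - n p\<close> is the space of linear forms vanishing to order \<open>n\<close> at \<open>p\<close>. So the gaps are
  \<open>1, 2, m + 1\<close>, where \<open>m\<close> is the multiplicity of the tangent line. Finally \<open>m \<ge> 3\<close> means \<open>z = 0\<close> or
  that the Hessian of \<open>f\<close> vanishes, and \<open>m = 4\<close> if in addition its Jacobian with \<open>f\<close>, a multiple of
  \<open>x y (x ^ 4 - y ^ 4)\<close>, vanishes.
\<close>

text \<open>The gaps are defined through a chosen canonical divisor and dimensions of spaces of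
  rational functions, so these spaces have to be computed outright. A hyperflex tangent at infinity
  makes this elementary. At the point at infinity \<open>1, w, w\<^sup>2, w\<^sup>3\<close> have
  orders distinct modulo 4, and so they have at every point with \<open>w = 0\<close>, while a
  polynomial in \<open>u\<close> has order divisible by 4 there. Hence the summands of a normal form
  cannot cancel, and orders can be read off the coefficients. The condition
  \<open>a ^ 2 \<noteq> 4\<close> says that \<open>f\<close> has four simple roots. Under it, the
  values 0, 6, -6 are exactly those for which the Hessian of \<open>f\<close> and
  \<open>x y (x ^ 4 - y ^ 4)\<close> have a common root. The sign of 6 cannot matter:
  \<open>(x, y, z) \<mapsto> (i x, y, z)\<close> carries the curves for \<open>a\<close> and
  \<open>-a\<close> into each other and normalizes the group.\<close>

unbundle no fps_syntax

section \<open>Points and projective transformations\<close>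

lemma rep_proj_plane_nonzero: "rep_proj_plane p \<noteq> 0"
  using Quotient3_rep_reflp[OF Quotient3_proj_plane, of p] by (simp add: proj_rel_def)

lemma abs_rep_proj_plane [simp]: "abs_proj_plane (rep_proj_plane p) = p"
  using Quotient3_abs_rep[OF Quotient3_proj_plane] .

lemma abs_proj_plane_eq_iff:
  assumes "u \<noteq> 0" "v \<noteq> 0"
  shows "abs_proj_plane u = abs_proj_plane v \<longleftrightarrow> (\<exists>c. c \<noteq> 0 \<and> v = c *s u)"
proof -
  have refl: "proj_rel w w" if "w \<noteq> 0" for w
    using that unfolding proj_rel_def by (auto intro!: exI[of _ 1])
  have "proj_rel u v \<longleftrightarrow> abs_proj_plane u = abs_proj_plane v"
    using Quotient3_rel[OF Quotient3_proj_plane, of u v] refl assms by auto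
  then show ?thesis using assms by (auto simp: proj_rel_def)
qed

abbreviation vec3 :: "'a::zero \<Rightarrow> 'a \<Rightarrow> 'a \<Rightarrow> 'a^3" where
  "vec3 x y z \<equiv> vector [x, y, z]"

definition pt :: "complex \<Rightarrow> complex \<Rightarrow> complex \<Rightarrow> proj_plane" where
  "pt x y z = abs_proj_plane (vec3 x y z)"

lemma vec3_eq_iff: "vec3 x y z = v \<longleftrightarrow> x = v $ 1 \<and> y = v $ 2 \<and> z = v $ 3"
  by (simp add: vec_eq_iff forall_3 vector_3)

lemma vec3_eq_0_iff [simp]: "vec3 x y z = 0 \<longleftrightarrow> x = 0 \<and> y = 0 \<and> z = 0"
  by (simp add: vec3_eq_iff)

lemma scale_vec3: "(c::complex) *s vec3 x y z = vec3 (c * x) (c * y) (c * z)"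
  by (simp add: vec_eq_iff forall_3 vector_3)

lemma vec3_collapse: "vec3 (v $ 1) (v $ 2) (v $ 3) = v"
  by (simp add: vec_eq_iff forall_3 vector_3)

lemma proj_plane_cases:
  obtains x y z where "p = pt x y z" "\<not> (x = 0 \<and> y = 0 \<and> z = 0)"
proof -
  have "p = pt (rep_proj_plane p $ 1) (rep_proj_plane p $ 2) (rep_proj_plane p $ 3)"
    by (simp add: pt_def vec3_collapse)
  moreover have "\<not> (rep_proj_plane p $ 1 = 0 \<and> rep_proj_plane p $ 2 = 0 \<and> rep_proj_plane p $ 3 = 0)"
    using rep_proj_plane_nonzero[of p] by (metis vec3_collapse vec3_eq_0_iff)
  ultimately show ?thesis using that by blast
qed

lemma pt_eq_iff:
  assumes "\<not> (x = 0 \<and> y = 0 \<and> z = 0)" "\<not> (x' = 0 \<and> y' = 0 \<and> z' = 0)"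
  shows "pt x y z = pt x' y' z' \<longleftrightarrow> (\<exists>c. c \<noteq> 0 \<and> x' = c * x \<and> y' = c * y \<and> z' = c * z)"
  using assms by (auto simp: pt_def abs_proj_plane_eq_iff scale_vec3 vec3_eq_iff vector_3)

lemma pt_affine_eq_iff [simp]: "pt x y 1 = pt x' y' 1 \<longleftrightarrow> x = x' \<and> y = y'"
  by (subst pt_eq_iff) auto

lemma pt_normalize: "z \<noteq> 0 \<Longrightarrow> pt x y z = pt (x / z) (y / z) 1"
  by (subst pt_eq_iff) (auto intro!: exI[of _ "inverse z"] simp: field_simps)

text \<open>\<open>proj_map\<close> acts on a chosen representative. Linearity turns another choice
  into a scalar factor, and the trivial kernel keeps the images away from 0, where
  \<open>abs_proj_plane\<close> has no meaning.\<close>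

lemma proj_map_abs_proj_plane:
  assumes "\<And>v. v \<noteq> 0 \<Longrightarrow> M *v v \<noteq> 0" "v \<noteq> 0"
  shows "proj_map M (abs_proj_plane v) = abs_proj_plane (M *v v)"
proof -
  let ?u = "rep_proj_plane (abs_proj_plane v)"
  have u: "?u \<noteq> 0" by (rule rep_proj_plane_nonzero)
  then obtain c where "c \<noteq> 0" "v = c *s ?u"
    using abs_proj_plane_eq_iff[OF u assms(2)] by auto
  then have "c \<noteq> 0 \<and> M *v v = c *s (M *v ?u)"
    by (metis vector_scalar_commute)
  then show ?thesis
    unfolding proj_map_def using assms u by (subst abs_proj_plane_eq_iff) auto
qed

section \<open>The symmetry group\<close>

text \<open>The sixteen elements of the group are \<open>(x, y, z) \<mapsto> (\<alpha> x, \<delta> \<alpha> y, z)\<close> and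
  \<open>(x, y, z) \<mapsto> (\<alpha> y, \<delta> \<alpha> x, z)\<close> with \<open>\<alpha>\<close> a fourth root of unity and \<open>\<delta> = \<plusminus>1\<close>.\<close>

definition mon_mat :: "bool \<times> complex \<times> complex \<Rightarrow> complex^3^3" where
  "mon_mat = (\<lambda>(t, \<alpha>, \<delta>). if t
     then vec3 (vec3 0 \<alpha> 0) (vec3 (\<delta> * \<alpha>) 0 0) (vec3 0 0 1)
     else vec3 (vec3 \<alpha> 0 0) (vec3 0 (\<delta> * \<alpha>) 0) (vec3 0 0 1))"

definition mon_index :: "(bool \<times> complex \<times> complex) set" where
  "mon_index = UNIV \<times> {\<alpha>. \<alpha> ^ 4 = 1} \<times> {\<delta>. \<delta> ^ 2 = 1}"

text \<open>The left factor is applied last. If it swaps, its first coordinate reads the second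
  coordinate of the right factor, whose coefficient is \<open>\<delta>' * \<alpha>'\<close>; this
  explains the extra \<open>\<delta>'\<close>. The other coefficient then fits because
  \<open>\<delta>' ^ 2 = 1\<close>.\<close>

fun mon_mult :: "bool \<times> complex \<times> complex \<Rightarrow> bool \<times> complex \<times> complex \<Rightarrow> bool \<times> complex \<times> complex" where
  "mon_mult (t, \<alpha>, \<delta>) (t', \<alpha>', \<delta>') = (t \<noteq> t', \<alpha> * \<alpha>' * (if t then \<delta>' else 1), \<delta> * \<delta>')"

abbreviation mon_map :: "bool \<times> complex \<times> complex \<Rightarrow> proj_plane \<Rightarrow> proj_plane" where
  "mon_map m \<equiv> proj_map (mon_mat m)"

lemma mon_mat_mult_vec3:
  "mon_mat (t, \<alpha>, \<delta>) *v v = vec3 (\<alpha> * (if t then v $ 2 else v $ 1)) (\<delta> * \<alpha> * (if t then v $ 1 else v $ 2)) (v $ 3)"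
  by (simp add: mon_mat_def vec_eq_iff forall_3 vector_3 matrix_vector_mult_def sum_3)

lemma power4_eq_1_iff: "(\<alpha>::complex) ^ 4 = 1 \<longleftrightarrow> \<alpha> = 1 \<or> \<alpha> = -1 \<or> \<alpha> = \<i> \<or> \<alpha> = -\<i>"
proof -
  have "\<alpha> ^ 4 - 1 = (\<alpha> - 1) * (\<alpha> + 1) * (\<alpha> - \<i>) * (\<alpha> + \<i>)"
    by (simp add: algebra_simps numeral_eq_Suc)
  then have "\<alpha> ^ 4 - 1 = 0 \<longleftrightarrow> \<alpha> - 1 = 0 \<or> \<alpha> + 1 = 0 \<or> \<alpha> - \<i> = 0 \<or> \<alpha> + \<i> = 0"
    by simp
  then show ?thesis by (simp add: eq_neg_iff_add_eq_0)
qed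

lemma mon_map_pt:
  assumes "(t, \<alpha>, \<delta>) \<in> mon_index" "\<not> (x = 0 \<and> y = 0 \<and> z = 0)"
  shows "mon_map (t, \<alpha>, \<delta>) (pt x y z) = pt (\<alpha> * (if t then y else x)) (\<delta> * \<alpha> * (if t then x else y)) z"
proof -
  have nz: "\<alpha> \<noteq> 0" "\<delta> \<noteq> 0" using assms(1) by (auto simp: mon_index_def)
  have "mon_mat (t, \<alpha>, \<delta>) *v v \<noteq> 0" if "v \<noteq> 0" for v
  proof -
    have "\<not> (v $ 1 = 0 \<and> v $ 2 = 0 \<and> v $ 3 = 0)"
      using that by (metis vec3_collapse vec3_eq_0_iff)
    then show ?thesis using nz by (auto simp: mon_mat_mult_vec3)
  qed
  then show ?thesis
    unfolding pt_def using assms(2)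
    by (subst proj_map_abs_proj_plane) (auto simp: mon_mat_mult_vec3 vector_3)
qed

lemma power4_eq_1_if_power2: "\<delta> ^ 2 = 1 \<Longrightarrow> (\<delta>::complex) ^ 4 = 1"
  by (auto simp: power4_eq_1_iff power2_eq_1_iff)

lemma mon_mult_closed: "m \<in> mon_index \<Longrightarrow> n \<in> mon_index \<Longrightarrow> mon_mult m n \<in> mon_index"
  by (cases m; cases n) (auto simp: mon_index_def power_mult_distrib power4_eq_1_if_power2)

lemma mon_map_mult:
  assumes "m \<in> mon_index" "n \<in> mon_index"
  shows "mon_map (mon_mult m n) = mon_map m \<circ> mon_map n"
proof
  fix p
  obtain x y z where p: "p = pt x y z" "\<not> (x = 0 \<and> y = 0 \<and> z = 0)" by (rule proj_plane_cases)
  obtain t \<alpha> \<delta> where m: "m = (t, \<alpha>, \<delta>)" by (cases m)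
  obtain t' \<alpha>' \<delta>' where n: "n = (t', \<alpha>', \<delta>')" by (cases n)
  have nz: "\<alpha>' \<noteq> 0" "\<delta>' \<noteq> 0" and d: "\<delta>' * \<delta>' = 1"
    using assms(2) by (auto simp: n mon_index_def power2_eq_square)
  have "mon_map (mon_mult m n) p
      = pt (\<alpha> * \<alpha>' * (if t then \<delta>' else 1) * (if t \<noteq> t' then y else x))
           (\<delta> * \<delta>' * (\<alpha> * \<alpha>' * (if t then \<delta>' else 1)) * (if t \<noteq> t' then x else y)) z"
    using mon_mult_closed[OF assms] p(2) unfolding p(1) m n mon_mult.simps
    by (subst mon_map_pt) auto
  moreover have "mon_map n p = pt (\<alpha>' * (if t' then y else x)) (\<delta>' * \<alpha>' * (if t' then x else y)) z"
    using assms(2) p(2) unfolding p(1) n by (rule mon_map_pt)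
  moreover have "mon_map m (pt (\<alpha>' * (if t' then y else x)) (\<delta>' * \<alpha>' * (if t' then x else y)) z)
      = pt (\<alpha> * (if t then \<delta>' * \<alpha>' * (if t' then x else y) else \<alpha>' * (if t' then y else x)))
           (\<delta> * \<alpha> * (if t then \<alpha>' * (if t' then y else x) else \<delta>' * \<alpha>' * (if t' then x else y))) z"
    using assms(1) p(2) nz unfolding m by (subst mon_map_pt) (auto split: if_splits)
  moreover have "\<delta> * \<delta>' * (\<alpha> * \<alpha>' * \<delta>') * e = \<delta> * \<alpha> * (\<alpha>' * e)" for e
    using d by (metis (no_types, lifting) mult.assoc mult.commute mult_1)
  ultimately show "mon_map (mon_mult m n) p = (mon_map m \<circ> mon_map n) p"
    using d by (cases t; cases t') (simp_all add: ac_simps, (metis mult.assoc mult_1)+)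
qed

lemma mon_map_one: "mon_map (False, 1, 1) = id"
proof
  fix p
  obtain x y z where p: "p = pt x y z" "\<not> (x = 0 \<and> y = 0 \<and> z = 0)" by (rule proj_plane_cases)
  then show "mon_map (False, 1, 1) p = id p"
    by (subst p(1), subst mon_map_pt) (auto simp: mon_index_def)
qed

text \<open>Solving \<open>X = \<alpha> y\<close>, \<open>Y = \<delta> \<alpha> x\<close> for a swap
  gives \<open>x = Y / (\<delta> \<alpha>)\<close>, and \<open>\<delta>\<close> is its own
  inverse.\<close>

fun mon_inv :: "bool \<times> complex \<times> complex \<Rightarrow> bool \<times> complex \<times> complex" where
  "mon_inv (t, \<alpha>, \<delta>) = (t, inverse \<alpha> * (if t then \<delta> else 1), \<delta>)"

lemma mon_inv_closed: "m \<in> mon_index \<Longrightarrow> mon_inv m \<in> mon_index"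
  by (cases m) (auto simp: mon_index_def power_mult_distrib power_inverse power4_eq_1_if_power2)

lemma mon_mult_inv:
  assumes "m \<in> mon_index"
  shows "mon_mult (mon_inv m) m = (False, 1, 1)" "mon_mult m (mon_inv m) = (False, 1, 1)"
proof -
  obtain t \<alpha> \<delta> where m: "m = (t, \<alpha>, \<delta>)" by (cases m)
  have "\<alpha> \<noteq> 0" and d: "\<delta> * \<delta> = 1" using assms by (auto simp: m mon_index_def power2_eq_square)
  moreover have "inverse \<alpha> * (\<delta> * (\<alpha> * \<delta>)) = (inverse \<alpha> * \<alpha>) * (\<delta> * \<delta>)"
    by (simp only: ac_simps)
  ultimately show "mon_mult (mon_inv m) m = (False, 1, 1)" "mon_mult m (mon_inv m) = (False, 1, 1)"
    by (simp_all add: m mult.assoc d)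
qed

lemma mon_map_inv:
  assumes "m \<in> mon_index"
  shows "mon_map (mon_inv m) \<circ> mon_map m = id" "mon_map m \<circ> mon_map (mon_inv m) = id"
  using mon_map_mult[OF mon_inv_closed[OF assms] assms] mon_map_mult[OF assms mon_inv_closed[OF assms]]
  by (simp_all add: mon_mult_inv[OF assms] mon_map_one)

lemma bij_mon_map: "m \<in> mon_index \<Longrightarrow> bij (mon_map m)"
  using mon_map_inv by (rule o_bij)

lemma Bij_UNIV: "Bij UNIV = Collect bij"
  by (auto simp: Bij_def extensional_def)

lemma BijGroup_UNIV_mult: "bij f \<Longrightarrow> bij g \<Longrightarrow> f \<otimes>\<^bsub>BijGroup UNIV\<^esub> g = f \<circ> g"
  by (auto simp: BijGroup_def Bij_UNIV compose_def)

lemma BijGroup_UNIV_inv: "bij f \<Longrightarrow> g \<circ> f = id \<Longrightarrow> inv\<^bsub>BijGroup UNIV\<^esub> f = g"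
proof -
  assume f: "bij f" "g \<circ> f = id"
  then have "g = inv_into UNIV f" by (metis bij_is_surj comp_assoc comp_id id_comp surj_iff)
  then have "bij g" using bij_imp_bij_inv[OF f(1)] by simp
  have "group (BijGroup (UNIV :: 'a set))" by (rule group_BijGroup)
  then show ?thesis
    using f \<open>bij g\<close> by (intro group.inv_equality) (auto simp: BijGroup_UNIV_mult, auto simp: BijGroup_def Bij_UNIV id_def)
qed

lemma subgroup_mon_map: "subgroup (mon_map ` mon_index) (BijGroup UNIV)"
proof (rule group.subgroupI[OF group_BijGroup])
  show "mon_map ` mon_index \<subseteq> carrier (BijGroup UNIV)"
    using bij_mon_map by (auto simp: BijGroup_def Bij_UNIV)
  show "mon_map ` mon_index \<noteq> {}" by (auto simp: mon_index_def intro!: exI[of _ 1])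
next
  fix g assume "g \<in> mon_map ` mon_index"
  then show "inv\<^bsub>BijGroup UNIV\<^esub> g \<in> mon_map ` mon_index"
    using BijGroup_UNIV_inv[OF bij_mon_map mon_map_inv(1)] mon_inv_closed by fastforce
next
  fix g h assume "g \<in> mon_map ` mon_index" "h \<in> mon_map ` mon_index"
  then obtain m n where mn: "m \<in> mon_index" "n \<in> mon_index" "g = mon_map m" "h = mon_map n" by auto
  then show "g \<otimes>\<^bsub>BijGroup UNIV\<^esub> h \<in> mon_map ` mon_index"
    using imageI[OF mon_mult_closed[OF mn(1,2)], of mon_map] mn
    by (simp add: BijGroup_UNIV_mult bij_mon_map mon_map_mult)
qed

lemma sigma_mat_eq: "sigma_mat = mon_mat (False, -1, -1)"
  and tau_mat_eq: "tau_mat = mon_mat (False, \<i>, -1)"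
  and rho_mat_eq: "rho_mat = mon_mat (True, -1, -1)"
  by (simp_all add: sigma_mat_def tau_mat_def rho_mat_def mon_mat_def)

text \<open>The work is to generate all sixteen maps. The product of sigma and tau multiplies
  \<open>(x, y)\<close> by \<open>-i\<close>, and its powers give every \<open>\<alpha>\<close> with
  \<open>\<delta> = 1\<close>; sigma then supplies \<open>\<delta> = -1\<close>, and rho the
  swaps.\<close>

lemma carrier_sym_group: "carrier sym_group = mon_map ` mon_index"
proof -
  let ?B = "BijGroup (UNIV :: proj_plane set)"
  let ?S = "{proj_map sigma_mat, proj_map tau_mat, proj_map rho_mat}"
  interpret B: group ?B by (rule group_BijGroup)
  have S: "?S \<subseteq> mon_map ` mon_index"
    by (auto simp: sigma_mat_eq tau_mat_eq rho_mat_eq mon_index_def image_iff)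
      (metis power4_eq_1_iff power_minus1_even power2_minus one_power2)+
  have SB: "?S \<subseteq> carrier ?B"
    using S subgroup.subset[OF subgroup_mon_map] by (rule subset_trans)
  have car: "carrier sym_group = generate ?B ?S"
    using SB by (simp add: sym_group_def carrier_subgroup_generated Int_absorb1)
  have mult: "mon_map (mon_mult m n) \<in> generate ?B ?S"
    if "mon_map m \<in> generate ?B ?S" "mon_map n \<in> generate ?B ?S" "m \<in> mon_index" "n \<in> mon_index" for m n
    using generate.eng[OF that(1,2)] by (simp add: BijGroup_UNIV_mult bij_mon_map that mon_map_mult)
  have \<sigma>: "mon_map (False, -1, -1) \<in> generate ?B ?S"
    and \<tau>: "mon_map (False, \<i>, -1) \<in> generate ?B ?S"
    and \<rho>: "mon_map (True, -1, -1) \<in> generate ?B ?S"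
    by (auto intro!: generate.incl simp: sigma_mat_eq tau_mat_eq rho_mat_eq)
  have I: "(False, \<i>, -1) \<in> mon_index" "(False, -1, -1) \<in> mon_index" "(True, -1, -1) \<in> mon_index"
    by (auto simp: mon_index_def)
  have 1: "mon_map (False, -\<i>, 1) \<in> generate ?B ?S"
    using mult[OF \<sigma> \<tau>] I by simp
  have J: "(False, -\<i>, 1) \<in> mon_index" by (auto simp: mon_index_def)
  have 2: "mon_map (False, -1, 1) \<in> generate ?B ?S"
    using mult[OF 1 1] J by simp
  have J2: "(False, -1, 1) \<in> mon_index" by (auto simp: mon_index_def)
  have 3: "mon_map (False, \<i>, 1) \<in> generate ?B ?S"
    using mult[OF 1 2] J J2 by simp
  have 4: "mon_map (False, 1, 1) \<in> generate ?B ?S"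
    using mult[OF 2 2] J2 by simp
  have scal: "mon_map (False, \<alpha>, 1) \<in> generate ?B ?S" if "\<alpha> ^ 4 = 1" for \<alpha>
    using that 1 2 3 4 by (auto simp: power4_eq_1_iff)
  have diag: "mon_map (False, \<alpha>, \<delta>) \<in> generate ?B ?S" if "\<alpha> ^ 4 = 1" "\<delta> ^ 2 = 1" for \<alpha> \<delta>
  proof (cases "\<delta> = 1")
    case False
    then have "\<delta> = -1" using that by (simp add: power2_eq_1_iff)
    then show ?thesis
      using mult[OF \<sigma> scal[of "-\<alpha>"]] I that by (simp add: mon_index_def)
  qed (use scal that in simp)
  have "mon_map (True, \<alpha>, \<delta>) \<in> generate ?B ?S" if "\<alpha> ^ 4 = 1" "\<delta> ^ 2 = 1" for \<alpha> \<delta>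
    using mult[OF diag[of "-\<alpha>" "-\<delta>"] \<rho>] I that by (simp add: mon_index_def)
  then have "mon_map ` mon_index \<subseteq> generate ?B ?S"
    using diag by (auto simp: mon_index_def) (metis (full_types))
  then show ?thesis
    using B.generate_subgroup_incl[OF S subgroup_mon_map] by (auto simp: car)
qed

text \<open>The fourth power of the first affine coordinate is \<open>x ^ 4\<close> or
  \<open>y ^ 4\<close> and so reveals whether there was a swap; the coordinates then determine
  \<open>\<alpha>\<close> and \<open>\<delta>\<close>.\<close>

lemma mon_map_orbit_inj:
  assumes "x \<noteq> 0" "y \<noteq> 0" "x ^ 4 \<noteq> y ^ 4"
  shows "inj_on (\<lambda>m. mon_map m (pt x y 1)) mon_index"
proof (rule inj_onI)
  fix m n assume mn: "m \<in> mon_index" "n \<in> mon_index" "mon_map m (pt x y 1) = mon_map n (pt x y 1)"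
  obtain t \<alpha> \<delta> where m: "m = (t, \<alpha>, \<delta>)" by (cases m)
  obtain t' \<alpha>' \<delta>' where n: "n = (t', \<alpha>', \<delta>')" by (cases n)
  have r: "\<alpha> ^ 4 = 1" "\<alpha>' ^ 4 = 1" "\<alpha> \<noteq> 0" using mn by (auto simp: m n mon_index_def)
  have eq: "\<alpha> * (if t then y else x) = \<alpha>' * (if t' then y else x)"
    "\<delta> * \<alpha> * (if t then x else y) = \<delta>' * \<alpha>' * (if t' then x else y)"
    using mn by (simp_all add: m n mon_map_pt)
  from eq(1) have "\<alpha> ^ 4 * (if t then y else x) ^ 4 = \<alpha>' ^ 4 * (if t' then y else x) ^ 4"
    by (metis power_mult_distrib)
  then have t: "t = t'" using r assms by (auto split: if_splits)
  then have "\<alpha> = \<alpha>'" using eq(1) assms by (auto split: if_splits)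
  then have "\<delta> = \<delta>'" using eq(2) assms t r by (auto split: if_splits)
  then show "m = n" using t \<open>\<alpha> = \<alpha>'\<close> by (simp add: m n)
qed

lemma card_mon_index: "card mon_index = 16"
proof -
  have "{\<alpha>::complex. \<alpha> ^ 4 = 1} = {1, -1, \<i>, -\<i>}" "{\<delta>::complex. \<delta> ^ 2 = 1} = {1, -1}"
    by (auto simp: power4_eq_1_iff power2_eq_1_iff)
  moreover have "card {1, -1, \<i>, -\<i>} = 4" "card {1, -1 :: complex} = 2"
    by (simp_all add: complex_eq_iff)
  ultimately show ?thesis
    unfolding mon_index_def by (simp only: card_cartesian_product card_UNIV_bool)
qed

lemma order_sym_group: "Coset.order sym_group = 16"
proof -
  \<comment> \<open>Any point with a free orbit separates the sixteen maps;
    \<open>[1 : 2 : 1]\<close> is one because \<open>1 ^ 4 \<noteq> 2 ^ 4\<close>.\<close>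
  have "inj_on (\<lambda>m. mon_map m (pt 1 2 1)) mon_index" by (rule mon_map_orbit_inj) auto
  then have "inj_on mon_map mon_index" unfolding inj_on_def by metis
  then show ?thesis by (simp add: Coset.order_def carrier_sym_group card_image card_mon_index)
qed

lemma group_action_restrict_sym_group:
  assumes "\<And>m p. m \<in> mon_index \<Longrightarrow> p \<in> C \<Longrightarrow> mon_map m p \<in> C"
  shows "group_action sym_group C (\<lambda>g. restrict g C)"
proof -
  interpret B: group "BijGroup (UNIV :: proj_plane set)" by (rule group_BijGroup)
  have grp: "group sym_group" unfolding sym_group_def by (rule B.group_subgroup_generated)
  have bij: "restrict (mon_map m) C \<in> Bij C" if "m \<in> mon_index" for m
  proof -
    have "mon_map m ` C = C"
    proof
      show "C \<subseteq> mon_map m ` C"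
      proof
        fix p assume "p \<in> C"
        then have "mon_map (mon_inv m) p \<in> C" using assms mon_inv_closed that by blast
        moreover have "mon_map m (mon_map (mon_inv m) p) = p"
          using mon_map_inv(2)[OF that] by (metis comp_apply id_apply)
        ultimately show "p \<in> mon_map m ` C" by (metis imageI)
      qed
    qed (use assms that in blast)
    then show ?thesis
      using bij_is_inj[OF bij_mon_map[OF that]] by (auto simp: Bij_def bij_betw_def inj_on_def)
  qed
  have "(\<lambda>g. restrict g C) \<in> hom sym_group (BijGroup C)"
  proof (rule homI)
    fix g assume "g \<in> carrier sym_group"
    then show "restrict g C \<in> carrier (BijGroup C)"
      using bij by (auto simp: carrier_sym_group BijGroup_def)
  next
    fix g h assume "g \<in> carrier sym_group" "h \<in> carrier sym_group"
    then obtain m n where mn: "m \<in> mon_index" "n \<in> mon_index" "g = mon_map m" "h = mon_map n"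
      by (auto simp: carrier_sym_group)
    have "g \<otimes>\<^bsub>sym_group\<^esub> h = g \<circ> h"
      using mn by (simp add: sym_group_def BijGroup_UNIV_mult bij_mon_map)
    moreover have "restrict g C \<otimes>\<^bsub>BijGroup C\<^esub> restrict h C = compose C (restrict g C) (restrict h C)"
      using bij mn by (simp add: BijGroup_def)
    moreover have "restrict (g \<circ> h) C = compose C (restrict g C) (restrict h C)"
      using assms[OF mn(2)] by (auto simp: compose_def fun_eq_iff mn(4))
    ultimately show "restrict (g \<otimes>\<^bsub>sym_group\<^esub> h) C = restrict g C \<otimes>\<^bsub>BijGroup C\<^esub> restrict h C"
      by simp
  qed
  then show ?thesis
    by (intro group_action.intro group_hom.intro group_hom_axioms.intro grp group_BijGroup)
qed

section \<open>Evaluation of forms\<close>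

lemma eval_tpoly_superset:
  assumes "h 0 = 0" "finite S" "Poly_Mapping.keys A \<subseteq> S"
  shows "eval_tpoly h A v = (\<Sum>m\<in>S. h (Poly_Mapping.lookup A m) * (v $ 1) ^ fst m * (v $ 2) ^ fst (snd m) * (v $ 3) ^ snd (snd m))"
  unfolding eval_tpoly_def split_def using assms
  by (intro sum.mono_neutral_cong_left) (auto simp: in_keys_iff)

lemma eval_tpoly_single:
  "h 0 = 0 \<Longrightarrow> eval_tpoly h (Poly_Mapping.single (i, j, k) c) v = h c * (v $ 1) ^ i * (v $ 2) ^ j * (v $ 3) ^ k"
  by (subst eval_tpoly_superset[of _ "{(i, j, k)}"]) (auto split: if_splits)

lemma eval_tpoly_zero [simp]: "eval_tpoly h 0 v = 0"
  by (simp add: eval_tpoly_def)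

lemma eval_tpoly_add:
  assumes "h 0 = 0" "\<And>x y. h (x + y) = h x + h y"
  shows "eval_tpoly h (A + B) v = eval_tpoly h A v + eval_tpoly h B v"
proof -
  let ?S = "Poly_Mapping.keys A \<union> Poly_Mapping.keys B"
  have "Poly_Mapping.keys (A + B) \<subseteq> ?S" by (rule Poly_Mapping.keys_add)
  then show ?thesis
    by (simp add: eval_tpoly_superset[where h = h and S = ?S, OF assms(1)] lookup_add assms(2) algebra_simps sum.distrib)
qed

lemma tpoly_induct [case_names zero single add]:
  fixes A :: tpoly
  assumes "P 0" "\<And>i j k c. P (Poly_Mapping.single (i, j, k) c)" "\<And>A B. P A \<Longrightarrow> P B \<Longrightarrow> P (A + B)"
  shows "P A"
proof (induction A rule: update_induct)
  case const
  then show ?case by (rule assms(1))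
next
  case (update A m c)
  have "Poly_Mapping.update m c A = A + Poly_Mapping.single m c"
    using update(1) by (intro poly_mapping_eqI)
      (auto simp: lookup_update lookup_add lookup_single in_keys_iff)
  then show ?case using assms(3)[OF update(3) assms(2)] by (cases m) simp
qed

lemma eval_tpoly_mult:
  assumes "h 0 = 0" "\<And>x y. h (x + y) = h x + h y" "\<And>x y. h (x * y) = h x * h y"
  shows "eval_tpoly h (A * B) v = eval_tpoly h A v * eval_tpoly h B v"
proof (induction A rule: tpoly_induct)
  case (single i j k c)
  show ?case
  proof (induction B rule: tpoly_induct)
    case (single i' j' k' c')
    then show ?case
      by (simp add: mult_single eval_tpoly_single assms power_add algebra_simps)
  next
    case (add A B)
    then show ?case by (simp add: distrib_left eval_tpoly_add assms)
  qed simp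
next
  case (add A B)
  then show ?case by (simp add: distrib_right eval_tpoly_add assms)
qed simp

lemma homogeneous_single: "i + j + k = d \<Longrightarrow> homogeneous d (Poly_Mapping.single (i, j, k) c)"
  by (simp add: homogeneous_def)

lemma homogeneous_add: "homogeneous d A \<Longrightarrow> homogeneous d B \<Longrightarrow> homogeneous d (A + B)"
  using Poly_Mapping.keys_add[of A B] by (auto simp: homogeneous_def)

lemma homogeneous_mult: "homogeneous d A \<Longrightarrow> homogeneous e B \<Longrightarrow> homogeneous (d + e) (A * B)"
  using keys_mult[of A B] by (fastforce simp: homogeneous_def)

lemma eval_tpoly_scale:
  assumes "homogeneous d A"
  shows "eval_tpoly h A (c *s v) = c ^ d * eval_tpoly h A v"
proof -
  have "c ^ d = c ^ i * c ^ j * c ^ k" if "(i, j, k) \<in> Poly_Mapping.keys A" for i j k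
    using assms that by (auto simp: homogeneous_def simp flip: power_add)
  then show ?thesis
    unfolding eval_tpoly_def sum_distrib_left
    by (intro sum.cong refl) (auto simp: power_mult_distrib)
qed

lemma nth_0_eval_tpoly:
  "fps_nth (eval_tpoly fps_const A \<gamma>) 0 = value_at A (\<chi> m. fps_nth (\<gamma> $ m) 0)"
  unfolding eval_tpoly_def by (simp add: fps_sum_nth split_def fps_nth_power_0)

section \<open>The quartic\<close>

lemma value_at_quartic:
  "value_at (quartic a) v = (v $ 1) ^ 4 + (v $ 2) ^ 4 + (v $ 3) ^ 4 + a * (v $ 1) ^ 2 * (v $ 2) ^ 2"
  by (rule eval_tpoly_quartic) auto

lemma homogeneous_quartic: "homogeneous 4 (quartic a)"
  unfolding quartic_def by (intro homogeneous_add homogeneous_single) auto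

lemma gradient_quartic:
  "gradient (quartic a) v = vec3 (4 * (v $ 1) ^ 3 + 2 * a * v $ 1 * (v $ 2) ^ 2)
     (4 * (v $ 2) ^ 3 + 2 * a * (v $ 1) ^ 2 * v $ 2) (4 * (v $ 3) ^ 3)"
proof -
  have "((\<lambda>s. value_at (quartic a) (v + s *s axis m 1)) has_field_derivative
      4 * (v $ 1) ^ 3 * axis m 1 $ 1 + 4 * (v $ 2) ^ 3 * axis m 1 $ 2 + 4 * (v $ 3) ^ 3 * axis m 1 $ 3
      + a * (2 * v $ 1 * axis m 1 $ 1 * (v $ 2) ^ 2 + (v $ 1) ^ 2 * (2 * v $ 2 * axis m 1 $ 2))) (at 0)" for m
    unfolding value_at_quartic
    by (auto intro!: derivative_eq_intros simp: algebra_simps)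
  note D = DERIV_imp_deriv[OF this]
  show ?thesis
    unfolding gradient_def D by (simp add: vec_eq_iff forall_3 vector_3 axis_def)
qed

lemma mem_curve_quartic_iff:
  assumes "\<not> (x = 0 \<and> y = 0 \<and> z = 0)"
  shows "pt x y z \<in> curve (quartic a) \<longleftrightarrow> x ^ 4 + y ^ 4 + z ^ 4 + a * x ^ 2 * y ^ 2 = 0"
proof
  assume "pt x y z \<in> curve (quartic a)"
  then obtain v where v: "pt x y z = abs_proj_plane v" "v \<noteq> 0" "value_at (quartic a) v = 0"
    by (auto simp: curve_def)
  then obtain c where "c \<noteq> 0" "v = c *s vec3 x y z"
    using assms unfolding pt_def by (subst (asm) abs_proj_plane_eq_iff) auto
  then have "value_at (quartic a) (vec3 x y z) = 0"
    using v(3) eval_tpoly_scale[OF homogeneous_quartic, of "\<lambda>c. c"] by simp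
  then show "x ^ 4 + y ^ 4 + z ^ 4 + a * x ^ 2 * y ^ 2 = 0" by (simp add: value_at_quartic vector_3)
next
  assume "x ^ 4 + y ^ 4 + z ^ 4 + a * x ^ 2 * y ^ 2 = 0"
  then show "pt x y z \<in> curve (quartic a)"
    using assms unfolding curve_def pt_def
    by (auto intro!: exI[of _ "vec3 x y z"] simp: value_at_quartic vector_3)
qed

lemma mon_map_curve_quartic:
  assumes "m \<in> mon_index" "p \<in> curve (quartic a)"
  shows "mon_map m p \<in> curve (quartic a)"
proof -
  obtain x y z where p: "p = pt x y z" "\<not> (x = 0 \<and> y = 0 \<and> z = 0)" by (rule proj_plane_cases)
  obtain t \<alpha> \<delta> where m: "m = (t, \<alpha>, \<delta>)" by (cases m)
  have r: "\<alpha> ^ 4 = 1" "\<delta> ^ 2 = 1" "\<delta> ^ 4 = 1" "\<alpha> \<noteq> 0" "\<delta> \<noteq> 0"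
    using assms(1) by (auto simp: m mon_index_def power4_eq_1_if_power2)
  have 2: "\<alpha>\<^sup>2 * (\<alpha>\<^sup>2 * c) = c" for c
    using r(1) by (simp add: mult.assoc[symmetric] flip: power_add)
  have "x ^ 4 + y ^ 4 + z ^ 4 + a * x ^ 2 * y ^ 2 = 0"
    using assms(2) p(2) by (simp add: p(1) mem_curve_quartic_iff)
  then show ?thesis
    using assms(1) p(2) r unfolding p(1) m
    by (subst mon_map_pt, simp, simp, subst mem_curve_quartic_iff)
      (auto simp: power_mult_distrib algebra_simps 2)
qed

text \<open>The hypotheses are the halved partial derivatives of \<open>f\<close>. Once
  \<open>x\<close> and \<open>y\<close> are cancelled they form a linear system in
  \<open>x ^ 2\<close> and \<open>y ^ 2\<close> with determinant \<open>4 - a ^ 2\<close> up to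
  sign.\<close>

lemma gradient_quartic_eq_0_imp:
  assumes "a ^ 2 \<noteq> 4" "2 * x ^ 3 + a * x * y ^ 2 = 0" "2 * y ^ 3 + a * x ^ 2 * y = (0::complex)"
  shows "x = 0 \<and> y = 0"
proof (rule ccontr)
  assume nz: "\<not> (x = 0 \<and> y = 0)"
  have x: "x \<noteq> 0" and y: "y \<noteq> 0" using assms nz by auto
  have "x * (2 * x ^ 2 + a * y ^ 2) = 0" "y * (2 * y ^ 2 + a * x ^ 2) = 0"
    using assms by (simp_all add: algebra_simps power2_eq_square power3_eq_cube)
  then have *: "2 * x ^ 2 + a * y ^ 2 = 0" "2 * y ^ 2 + a * x ^ 2 = 0" using x y by auto
  have "(4 - a ^ 2) * x ^ 2 = 2 * (2 * x ^ 2 + a * y ^ 2) - a * (2 * y ^ 2 + a * x ^ 2)"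
    by (simp add: algebra_simps power2_eq_square)
  then show False using * x assms(1) by simp
qed

lemma smooth_quartic:
  assumes "a ^ 2 \<noteq> 4"
  shows "smooth_plane_curve 4 (quartic a)"
proof -
  have "gradient (quartic a) v \<noteq> 0" if "v \<noteq> 0" for v
  proof
    assume g: "gradient (quartic a) v = 0"
    then have "2 * (v $ 1) ^ 3 + a * v $ 1 * (v $ 2) ^ 2 = 0" "2 * (v $ 2) ^ 3 + a * (v $ 1) ^ 2 * v $ 2 = 0" "v $ 3 = 0"
      by (auto simp: gradient_quartic) algebra+
    then have "v $ 1 = 0 \<and> v $ 2 = 0 \<and> v $ 3 = 0"
      using gradient_quartic_eq_0_imp[OF assms] by blast
    then show False using that by (metis vec3_collapse vec3_eq_0_iff)
  qed
  moreover have "Poly_Mapping.lookup (quartic a) (4, 0, 0) = 1"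
    by (simp add: quartic_def lookup_add lookup_single)
  then have "quartic a \<noteq> 0" by auto
  ultimately show ?thesis
    by (simp add: smooth_plane_curve_def homogeneous_quartic)
qed

section \<open>Local parameters of the quartic\<close>

lemma fourth_root_exists: obtains r :: complex where "r ^ 4 = k"
proof
  show "csqrt (csqrt k) ^ 4 = k"
    using power_mult[of "csqrt (csqrt k)" 2 2] by simp
qed

lemma fps_fourth_root_exists:
  fixes f :: "complex fps"
  assumes "fps_nth f 0 = c ^ 4" "c \<noteq> 0"
  obtains g where "g ^ 4 = f" "fps_nth g 0 = c"
proof
  \<comment> \<open>The first argument of \<open>fps_radical\<close> prescribes the root of the
    constant coefficient, here \<open>c\<close>.\<close>
  let ?g = "fps_radical (\<lambda>_ _. c) (Suc 3) f"
  show "?g ^ 4 = f"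
    using power_radical[of f "\<lambda>_ _. c" 3] assms by (simp add: numeral_eq_Suc)
  show "fps_nth ?g 0 = c" by simp
qed

text \<open>If \<open>z \<noteq> 0\<close>, the pair \<open>(x, y)\<close> may move along a line,
  and the equation is solved for \<open>z\<close> by a fourth root. If \<open>z = 0\<close>, the
  quartic is ramified over the line of ratios \<open>x / y\<close>, and \<open>z\<close> has to
  carry the linear term.\<close>

lemma local_param_quartic_exists:
  assumes "p \<in> curve (quartic a)" "a ^ 2 \<noteq> 4"
  shows "\<exists>\<gamma>. is_local_param (quartic a) p \<gamma>"
proof -
  obtain x y z where p: "p = pt x y z" "\<not> (x = 0 \<and> y = 0 \<and> z = 0)" by (rule proj_plane_cases)
  have eq: "x ^ 4 + y ^ 4 + z ^ 4 + a * x ^ 2 * y ^ 2 = 0"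
    using assms p by (simp add: mem_curve_quartic_iff)
  have intro: "is_local_param (quartic a) p (vec3 X Y Z)"
    if "X ^ 4 + Y ^ 4 + Z ^ 4 + fps_const a * X ^ 2 * Y ^ 2 = 0"
      "fps_nth X 0 = x" "fps_nth Y 0 = y" "fps_nth Z 0 = z"
      "\<And>c. \<not> (fps_nth X 1 = c * x \<and> fps_nth Y 1 = c * y \<and> fps_nth Z 1 = c * z)" for X Y Z
  proof -
    have "(\<chi> m. fps_nth (vec3 X Y Z $ m) n) = vec3 (fps_nth X n) (fps_nth Y n) (fps_nth Z n)" for n
      by (simp add: vec_eq_iff forall_3 vector_3)
    then show ?thesis
      using that p(2) unfolding is_local_param_def Let_def
      by (auto simp: eval_tpoly_quartic vector_3 pt_def p(1) scale_vec3 vec3_eq_iff)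
  qed
  show ?thesis
  proof (cases "z = 0")
    case False
    \<comment> \<open>A direction not proportional to \<open>(x, y)\<close> gives nonzero velocity
      in the projective plane, whatever the linear term of \<open>z\<close> turns out to be.\<close>
    obtain \<alpha> \<beta> where ab: "x * \<beta> \<noteq> y * \<alpha>"
    proof (cases "x = 0")
      case True
      then have "y \<noteq> 0" using eq False by auto
      then show ?thesis using that[of 0 1] that[of 1 0] by simp
    next
      case False
      then show ?thesis using that[of 1 0] by simp
    qed
    define X where "X = fps_const x + fps_const \<alpha> * fps_X"
    define Y where "Y = fps_const y + fps_const \<beta> * fps_X"
    have XY: "fps_nth X 0 = x" "fps_nth Y 0 = y" "fps_nth X 1 = \<alpha>" "fps_nth Y 1 = \<beta>"
      by (simp_all add: X_def Y_def)
    have "fps_nth (- (X ^ 4 + Y ^ 4 + fps_const a * X ^ 2 * Y ^ 2)) 0 = z ^ 4"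
      using eq by (simp add: XY fps_nth_power_0) algebra
    then obtain Z where Z: "Z ^ 4 = - (X ^ 4 + Y ^ 4 + fps_const a * X ^ 2 * Y ^ 2)" "fps_nth Z 0 = z"
      using False by (rule fps_fourth_root_exists)
    have "is_local_param (quartic a) p (vec3 X Y Z)"
      using ab by (intro intro) (auto simp: Z XY XY[unfolded One_nat_def])
    then show ?thesis ..
  next
    case True
    text \<open>Restricted to \<open>y\<close> fixed, \<open>x ^ 4 + y ^ 4 + a x\<^sup>2 y\<^sup>2\<close> has the simple root \<open>x\<close>,
      so replacing \<open>x\<close> by \<open>x + t ^ 4\<close> gives \<open>t ^ 4\<close> times a unit, which is a fourth power.\<close>
    define k where "k = 4 * x ^ 3 + 2 * a * x * y ^ 2"
    \<comment> \<open>\<open>k\<close> is the derivative of \<open>f\<close> by \<open>x\<close>. If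
      it vanished, Euler's relation would make the derivative by \<open>y\<close> vanish too, at a
      nonzero zero of \<open>f\<close>.\<close>
    have "k \<noteq> 0"
    proof
      assume k: "k = 0"
      have *: "y * (4 * y ^ 3 + 2 * a * x ^ 2 * y) = 4 * (x ^ 4 + y ^ 4 + a * x ^ 2 * y ^ 2) - x * k"
        by (simp add: k_def algebra_simps numeral_eq_Suc)
      have "y * (4 * y ^ 3 + 2 * a * x ^ 2 * y) = 0" unfolding * using eq True k by simp
      then have y: "y = 0 \<or> 4 * y ^ 3 + 2 * a * x ^ 2 * y = 0" by simp
      have "x \<noteq> 0 \<and> y \<noteq> 0" using eq True p(2) by auto
      with y have "4 * y ^ 3 + 2 * a * x ^ 2 * y = 0" by simp
      then have "2 * y ^ 3 + a * x ^ 2 * y = 0" by algebra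
      moreover have "2 * x ^ 3 + a * x * y ^ 2 = 0" using k unfolding k_def by algebra
      ultimately show False using gradient_quartic_eq_0_imp[OF assms(2), of x y] \<open>x \<noteq> 0 \<and> y \<noteq> 0\<close> by auto
    qed
    define T :: "complex fps" where "T = fps_X ^ 4"
    \<comment> \<open>This is the Taylor expansion
      \<open>f (x + T) y = f x y + T * H\<close>.\<close>
    define H where "H = fps_const k + fps_const (6 * x ^ 2 + a * y ^ 2) * T + fps_const (4 * x) * T ^ 2 + T ^ 3"
    have T0: "fps_nth T 0 = 0" "fps_nth T 1 = 0" by (simp_all add: T_def)
    obtain r where r: "r ^ 4 = - k" by (rule fourth_root_exists)
    then have "fps_nth (- H) 0 = r ^ 4" "r \<noteq> 0" using \<open>k \<noteq> 0\<close> by (auto simp: H_def T0 fps_nth_power_0)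
    then obtain R where R: "R ^ 4 = - H" "fps_nth R 0 = r" by (rule fps_fourth_root_exists)
    define X where "X = fps_const x + T"
    define Y where "Y = fps_const y"
    define Z where "Z = fps_X * R"
    have "Z ^ 4 = - (T * H)" by (simp add: Z_def power_mult_distrib R T_def)
    have "X ^ 4 + Y ^ 4 + fps_const a * X ^ 2 * Y ^ 2
        = fps_const (x ^ 4 + y ^ 4 + a * x ^ 2 * y ^ 2) + T * H"
      unfolding X_def Y_def H_def k_def
      by (simp add: algebra_simps numeral_eq_Suc fps_const_add[symmetric] fps_const_mult[symmetric] numeral_fps_const[symmetric] del: fps_const_add fps_const_mult)
    then have "X ^ 4 + Y ^ 4 + Z ^ 4 + fps_const a * X ^ 2 * Y ^ 2 = 0"
      using eq True \<open>Z ^ 4 = - (T * H)\<close> by (simp add: algebra_simps)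
    then have "is_local_param (quartic a) p (vec3 X Y Z)"
      using \<open>r \<noteq> 0\<close> True by (intro intro) (auto simp: X_def Y_def Z_def T0 R)
    then show ?thesis ..
  qed
qed

lemma is_local_param_quartic:
  "p \<in> curve (quartic a) \<Longrightarrow> a ^ 2 \<noteq> 4 \<Longrightarrow> is_local_param (quartic a) p (local_param (quartic a) p)"
  unfolding local_param_def by (rule someI_ex[OF local_param_quartic_exists])

notation fls_nth (infixl "$$" 75)

section \<open>Orders of Laurent series\<close>

lemma fls_nth_0_mult:
  fixes f g :: "'a::idom fls"
  assumes "fls_subdegree f \<ge> 0" "fls_subdegree g \<ge> 0"
  shows "(f * g) $$ 0 = f $$ 0 * g $$ 0"
proof -
  have "f = fps_to_fls (fls_regpart f)" "g = fps_to_fls (fls_regpart g)"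
    using assms by (simp_all add: fls_regpart_to_fls_trivial)
  then obtain F G where FG: "f = fps_to_fls F" "g = fps_to_fls G" by blast
  show ?thesis
    by (simp add: FG flip: fls_times_fps_to_fls)
qed

lemma fls_subdegree_add_ge_0:
  "fls_subdegree f \<ge> 0 \<Longrightarrow> fls_subdegree g \<ge> 0 \<Longrightarrow> fls_subdegree (f + g) \<ge> 0"
  by (rule fls_subdegree_ge0I) auto

lemma fls_subdegree_power_ge_0: "fls_subdegree f \<ge> 0 \<Longrightarrow> fls_subdegree ((f::'a::idom fls) ^ n) \<ge> 0"
  by (simp add: fls_subdegree_pow)

lemma fls_nth_0_power: "fls_subdegree f \<ge> 0 \<Longrightarrow> ((f::'a::idom fls) ^ n) $$ 0 = (f $$ 0) ^ n"
  by (induction n) (simp_all add: fls_nth_0_mult fls_subdegree_power_ge_0)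

lemma fls_nth_sum: "(\<Sum>j\<in>J. t j) $$ n = (\<Sum>j\<in>J. t j $$ n)"
  by (induction J rule: infinite_finite_induct) simp_all

lemma fls_subdegree_sum_ge_0: "(\<And>j. j \<in> J \<Longrightarrow> fls_subdegree (t j) \<ge> 0) \<Longrightarrow> fls_subdegree (\<Sum>j\<in>J. t j) \<ge> 0"
  by (rule fls_subdegree_ge0I)
    (auto simp: fls_nth_sum intro!: sum.neutral fls_eq0_below_subdegree elim: less_le_trans)

text \<open>The summand of least order has nothing to cancel against. Zero summands are exempt from
  the distinctness condition since \<open>fls_subdegree\<close> is 0 on the zero series by
  convention.\<close>

lemma fls_subdegree_sum_distinct:
  fixes t :: "nat \<Rightarrow> 'a::comm_ring_1 fls"
  assumes "finite J" "j \<in> J" "t j \<noteq> 0"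
    and "\<And>i k. i \<in> J \<Longrightarrow> k \<in> J \<Longrightarrow> i \<noteq> k \<Longrightarrow> t i \<noteq> 0 \<Longrightarrow> t k \<noteq> 0 \<Longrightarrow> fls_subdegree (t i) \<noteq> fls_subdegree (t k)"
  shows "sum t J \<noteq> 0" "fls_subdegree (sum t J) \<le> fls_subdegree (t j)"
proof -
  let ?J = "{i \<in> J. t i \<noteq> 0}"
  have fin: "finite ?J" and ne: "?J \<noteq> {}" using assms by auto
  obtain k where k: "k \<in> ?J" "\<And>i. i \<in> ?J \<Longrightarrow> fls_subdegree (t k) \<le> fls_subdegree (t i)"
    using arg_min_if_finite[OF fin ne, of "\<lambda>i. fls_subdegree (t i)"] by (meson linorder_not_less)
  have "sum t J $$ fls_subdegree (t k) = (\<Sum>i\<in>J. t i $$ fls_subdegree (t k))"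
    by (simp add: fls_nth_sum)
  also have "\<dots> = (\<Sum>i\<in>{k}. t i $$ fls_subdegree (t k))"
  proof (rule sum.mono_neutral_right)
    show "\<forall>i\<in>J - {k}. t i $$ fls_subdegree (t k) = 0"
    proof
      fix i assume i: "i \<in> J - {k}"
      show "t i $$ fls_subdegree (t k) = 0"
      proof (cases "t i = 0")
        case False
        then have "fls_subdegree (t k) < fls_subdegree (t i)"
          using k(2)[of i] assms(4)[of i k] i k(1) by force
        then show ?thesis by simp
      qed simp
    qed
  qed (use assms(1) k in auto)
  finally have nz: "sum t J $$ fls_subdegree (t k) \<noteq> 0" using k(1) by simp
  then show "sum t J \<noteq> 0" by auto
  show "fls_subdegree (sum t J) \<le> fls_subdegree (t j)"
    using fls_subdegree_leI[OF nz] k(2)[of j] assms(2,3) by simp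
qed

section \<open>Polynomials evaluated at Laurent series\<close>

definition evp :: "complex poly \<Rightarrow> complex fls \<Rightarrow> complex fls" where
  "evp p x = poly (map_poly fls_const p) x"

lemma evp_0 [simp]: "evp 0 x = 0"
  by (simp add: evp_def)

lemma evp_pCons [simp]: "evp (pCons c p) x = fls_const c + x * evp p x"
  by (simp add: evp_def map_poly_pCons)

lemma evp_add [simp]: "evp (p + q) x = evp p x + evp q x"
proof (induction p arbitrary: q)
  case (pCons c p)
  then show ?case
    by (cases q) (simp add: algebra_simps flip: fls_plus_const)
qed simp

lemma evp_smult [simp]: "evp (smult c p) x = fls_const c * evp p x"
  by (induction p) (simp_all add: algebra_simps flip: fls_const_mult_const)

lemma evp_minus [simp]: "evp (- p) x = - evp p x"
  using evp_smult[of "-1" p x] by (simp)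

lemma evp_diff [simp]: "evp (p - q) x = evp p x - evp q x"
  using evp_add[of p "- q" x] by simp

lemma evp_mult [simp]: "evp (p * q) x = evp p x * evp q x"
  by (induction p) (simp_all add: algebra_simps)

lemma evp_1 [simp]: "evp 1 x = 1"
  by (simp add: one_pCons)

lemma evp_power [simp]: "evp (p ^ n) x = evp p x ^ n"
  by (induction n) simp_all

lemma fls_deriv_evp: "fls_deriv (evp p x) = evp (pderiv p) x * fls_deriv x"
  by (induction p) (simp_all add: pderiv_pCons algebra_simps)

lemma evp_subdegree_ge_0: "fls_subdegree x \<ge> 0 \<Longrightarrow> fls_subdegree (evp p x) \<ge> 0"
  by (induction p) (simp_all add: fls_subdegree_add_ge_0 fls_mult_subdegree_ge_0)

lemma evp_nth_0: "fls_subdegree x \<ge> 0 \<Longrightarrow> evp p x $$ 0 = poly p (x $$ 0)"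
  by (induction p) (simp_all add: fls_nth_0_mult evp_subdegree_ge_0)

text \<open>In Horner's scheme the constant added to \<open>x * evp p x\<close> has no pole, so it
  cannot change the order of a pole.\<close>

lemma evp_pole:
  assumes "fls_subdegree x < 0" "p \<noteq> 0"
  shows "evp p x \<noteq> 0 \<and> fls_subdegree (evp p x) = fls_subdegree x * int (degree p)"
  using assms(2)
proof (induction p)
  case (pCons c p)
  show ?case
  proof (cases "p = 0")
    case False
    have x: "x \<noteq> 0" using assms(1) by auto
    have e: "evp p x \<noteq> 0" "fls_subdegree (evp p x) = fls_subdegree x * int (degree p)"
      using pCons False by auto
    have d: "fls_subdegree (x * evp p x) = fls_subdegree x * int (degree (pCons c p))"
      using x e False by (simp add: algebra_simps)
    have neg: "fls_subdegree (x * evp p x) < 0"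
      unfolding d using assms(1) False by (simp add: mult_neg_pos)
    have "fls_subdegree (x * evp p x + fls_const c) = fls_subdegree (x * evp p x)"
      using neg x e by (intro fls_subdegree_add_eq1) auto
    then show ?thesis using d neg by (auto simp: add.commute)
  qed (use pCons in auto)
qed simp

text \<open>Split off the full power of the root \<open>x $$ 0\<close>; the remaining factor has a
  nonzero constant term and thus order 0.\<close>

lemma evp_zero_order:
  assumes "fls_subdegree x \<ge> 0" "x \<noteq> fls_const (x $$ 0)" "p \<noteq> 0"
  shows "evp p x \<noteq> 0 \<and> fls_subdegree (evp p x) = int (Polynomial.order (x $$ 0) p) * fls_subdegree (x - fls_const (x $$ 0))"
proof -
  define r where "r = x $$ 0"
  obtain q where q: "p = [:- r, 1:] ^ Polynomial.order r p * q" "\<not> [:- r, 1:] dvd q"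
    using order_decomp[OF assms(3)] by blast
  have "poly q r \<noteq> 0" using q(2) by (simp add: poly_eq_0_iff_dvd)
  then have *: "evp q x $$ 0 \<noteq> 0" using evp_nth_0[OF assms(1)] by (simp add: r_def)
  then have "fls_subdegree (evp q x) = 0"
    using evp_subdegree_ge_0[OF assms(1), of q] fls_subdegree_leI[OF *] by simp
  moreover have "evp q x \<noteq> 0" using * by auto
  moreover have "evp [:- r, 1:] x = x - fls_const r" by (simp)
  moreover have "evp p x = evp [:- r, 1:] x ^ Polynomial.order r p * evp q x"
    by (subst q(1)) (simp only: evp_mult evp_power)
  ultimately show ?thesis
    using assms(2) by (simp add: fls_subdegree_pow r_def)
qed

lemma sum_lessThan_4: "(\<Sum>j<(4::nat). f j) = f 0 + f 1 + f 2 + (f 3 :: 'a::comm_monoid_add)"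
  by (simp add: numeral_eq_Suc)

text \<open>The values of \<open>v\<close> are \<open>w, - w, i w, - i w\<close>. Adding the four
  relations with suitable fourth roots of unity as weights isolates each coefficient up to the
  factor 4, as in a discrete Fourier transform.\<close>

lemma vandermonde_fourth_roots:
  fixes w :: complex
  assumes "w \<noteq> 0" "\<And>v. v ^ 4 = w ^ 4 \<Longrightarrow> c0 + c1 * v + c2 * v ^ 2 + c3 * v ^ 3 = 0"
  shows "c0 = 0" "c1 = 0" "c2 = 0" "c3 = 0"
proof -
  have ii: "\<i> ^ 2 = (-1::complex)" and iii: "\<i> ^ 3 = - \<i>" by (simp_all add: power3_eq_cube)
  have "c0 + c1 * w + c2 * w ^ 2 + c3 * w ^ 3 = 0" using assms(2)[of w] by simp
  moreover have "c0 - c1 * w + c2 * w ^ 2 - c3 * w ^ 3 = 0" using assms(2)[of "- w"] by simp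
  moreover have "c0 + \<i> * c1 * w - c2 * w ^ 2 - \<i> * c3 * w ^ 3 = 0"
    using assms(2)[of "\<i> * w"] by (simp add: power_mult_distrib iii algebra_simps)
  moreover have "c0 - \<i> * c1 * w - c2 * w ^ 2 + \<i> * c3 * w ^ 3 = 0"
    using assms(2)[of "- \<i> * w"] by (simp add: power_mult_distrib iii algebra_simps)
  ultimately have "4 * c0 = 0" "4 * w * c1 = 0" "4 * w ^ 2 * c2 = 0" "4 * w ^ 3 * c3 = 0"
    using ii by algebra+
  then show "c0 = 0" "c1 = 0" "c2 = 0" "c3 = 0" using assms(1) by auto
qed

section \<open>Regular and rational functions on a cyclic quartic cover of the line\<close>

text \<open>The curve \<open>w ^ 4 = \<kappa> u\<close>, given by the Laurent expansions of
  \<open>u\<close> and \<open>w\<close> at its points. It has one point \<open>\<infinity>\<close> over \<open>u = \<infinity>\<close>.\<close>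

locale cyclic_quartic_cover =
  fixes S :: "'p set" and u w :: "'p \<Rightarrow> complex fls" and \<kappa> :: "complex poly" and inf :: 'p
  assumes w_power4: "q \<in> S \<Longrightarrow> w q ^ 4 = evp \<kappa> (u q)"
    and inf_in: "inf \<in> S"
    and subdegree_u_inf: "fls_subdegree (u inf) = - 4"
    and subdegree_w_inf: "fls_subdegree (w inf) = - 3"
    and subdegree_u_finite: "q \<in> S \<Longrightarrow> q \<noteq> inf \<Longrightarrow> fls_subdegree (u q) \<ge> 0"
    and subdegree_w_finite: "q \<in> S \<Longrightarrow> q \<noteq> inf \<Longrightarrow> fls_subdegree (w q) \<ge> 0"
    and unramified: "q \<in> S \<Longrightarrow> q \<noteq> inf \<Longrightarrow> w q $$ 0 \<noteq> 0 \<Longrightarrow>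
        fls_subdegree (u q - fls_const (u q $$ 0)) = 1"
    and ramified: "q \<in> S \<Longrightarrow> q \<noteq> inf \<Longrightarrow> w q $$ 0 = 0 \<Longrightarrow>
        fls_subdegree (u q - fls_const (u q $$ 0)) = 4 \<and> fls_subdegree (w q) = 1"
    and finite_point: "poly \<kappa> u0 = w0 ^ 4 \<Longrightarrow> \<exists>q\<in>S. q \<noteq> inf \<and> u q $$ 0 = u0 \<and> w q $$ 0 = w0"
begin

text \<open>Since \<open>w ^ 4\<close> is a polynomial in \<open>u\<close>, every polynomial in
  \<open>u\<close> and \<open>w\<close> has such a normal form. Only the first four values of
  \<open>Q\<close> count, hence \<open>quad_zero\<close> in place of \<open>Q = 0\<close>.\<close>

definition ev :: "(nat \<Rightarrow> complex poly) \<Rightarrow> 'p \<Rightarrow> complex fls" where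
  "ev Q q = (\<Sum>j<4. evp (Q j) (u q) * w q ^ j)"

definition quad_zero :: "(nat \<Rightarrow> complex poly) \<Rightarrow> bool" where
  "quad_zero Q \<longleftrightarrow> (\<forall>j<4. Q j = 0)"

definition quad :: "complex poly \<Rightarrow> complex poly \<Rightarrow> complex poly \<Rightarrow> complex poly \<Rightarrow> nat \<Rightarrow> complex poly" where
  "quad p0 p1 p2 p3 j = (if j = 0 then p0 else if j = 1 then p1 else if j = 2 then p2 else p3)"

lemma ev_quad:
  "ev (quad p0 p1 p2 p3) q = evp p0 (u q) + evp p1 (u q) * w q + evp p2 (u q) * w q ^ 2 + evp p3 (u q) * w q ^ 3"
  by (simp add: ev_def quad_def sum_lessThan_4)

lemma ev_eq: "ev Q q = evp (Q 0) (u q) + evp (Q 1) (u q) * w q + evp (Q 2) (u q) * w q ^ 2 + evp (Q 3) (u q) * w q ^ 3"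
  by (simp add: ev_def sum_lessThan_4)

lemma quad_zero_iff: "quad_zero Q \<longleftrightarrow> Q 0 = 0 \<and> Q 1 = 0 \<and> Q 2 = 0 \<and> Q 3 = 0"
  by (auto simp: quad_zero_def less_Suc_eq numeral_eq_Suc)

lemma quad_zero_quad [simp]: "quad_zero (quad p0 p1 p2 p3) \<longleftrightarrow> p0 = 0 \<and> p1 = 0 \<and> p2 = 0 \<and> p3 = 0"
  by (simp add: quad_zero_iff quad_def)

lemma ev_quad_zero: "quad_zero Q \<Longrightarrow> ev Q q = 0"
  by (simp add: ev_def quad_zero_def)

text \<open>The functions \<open>1, w, w\<^sup>2, w\<^sup>3\<close> have orders \<open>0, -3, -6, -9\<close> at \<open>\<infinity>\<close>, which are distinct
  modulo \<open>4\<close>, while polynomials in \<open>u\<close> have orders divisible by \<open>4\<close>.\<close>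

lemma ev_inf:
  assumes "j < 4" "Q j \<noteq> 0"
  shows "ev Q inf \<noteq> 0" "fls_subdegree (ev Q inf) \<le> - 4 * int (degree (Q j)) - 3 * int j"
proof -
  let ?t = "\<lambda>j. evp (Q j) (u inf) * w inf ^ j"
  have w: "w inf \<noteq> 0" using subdegree_w_inf by auto
  have t: "?t i \<noteq> 0 \<and> fls_subdegree (?t i) = - 4 * int (degree (Q i)) - 3 * int i" if "Q i \<noteq> 0" for i
    using evp_pole[OF _ that, of "u inf"] w
    by (simp add: subdegree_u_inf subdegree_w_inf fls_subdegree_pow)
  have t0: "Q i \<noteq> 0" if "?t i \<noteq> 0" for i using that by auto
  have dist: "fls_subdegree (?t i) \<noteq> fls_subdegree (?t k)"
    if "i \<in> {..<4}" "k \<in> {..<4}" "i \<noteq> k" "?t i \<noteq> 0" "?t k \<noteq> 0" for i k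
  proof -
    have "- 4 * int (degree (Q i)) - 3 * int i \<noteq> - 4 * int (degree (Q k)) - 3 * int k"
      using that(1-3) by simp presburger
    then show ?thesis using t[OF t0] that(4,5) by simp
  qed
  show "ev Q inf \<noteq> 0"
    unfolding ev_def by (rule fls_subdegree_sum_distinct(1)[of _ j]) (use assms t dist in auto)
  have "fls_subdegree (ev Q inf) \<le> fls_subdegree (?t j)"
    unfolding ev_def by (rule fls_subdegree_sum_distinct(2)) (use assms t dist in auto)
  then show "fls_subdegree (ev Q inf) \<le> - 4 * int (degree (Q j)) - 3 * int j"
    using t[OF assms(2)] by simp
qed

lemma ev_inf_nonzero: "\<not> quad_zero Q \<Longrightarrow> ev Q inf \<noteq> 0"
  using ev_inf(1) by (auto simp: quad_zero_def)

lemma u_nonconst: "q \<in> S \<Longrightarrow> u q \<noteq> fls_const c"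
proof
  assume q: "q \<in> S" "u q = fls_const c"
  then have "q \<noteq> inf" using subdegree_u_inf by auto
  moreover have "fls_subdegree (u q - fls_const (u q $$ 0)) = 0" by (simp add: q(2))
  ultimately show False
    using unramified[OF q(1)] ramified[OF q(1)] by (cases "w q $$ 0 = 0") simp_all
qed

lemma evp_u_finite:
  assumes "q \<in> S" "q \<noteq> inf" "p \<noteq> 0"
  shows "evp p (u q) \<noteq> 0" "fls_subdegree (evp p (u q))
    = int (Polynomial.order (u q $$ 0) p) * (if w q $$ 0 = 0 then 4 else 1)"
  using evp_zero_order[OF subdegree_u_finite[OF assms(1,2)] u_nonconst[OF assms(1)] assms(3)]
    unramified[OF assms(1,2)] ramified[OF assms(1,2)] by auto

lemma evp_u_nonzero: "q \<in> S \<Longrightarrow> p \<noteq> 0 \<Longrightarrow> evp p (u q) \<noteq> 0"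
  using evp_u_finite(1)[of q p] evp_pole[of "u inf" p] by (cases "q = inf") (simp_all add: subdegree_u_inf)

lemma ev_finite:
  assumes "q \<in> S" "q \<noteq> inf"
  shows "fls_subdegree (ev Q q) \<ge> 0" "ev Q q $$ 0 = (\<Sum>j<4. poly (Q j) (u q $$ 0) * (w q $$ 0) ^ j)"
proof -
  have uw: "fls_subdegree (u q) \<ge> 0" "fls_subdegree (w q) \<ge> 0"
    using assms subdegree_u_finite subdegree_w_finite by auto
  then show "fls_subdegree (ev Q q) \<ge> 0"
    unfolding ev_def
    by (intro fls_subdegree_sum_ge_0 fls_mult_subdegree_ge_0 evp_subdegree_ge_0 fls_subdegree_power_ge_0)
  show "ev Q q $$ 0 = (\<Sum>j<4. poly (Q j) (u q $$ 0) * (w q $$ 0) ^ j)"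
    unfolding ev_def using uw
    by (simp add: fls_nth_sum fls_nth_0_mult evp_subdegree_ge_0 fls_subdegree_power_ge_0 fls_nth_0_power evp_nth_0)
qed

section \<open>The ring generated by \<open>u\<close> and \<open>w\<close>, and norms\<close>

definition regular :: "('p \<Rightarrow> complex fls) \<Rightarrow> bool" where
  "regular h \<longleftrightarrow> (\<exists>Q. \<forall>q\<in>S. h q = ev Q q)"

lemma regular_ev: "regular (ev Q)"
  by (auto simp: regular_def)

lemma regular_add: "regular h \<Longrightarrow> regular k \<Longrightarrow> regular (\<lambda>q. h q + k q)"
proof -
  assume "regular h" "regular k"
  then obtain P Q where "\<forall>q\<in>S. h q = ev P q" "\<forall>q\<in>S. k q = ev Q q" by (auto simp: regular_def)
  then have "\<forall>q\<in>S. h q + k q = ev (\<lambda>j. P j + Q j) q"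
    by (simp add: ev_eq algebra_simps)
  then show ?thesis unfolding regular_def by (rule exI[of _ "\<lambda>j. P j + Q j"])
qed

lemma regular_evp_mult: "regular h \<Longrightarrow> regular (\<lambda>q. evp p (u q) * h q)"
proof -
  assume "regular h"
  then obtain Q where "\<forall>q\<in>S. h q = ev Q q" by (auto simp: regular_def)
  then have "\<forall>q\<in>S. evp p (u q) * h q = ev (\<lambda>j. p * Q j) q"
    by (simp add: ev_eq algebra_simps)
  then show ?thesis unfolding regular_def by (rule exI[of _ "\<lambda>j. p * Q j"])
qed

text \<open>Multiplication by \<open>w\<close> shifts the four coefficients cyclically; the one that
  overflows returns with the factor \<open>\<kappa>\<close>.\<close>

lemma regular_w_mult: "regular h \<Longrightarrow> regular (\<lambda>q. w q * h q)"
proof -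
  assume "regular h"
  then obtain Q where Q: "\<forall>q\<in>S. h q = ev Q q" by (auto simp: regular_def)
  have "w q * h q = ev (quad (\<kappa> * Q 3) (Q 0) (Q 1) (Q 2)) q" if "q \<in> S" for q
  proof -
    have "w q * h q = evp (Q 3) (u q) * w q ^ 4 + evp (Q 0) (u q) * w q + evp (Q 1) (u q) * w q ^ 2 + evp (Q 2) (u q) * w q ^ 3"
      using Q that by (simp add: ev_eq algebra_simps numeral_eq_Suc)
    then show ?thesis using w_power4[OF that] by (simp add: ev_quad mult.commute)
  qed
  then show ?thesis unfolding regular_def by blast
qed

lemma regular_mult: "regular h \<Longrightarrow> regular k \<Longrightarrow> regular (\<lambda>q. h q * k q)"
proof -
  assume h: "regular h" and k: "regular k"
  obtain Q where Q: "\<forall>q\<in>S. h q = ev Q q" using h by (auto simp: regular_def)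
  have wk: "regular (\<lambda>q. w q ^ n * k q)" for n
    by (induction n) (use k regular_w_mult in \<open>auto simp: mult.assoc\<close>)
  have r: "regular (\<lambda>q. evp (Q 0) (u q) * (w q ^ 0 * k q) + (evp (Q 1) (u q) * (w q ^ 1 * k q)
      + (evp (Q 2) (u q) * (w q ^ 2 * k q) + evp (Q 3) (u q) * (w q ^ 3 * k q))))"
    by (intro regular_add regular_evp_mult wk)
  have "\<forall>q\<in>S. h q * k q = evp (Q 0) (u q) * (w q ^ 0 * k q) + (evp (Q 1) (u q) * (w q ^ 1 * k q)
      + (evp (Q 2) (u q) * (w q ^ 2 * k q) + evp (Q 3) (u q) * (w q ^ 3 * k q)))"
    using Q by (simp add: ev_eq algebra_simps)
  then show ?thesis using r unfolding regular_def by metis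
qed

lemma regular_evp: "regular (\<lambda>q. evp p (u q))"
  unfolding regular_def by (rule exI[of _ "quad p 0 0 0"]) (simp add: ev_quad)

lemma regular_const: "regular (\<lambda>q. fls_const c)"
  using regular_evp[of "[:c:]"] by simp

lemma regular_u: "regular u"
  using regular_evp[of "[:0, 1:]"] by (simp add: fun_eq_iff)

lemma regular_w: "regular w"
  unfolding regular_def by (rule exI[of _ "quad 0 1 0 0"]) (simp add: ev_quad)

lemma regular_power: "regular h \<Longrightarrow> regular (\<lambda>q. h q ^ n)"
  by (induction n) (use regular_const[of 1] in \<open>auto intro: regular_mult\<close>)

text \<open>The norm of \<open>D\<close> down to the rational functions of \<open>u\<close>, in two quadratic steps:
  \<open>D(w) D(- w) = G\<^sub>0 + G\<^sub>2 w\<^sup>2\<close>, and \<open>(G\<^sub>0 + G\<^sub>2 w\<^sup>2) (G\<^sub>0 - G\<^sub>2 w\<^sup>2) = G\<^sub>0\<^sup>2 - G\<^sub>2\<^sup>2 \<kappa>\<close>.\<close>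

lemma norm_exists:
  assumes "\<not> quad_zero D"
  obtains E b where "b \<noteq> 0" "\<And>q. q \<in> S \<Longrightarrow> ev D q * ev E q = evp b (u q)"
proof -
  define D' where "D' = quad (D 0) (- D 1) (D 2) (- D 3)"
  define G0 where "G0 = D 0 ^ 2 + \<kappa> * D 2 ^ 2 - 2 * \<kappa> * D 1 * D 3"
  define G2 where "G2 = 2 * D 0 * D 2 - D 1 ^ 2 - \<kappa> * D 3 ^ 2"
  define b where "b = G0 ^ 2 - \<kappa> * G2 ^ 2"
  have ev2: "evp 2 x = 2" for x
    using evp_add[of 1 1 x] by simp
  have 1: "ev D q * ev D' q = ev (quad G0 0 G2 0) q" if "q \<in> S" for q
  proof -
    have D': "ev D' q = evp (D 0) (u q) - evp (D 1) (u q) * w q + evp (D 2) (u q) * w q ^ 2 - evp (D 3) (u q) * w q ^ 3"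
      by (simp add: D'_def ev_quad)
    have "ev D q * ev D' q = evp (D 0) (u q) ^ 2 + w q ^ 4 * evp (D 2) (u q) ^ 2
         - 2 * w q ^ 4 * evp (D 1) (u q) * evp (D 3) (u q)
       + (2 * evp (D 0) (u q) * evp (D 2) (u q) - evp (D 1) (u q) ^ 2 - w q ^ 4 * evp (D 3) (u q) ^ 2) * w q ^ 2"
      unfolding D' ev_eq[of D] by (simp add: algebra_simps numeral_eq_Suc)
    then show ?thesis
      by (simp add: ev_quad G0_def G2_def w_power4[OF that] ev2)
  qed
  have 2: "ev (quad G0 0 G2 0) q * ev (quad G0 0 (- G2) 0) q = evp b (u q)" if "q \<in> S" for q
  proof -
    have "ev (quad G0 0 G2 0) q * ev (quad G0 0 (- G2) 0) q = evp G0 (u q) ^ 2 - w q ^ 4 * evp G2 (u q) ^ 2"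
      by (simp add: ev_quad algebra_simps numeral_eq_Suc)
    then show ?thesis by (simp add: b_def w_power4[OF that])
  qed
  have nz: "\<not> quad_zero D'" using assms unfolding D'_def quad_zero_quad quad_zero_iff[of D] by auto
  \<comment> \<open>The norm is shown to be nonzero at \<open>inf\<close>, where a normal form with
    a nonzero coefficient cannot vanish, once for each quadratic step.\<close>
  have "ev (quad G0 0 G2 0) inf \<noteq> 0"
    using 1[OF inf_in] ev_inf_nonzero[OF assms] ev_inf_nonzero[OF nz] by auto
  then have "\<not> quad_zero (quad G0 0 (- G2) 0)" using ev_quad_zero by fastforce
  then have "evp b (u inf) \<noteq> 0"
    using 2[OF inf_in] ev_inf_nonzero \<open>ev (quad G0 0 G2 0) inf \<noteq> 0\<close> by (metis mult_eq_0_iff)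
  then have b: "b \<noteq> 0" by auto
  have "regular (\<lambda>q. ev D' q * ev (quad G0 0 (- G2) 0) q)"
    by (intro regular_mult regular_ev)
  then obtain E where "\<forall>q\<in>S. ev D' q * ev (quad G0 0 (- G2) 0) q = ev E q"
    unfolding regular_def by blast
  then have "ev D q * ev E q = evp b (u q)" if "q \<in> S" for q
    using 1[OF that] 2[OF that] that by (metis mult.assoc)
  with b show ?thesis by (rule that)
qed

text \<open>\<open>ev Q\<close> divides a nonzero polynomial in \<open>u\<close>, and such a
  polynomial has a nonzero expansion at every point. The norm thus carries nonvanishing from
  \<open>inf\<close> to all of \<open>S\<close>.\<close>

lemma ev_nonzero: "q \<in> S \<Longrightarrow> \<not> quad_zero Q \<Longrightarrow> ev Q q \<noteq> 0"
  by (metis norm_exists evp_u_nonzero mult_zero_left)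

lemma w_nonzero: "q \<in> S \<Longrightarrow> w q \<noteq> 0"
  using ev_nonzero[of q "quad 0 1 0 0"] by (simp add: ev_quad)

text \<open>If \<open>\<kappa>\<close> does not vanish at \<open>r\<close>, the four points over
  \<open>r\<close> have four different values of \<open>w\<close>, and vanishing at all of them is a
  Vandermonde system. If it does, then \<open>u - r\<close> has order 4 and \<open>w\<close> order 1
  at a point over \<open>r\<close>. The summands there have distinct orders, and one with
  \<open>poly (Q j) r \<noteq> 0\<close> has order \<open>j < 4\<close>, less than the order of
  \<open>b\<close>.\<close>

lemma common_root:
  assumes "b \<noteq> 0" "poly b r = 0" "j < 4"
    and le: "\<And>q. q \<in> S \<Longrightarrow> q \<noteq> inf \<Longrightarrow> fls_subdegree (evp b (u q)) \<le> fls_subdegree (ev Q q)"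
  shows "poly (Q j) r = 0"
proof -
  obtain w0 where w0: "w0 ^ 4 = poly \<kappa> r" by (rule fourth_root_exists)
  have ord: "Polynomial.order r b \<ge> 1" using assms(1,2) by (simp add: order_root Suc_leI)
  show ?thesis
  proof (cases "w0 = 0")
    case False
    have "poly (Q 0) r + poly (Q 1) r * v + poly (Q 2) r * v ^ 2 + poly (Q 3) r * v ^ 3 = 0"
      if "v ^ 4 = w0 ^ 4" for v
    proof -
      obtain q where q: "q \<in> S" "q \<noteq> inf" "u q $$ 0 = r" "w q $$ 0 = v"
        using finite_point[of r v] w0 \<open>v ^ 4 = w0 ^ 4\<close> by auto
      have "v \<noteq> 0" using that False by auto
      have "fls_subdegree (ev Q q) \<ge> 1"
        using le[OF q(1,2)] evp_u_finite(2)[OF q(1,2) assms(1)] q ord \<open>v \<noteq> 0\<close> by simp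
      then have "ev Q q $$ 0 = 0" by simp
      then show ?thesis
        using ev_finite(2)[OF q(1,2), of Q] q
        by (simp add: sum_lessThan_4)
    qed
    then show ?thesis
      using vandermonde_fourth_roots[OF False, of "poly (Q 0) r" "poly (Q 1) r" "poly (Q 2) r" "poly (Q 3) r"]
        assms(3) by (auto simp: less_Suc_eq numeral_eq_Suc)
  next
    case True
    obtain q where q: "q \<in> S" "q \<noteq> inf" "u q $$ 0 = r" "w q $$ 0 = 0"
      using finite_point[of r 0] w0 True by auto
    show ?thesis
    proof (rule ccontr)
      assume nz: "poly (Q j) r \<noteq> 0"
      let ?t = "\<lambda>j. evp (Q j) (u q) * w q ^ j"
      have w: "w q \<noteq> 0" "fls_subdegree (w q) = 1" using w_nonzero ramified q by auto
      have t: "?t i \<noteq> 0 \<and> fls_subdegree (?t i) = 4 * int (Polynomial.order r (Q i)) + int i" if "Q i \<noteq> 0" for i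
        using evp_u_finite[OF q(1,2) that] w q by (simp add: fls_subdegree_pow)
      have t0: "Q i \<noteq> 0" if "?t i \<noteq> 0" for i using that by auto
      have dist: "fls_subdegree (?t i) \<noteq> fls_subdegree (?t k)"
        if "i \<in> {..<4}" "k \<in> {..<4}" "i \<noteq> k" "?t i \<noteq> 0" "?t k \<noteq> 0" for i k
      proof -
        have "4 * int (Polynomial.order r (Q i)) + int i \<noteq> 4 * int (Polynomial.order r (Q k)) + int k"
          using that(1-3) by simp presburger
        then show ?thesis using t[OF t0] that(4,5) by simp
      qed
      have "Q j \<noteq> 0" using nz by auto
      have "fls_subdegree (ev Q q) \<le> fls_subdegree (?t j)"
        unfolding ev_def
        by (rule fls_subdegree_sum_distinct(2)) (use assms(3) t[OF \<open>Q j \<noteq> 0\<close>] dist in auto)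
      also have "\<dots> = int j" using t[OF \<open>Q j \<noteq> 0\<close>] nz by (simp add: order_0I)
      also have "\<dots> < 4" using assms(3) by simp
      also have "4 \<le> fls_subdegree (evp b (u q))"
        using evp_u_finite(2)[OF q(1,2) assms(1)] q ord by simp
      also have "\<dots> \<le> fls_subdegree (ev Q q)" by (rule le[OF q(1,2)])
      finally show False by simp
    qed
  qed
qed

text \<open>Roots of \<open>b\<close> are removed one at a time. As \<open>u - r\<close> is nonzero
  in every local field, cancelling it from both sides preserves the comparison of orders.\<close>

lemma division:
  assumes "b \<noteq> 0" "\<not> quad_zero Q"
    and "\<And>q. q \<in> S \<Longrightarrow> q \<noteq> inf \<Longrightarrow> fls_subdegree (evp b (u q)) \<le> fls_subdegree (ev Q q)"
  shows "\<exists>R. \<forall>j<4. Q j = b * R j"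
  using assms
proof (induction "degree b" arbitrary: b Q)
  case 0
  then obtain c where "b = [:c:]" "c \<noteq> 0" by (metis degree_eq_zeroE pCons_0_0)
  then have "\<forall>j<4. Q j = b * smult (inverse c) (Q j)" by simp
  then show ?case by (intro exI)
next
  case (Suc n)
  have "\<not> constant (poly b)" using Suc(2) by (simp add: constant_degree)
  then obtain r where r: "poly b r = 0" using fundamental_theorem_of_algebra by blast
  then obtain b' where b': "b = [:- r, 1:] * b'" by (metis dvdE poly_eq_0_iff_dvd)
  have "b' \<noteq> 0" using Suc(3) b' by auto
  have "\<forall>j. j < 4 \<longrightarrow> (\<exists>R. Q j = [:- r, 1:] * R)"
    using common_root[OF Suc(3) r] Suc(5) by (metis dvdE poly_eq_0_iff_dvd)
  then obtain R where R: "\<And>j. j < 4 \<Longrightarrow> Q j = [:- r, 1:] * R j" by metis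
  have evQ: "ev Q q = (u q - fls_const r) * ev R q" for q
    unfolding ev_def using R
    by (simp add: sum_distrib_left evp_def[symmetric] mult.assoc del: mult_pCons_left mult_pCons_right)
  have "\<not> quad_zero R" using Suc(4) R by (auto simp: quad_zero_def)
  have "fls_subdegree (evp b' (u q)) \<le> fls_subdegree (ev R q)" if q: "q \<in> S" "q \<noteq> inf" for q
  proof -
    have "evp b (u q) = (u q - fls_const r) * evp b' (u q)"
      unfolding b' evp_mult by simp
    moreover have "u q - fls_const r \<noteq> 0" using u_nonconst[OF q(1)] by simp
    ultimately show ?thesis
      using Suc(5)[OF q] evQ[of q] evp_u_nonzero[OF q(1) \<open>b' \<noteq> 0\<close>] ev_nonzero[OF q(1) \<open>\<not> quad_zero R\<close>]
      by simp
  qed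
  moreover have "degree b = Suc (degree b')"
    unfolding b' using \<open>b' \<noteq> 0\<close> by (subst degree_mult_eq) auto
  ultimately obtain R' where "\<forall>j<4. R j = b' * R' j"
    using Suc(1)[of b' R] \<open>b' \<noteq> 0\<close> \<open>\<not> quad_zero R\<close> Suc(2) by auto
  then have "\<forall>j<4. Q j = b * R' j" using R b' by (metis mult.assoc)
  then show ?case by (rule exI[of _ R'])
qed

section \<open>Rational functions and those with bounded poles\<close>

definition rational :: "('p \<Rightarrow> complex fls) \<Rightarrow> bool" where
  "rational h \<longleftrightarrow> (\<exists>N D. \<not> quad_zero D \<and> (\<forall>q\<in>S. h q = ev N q / ev D q))"

lemma rational_divide_regular:
  assumes "regular h" "regular k" "\<And>q. q \<in> S \<Longrightarrow> k q \<noteq> 0"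
  shows "rational (\<lambda>q. h q / k q)"
proof -
  obtain N D where ND: "\<forall>q\<in>S. h q = ev N q" "\<forall>q\<in>S. k q = ev D q" using assms by (auto simp: regular_def)
  then have "\<not> quad_zero D" using assms(3)[OF inf_in] inf_in ev_quad_zero by auto
  then show ?thesis using ND unfolding rational_def by (intro exI[of _ N] exI[of _ D]) auto
qed

lemma rationalE:
  assumes "rational h"
  obtains N D where "\<not> quad_zero D" "\<And>q. q \<in> S \<Longrightarrow> h q = ev N q / ev D q" "\<And>q. q \<in> S \<Longrightarrow> ev D q \<noteq> 0"
  using assms ev_nonzero unfolding rational_def by blast

lemma rational_cong: "(\<And>q. q \<in> S \<Longrightarrow> h q = k q) \<Longrightarrow> rational h \<longleftrightarrow> rational k"
  unfolding rational_def by auto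

lemma regular_imp_rational: "regular h \<Longrightarrow> rational h"
  using rational_divide_regular[OF _ regular_const[of 1]] by simp

text \<open>A nonzero expansion at one point shows that the normal form of the numerator is nonzero,
  and then its expansion is nonzero everywhere.\<close>

lemma rational_nonzero:
  assumes "rational h" "p \<in> S" "h p \<noteq> 0" "q \<in> S"
  shows "h q \<noteq> 0"
proof -
  obtain N D where ND: "\<not> quad_zero D" "\<And>q. q \<in> S \<Longrightarrow> h q = ev N q / ev D q" "\<And>q. q \<in> S \<Longrightarrow> ev D q \<noteq> 0"
    using assms(1) by (rule rationalE) (rule that)
  have "\<not> quad_zero N" using ND(2)[OF assms(2)] assms(3) ev_quad_zero by auto
  then show ?thesis using ND assms(4) ev_nonzero by simp
qed

lemma rational_mult:
  assumes "rational h" "rational k"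
  shows "rational (\<lambda>q. h q * k q)"
proof -
  obtain N D where h: "\<And>q. q \<in> S \<Longrightarrow> h q = ev N q / ev D q" "\<And>q. q \<in> S \<Longrightarrow> ev D q \<noteq> 0"
    using assms(1) by (rule rationalE) (rule that)
  obtain M E where k: "\<And>q. q \<in> S \<Longrightarrow> k q = ev M q / ev E q" "\<And>q. q \<in> S \<Longrightarrow> ev E q \<noteq> 0"
    using assms(2) by (rule rationalE) (rule that)
  have "rational (\<lambda>q. (ev N q * ev M q) / (ev D q * ev E q))"
    using h k by (intro rational_divide_regular regular_mult regular_ev) auto
  then show ?thesis by (rule rational_cong[THEN iffD1, rotated]) (simp add: h k)
qed

lemma rational_divide:
  assumes "rational h" "rational k" "p \<in> S" "k p \<noteq> 0"
  shows "rational (\<lambda>q. h q / k q)"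
proof -
  obtain N D where h: "\<And>q. q \<in> S \<Longrightarrow> h q = ev N q / ev D q" "\<And>q. q \<in> S \<Longrightarrow> ev D q \<noteq> 0"
    using assms(1) by (rule rationalE) (rule that)
  obtain M E where k: "\<And>q. q \<in> S \<Longrightarrow> k q = ev M q / ev E q" "\<And>q. q \<in> S \<Longrightarrow> ev E q \<noteq> 0"
    using assms(2) by (rule rationalE) (rule that)
  have M: "ev M q \<noteq> 0" if "q \<in> S" for q
    using rational_nonzero[OF assms(2-4) that] k[OF that] by auto
  have "rational (\<lambda>q. (ev N q * ev E q) / (ev D q * ev M q))"
    using h M by (intro rational_divide_regular regular_mult regular_ev) auto
  then show ?thesis by (rule rational_cong[THEN iffD1, rotated]) (simp add: h k)
qed

text \<open>Multiplying by the cofactor of a norm makes the denominator a polynomial in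
  \<open>u\<close>, and \<open>division\<close> removes it. The pole bound becomes
  \<open>4 deg + 3 j \<le> 4\<close> for the coefficient of \<open>w ^ j\<close>: a linear
  polynomial for \<open>j = 0\<close>, a constant for \<open>j = 1\<close>, and zero for
  \<open>j = 2, 3\<close>.\<close>

theorem regular_sections:
  assumes "rational h" "\<And>q. q \<in> S \<Longrightarrow> q \<noteq> inf \<Longrightarrow> fls_subdegree (h q) \<ge> 0" "fls_subdegree (h inf) \<ge> - 4"
  obtains c0 c1 c2 where "\<And>q. q \<in> S \<Longrightarrow> h q = fls_const c0 + fls_const c1 * u q + fls_const c2 * w q"
proof -
  obtain N D where h: "\<not> quad_zero D" "\<And>q. q \<in> S \<Longrightarrow> h q = ev N q / ev D q" "\<And>q. q \<in> S \<Longrightarrow> ev D q \<noteq> 0"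
    using assms(1) by (rule rationalE) (rule that)
  obtain E b where E: "b \<noteq> 0" "\<And>q. q \<in> S \<Longrightarrow> ev D q * ev E q = evp b (u q)"
    using h(1) by (rule norm_exists) (rule that)
  obtain M where M: "\<And>q. q \<in> S \<Longrightarrow> ev N q * ev E q = ev M q"
    using regular_mult[OF regular_ev regular_ev, of N E] unfolding regular_def by blast
  have b: "evp b (u q) \<noteq> 0" if "q \<in> S" for q using evp_u_nonzero[OF that E(1)] .
  have hM: "h q = ev M q / evp b (u q)" if "q \<in> S" for q
    using h(2,3)[OF that] E(2)[OF that] M[OF that] b[OF that]
    by (metis mult_divide_mult_cancel_right mult_eq_0_iff)
  show ?thesis
  proof (cases "quad_zero M")
    case True
    then show ?thesis using that[of 0 0 0] hM ev_quad_zero by simp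
  next
    case False
    have "fls_subdegree (evp b (u q)) \<le> fls_subdegree (ev M q)" if "q \<in> S" "q \<noteq> inf" for q
      using assms(2)[OF that] hM[OF that(1)] b[OF that(1)] ev_nonzero[OF that(1) False]
      by (simp add: fls_divide_subdegree)
    then obtain R where R: "\<And>j. j < 4 \<Longrightarrow> M j = b * R j"
      using division[OF E(1) False] by blast
    have "ev M q = evp b (u q) * ev R q" for q
      unfolding ev_def sum_distrib_left using R by (auto intro!: sum.cong simp: mult.assoc)
    then have hR: "h q = ev R q" if "q \<in> S" for q
      using hM[OF that] b[OF that] by simp
    have bound: "4 * int (degree (R j)) + 3 * int j \<le> 4" if "j < 4" "R j \<noteq> 0" for j
      using ev_inf(2)[of j R, OF that] assms(3) hR[OF inf_in] by simp
    have "degree (R 0) \<le> 1" using bound[of 0] by (cases "R 0 = 0") auto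
    then have "R 0 = [:coeff (R 0) 0, coeff (R 0) 1:]"
      by (intro poly_eqI) (auto simp: coeff_pCons coeff_eq_0 split: nat.splits)
    then obtain c0 c1 where R0: "R 0 = [:c0, c1:]" by blast
    have "degree (R 1) = 0" using bound[of 1] by (cases "R 1 = 0") auto
    then obtain c2 where R1: "R 1 = [:c2:]" by (metis degree_eq_zeroE)
    have R23: "R 2 = 0" "R 3 = 0" using bound[of 2] bound[of 3] by fastforce+
    show ?thesis
      by (rule that[of c0 c1 c2]) (simp add: hR ev_eq R0 R1[unfolded One_nat_def] R23 algebra_simps)
  qed
qed

section \<open>Derivatives and the differential \<open>du / w\<^sup>3\<close>\<close>

lemma fls_deriv_w:
  assumes "q \<in> S"
  shows "4 * w q ^ 3 * fls_deriv (w q) = evp (pderiv \<kappa>) (u q) * fls_deriv (u q)"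
proof -
  have "fls_deriv (w q ^ 4) = 4 * w q ^ 3 * fls_deriv (w q)"
    by (simp add: numeral_eq_Suc algebra_simps)
  then show ?thesis using w_power4[OF assms] fls_deriv_evp by metis
qed

text \<open>Implicit differentiation gives \<open>dw = (\<kappa>' / 4) du / w\<^sup>3\<close>, so
  measuring against \<open>du / w\<^sup>3\<close> instead of \<open>du\<close> keeps the cofactor
  free of denominators.\<close>

lemma regular_deriv:
  assumes "regular h"
  obtains r where "regular r" "\<And>q. q \<in> S \<Longrightarrow> fls_deriv (h q) = r q * (fls_deriv (u q) / w q ^ 3)"
proof -
  obtain Q where Q: "\<And>q. q \<in> S \<Longrightarrow> h q = ev Q q" using assms by (auto simp: regular_def)
  define r where "r = (\<lambda>q. w q ^ 3 * ev (\<lambda>j. pderiv (Q j)) q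
    + evp (smult (1/4) (pderiv \<kappa>)) (u q) * (evp (Q 1) (u q) + (evp (smult 2 (Q 2)) (u q) * w q + evp (smult 3 (Q 3)) (u q) * w q ^ 2)))"
  have "regular r"
    unfolding r_def
    by (intro regular_add regular_mult regular_power regular_ev regular_evp regular_w)
  moreover have "fls_deriv (h q) = r q * (fls_deriv (u q) / w q ^ 3)" if q: "q \<in> S" for q
  proof -
    have c: "fls_const (1/4) * (4 :: complex fls) = 1" "fls_const 2 = (2 :: complex fls)" "fls_const 3 = (3 :: complex fls)"
      by (simp_all flip: fls_const_numeral)
    have dw: "w q ^ 3 * fls_deriv (w q) = fls_const (1/4) * evp (pderiv \<kappa>) (u q) * fls_deriv (u q)"
    proof -
      have "w q ^ 3 * fls_deriv (w q) = (fls_const (1/4) * 4) * (w q ^ 3 * fls_deriv (w q))"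
        by (simp only: c(1) mult_1)
      also have "\<dots> = fls_const (1/4) * (4 * w q ^ 3 * fls_deriv (w q))" by (simp only: mult.assoc)
      also have "\<dots> = fls_const (1/4) * evp (pderiv \<kappa>) (u q) * fls_deriv (u q)"
        unfolding fls_deriv_w[OF q] by (simp only: mult.assoc)
      finally show ?thesis .
    qed
    have "fls_deriv (ev Q q) = ev (\<lambda>j. pderiv (Q j)) q * fls_deriv (u q)
       + (evp (Q 1) (u q) + 2 * evp (Q 2) (u q) * w q + 3 * evp (Q 3) (u q) * w q ^ 2) * fls_deriv (w q)"
      unfolding ev_eq by (simp add: fls_deriv_evp algebra_simps numeral_eq_Suc)
    moreover have "fls_deriv (h q) = fls_deriv (ev Q q)" by (simp only: Q[OF q])
    ultimately have "w q ^ 3 * fls_deriv (h q) = w q ^ 3 * ev (\<lambda>j. pderiv (Q j)) q * fls_deriv (u q)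
       + (evp (Q 1) (u q) + 2 * evp (Q 2) (u q) * w q + 3 * evp (Q 3) (u q) * w q ^ 2) * (w q ^ 3 * fls_deriv (w q))"
      by (simp add: algebra_simps)
    then have "w q ^ 3 * fls_deriv (h q) = r q * fls_deriv (u q)"
      unfolding dw by (simp add: r_def c algebra_simps)
    then show ?thesis using w_nonzero[OF q] by (simp add: eq_divide_eq mult.commute)
  qed
  ultimately show ?thesis by (rule that)
qed

lemma rational_deriv:
  assumes "rational h"
  obtains g where "rational g" "\<And>q. q \<in> S \<Longrightarrow> fls_deriv (h q) = g q * (fls_deriv (u q) / w q ^ 3)"
proof -
  obtain N D where h: "\<And>q. q \<in> S \<Longrightarrow> h q = ev N q / ev D q" "\<And>q. q \<in> S \<Longrightarrow> ev D q \<noteq> 0"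
    using assms(1) by (rule rationalE) (rule that)
  obtain n where n: "regular n" "\<And>q. q \<in> S \<Longrightarrow> fls_deriv (ev N q) = n q * (fls_deriv (u q) / w q ^ 3)"
    using regular_ev[of N] by (rule regular_deriv) (rule that)
  obtain d where d: "regular d" "\<And>q. q \<in> S \<Longrightarrow> fls_deriv (ev D q) = d q * (fls_deriv (u q) / w q ^ 3)"
    using regular_ev[of D] by (rule regular_deriv) (rule that)
  \<comment> \<open>The quotient rule, with the minus sign written as multiplication by a constant
    so that closure under sums and products applies.\<close>
  have "rational (\<lambda>q. (n q * ev D q + fls_const (- 1) * (ev N q * d q)) / ev D q ^ 2)"
    using h n d by (intro rational_divide_regular regular_add regular_mult regular_power regular_ev regular_const) auto
  moreover have "fls_deriv (h q) = (n q * ev D q + fls_const (- 1) * (ev N q * d q)) / ev D q ^ 2 * (fls_deriv (u q) / w q ^ 3)"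
    if q: "q \<in> S" for q
  proof -
    have quot: "A = B / d * X" if "A * d = B * X" "d \<noteq> 0" for A B d X :: "complex fls"
      using that by (simp add: eq_divide_eq)
    define X where "X = fls_deriv (u q) / w q ^ 3"
    have "fls_deriv (ev N q) = fls_deriv (h q * ev D q)" using h[OF q] by simp
    then have "n q * X = fls_deriv (h q) * ev D q + h q * (d q * X)"
      using n(2)[OF q] d(2)[OF q] by (simp add: X_def[symmetric] algebra_simps)
    then have "fls_deriv (h q) * ev D q = (n q - h q * d q) * X"
      by (simp add: algebra_simps)
    then have "fls_deriv (h q) = (n q - h q * d q) / ev D q * (fls_deriv (u q) / w q ^ 3)"
      using h(2)[OF q] unfolding X_def by (rule quot)
    moreover have "(n q - h q * d q) / ev D q = (n q * ev D q + fls_const (- 1) * (ev N q * d q)) / ev D q ^ 2"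
      using h[OF q] by (simp add: field_simps power2_eq_square)
    ultimately show ?thesis by simp
  qed
  ultimately show ?thesis by (rule that)
qed

lemma deriv_u_nonzero: "q \<in> S \<Longrightarrow> fls_deriv (u q) \<noteq> 0"
  using u_nonconst by (metis fls_deriv_eq_0_iff)

text \<open>The orders are \<open>-5 + 9\<close> at \<open>inf\<close>, \<open>3 - 3\<close> where
  \<open>w\<close> vanishes and \<open>0 - 0\<close> elsewhere. The total 4 is
  \<open>2 g - 2\<close> for genus 3.\<close>

lemma subdegree_differential:
  assumes "q \<in> S"
  shows "fls_subdegree (fls_deriv (u q) / w q ^ 3) = (if q = inf then 4 else 0)"
proof -
  have *: "fls_subdegree (fls_deriv (u q) / w q ^ 3) = fls_subdegree (fls_deriv (u q)) - 3 * fls_subdegree (w q)"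
    using deriv_u_nonzero[OF assms] w_nonzero[OF assms] by (simp add: fls_divide_subdegree fls_subdegree_pow)
  show ?thesis
  proof (cases "q = inf")
    case True
    have "fls_subdegree (fls_deriv (u inf)) = - 5"
      by (subst fls_subdegree_deriv) (auto simp: subdegree_u_inf)
    then show ?thesis using * True by (simp add: subdegree_w_inf)
  next
    case False
    \<comment> \<open>Differentiation lowers the order by one only for series of nonzero order, so
      the constant term is subtracted first.\<close>
    have d: "fls_deriv (u q) = fls_deriv (u q - fls_const (u q $$ 0))" by simp
    show ?thesis
    proof (cases "w q $$ 0 = 0")
      case True
      have "fls_subdegree (fls_deriv (u q)) = 3"
        unfolding d by (subst fls_subdegree_deriv) (auto simp: ramified[OF assms False True])
      then show ?thesis using * False ramified[OF assms False True] by simp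
    next
      case w: False
      have "fls_subdegree (fls_deriv (u q)) = 0"
        unfolding d by (subst fls_subdegree_deriv) (auto simp: unramified[OF assms False w])
      moreover have "fls_subdegree (w q) = 0"
        using fls_subdegree_leI[OF w] subdegree_w_finite[OF assms False] by simp
      ultimately show ?thesis using * False by simp
    qed
  qed
qed

end

section \<open>The quartic as a cyclic cover\<close>

text \<open>A root with \<open>e ^ 4 = 1\<close> would satisfy \<open>a * e ^ 2 = - 2\<close>,
  whence \<open>a ^ 2 = 4\<close>. The two conclusions together say that
  \<open>e, - e, 1 / e, - 1 / e\<close> are distinct.\<close>

lemma biquadratic_root:
  assumes "a ^ 2 \<noteq> 4" "e ^ 4 + a * e ^ 2 + 1 = (0::complex)"
  shows "e \<noteq> 0" "e ^ 4 \<noteq> 1"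
proof -
  show "e \<noteq> 0" using assms(2) by auto
  show "e ^ 4 \<noteq> 1"
  proof
    assume 1: "e ^ 4 = 1"
    then have "a * e ^ 2 = - 2" using assms(2) by algebra
    moreover have "a ^ 2 * e ^ 4 = (a * e ^ 2) ^ 2" by (simp add: power_mult_distrib flip: power_mult)
    ultimately have "a ^ 2 * e ^ 4 = 4" by simp
    then show False using 1 assms(1) by simp
  qed
qed

text \<open>The biquadratic is palindromic, so its roots are \<open>e, - e, 1 / e, - 1 / e\<close>,
  and \<open>a\<close> is minus the sum of the squares of \<open>e\<close> and
  \<open>1 / e\<close>.\<close>

lemma biquadratic_factor:
  assumes "e ^ 4 + a * e ^ 2 + 1 = (0::complex)"
  shows "X ^ 4 + Y ^ 4 + fps_const a * X ^ 2 * Y ^ 2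
    = (X - fps_const e * Y) * (X + fps_const e * Y) * (X - fps_const (1 / e) * Y) * (X + fps_const (1 / e) * Y)"
proof -
  define E where "E = fps_const e"
  define E' where "E' = fps_const (1 / e)"
  have e: "e \<noteq> 0" using assms by auto
  then have 1: "E * E' = 1" by (simp add: E_def E'_def)
  have "a * e ^ 2 = - (e ^ 4 + 1)" using assms by (simp add: eq_neg_iff_add_eq_0 algebra_simps)
  then have "a = - (e ^ 2 + (1 / e) ^ 2)" using e by (simp add: field_simps power2_eq_square numeral_eq_Suc)
  then have 2: "fps_const a = - (E ^ 2 + E' ^ 2)"
    by (simp add: E_def E'_def fps_const_power)
  show ?thesis
    unfolding 2 E_def[symmetric] E'_def[symmetric] using 1 by algebra
qed

locale smooth_quartic =
  fixes a s :: complex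
  assumes a2: "a ^ 2 \<noteq> 4" and root_s: "s ^ 4 + a * s ^ 2 + 1 = 0"
begin

abbreviation "F \<equiv> quartic a"
abbreviation "C \<equiv> curve F"

definition X where "X q = local_param F q $ 1"
definition Y where "Y q = local_param F q $ 2"
definition Z where "Z q = local_param F q $ 3"

lemma s_nonzero: "s \<noteq> 0"
  using biquadratic_root(1)[OF a2 root_s] .

lemma local_param_XYZ:
  assumes "q \<in> C"
  shows "\<not> (fps_nth (X q) 0 = 0 \<and> fps_nth (Y q) 0 = 0 \<and> fps_nth (Z q) 0 = 0)"
    and "q = pt (fps_nth (X q) 0) (fps_nth (Y q) 0) (fps_nth (Z q) 0)"
    and "\<not> (fps_nth (X q) 1 = c * fps_nth (X q) 0 \<and> fps_nth (Y q) 1 = c * fps_nth (Y q) 0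
      \<and> fps_nth (Z q) 1 = c * fps_nth (Z q) 0)"
    and "X q ^ 4 + Y q ^ 4 + Z q ^ 4 + fps_const a * X q ^ 2 * Y q ^ 2 = 0"
proof -
  let ?\<gamma> = "local_param F q"
  have v: "(\<chi> m. fps_nth (?\<gamma> $ m) n) = vec3 (fps_nth (X q) n) (fps_nth (Y q) n) (fps_nth (Z q) n)" for n
    by (simp add: vec_eq_iff forall_3 vector_3 X_def Y_def Z_def)
  have "is_local_param F q ?\<gamma>" by (rule is_local_param_quartic[OF assms a2])
  then have *: "vec3 (fps_nth (X q) 0) (fps_nth (Y q) 0) (fps_nth (Z q) 0) \<noteq> 0"
      "abs_proj_plane (vec3 (fps_nth (X q) 0) (fps_nth (Y q) 0) (fps_nth (Z q) 0)) = q"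
      "\<And>c. vec3 (fps_nth (X q) 1) (fps_nth (Y q) 1) (fps_nth (Z q) 1)
         \<noteq> c *s vec3 (fps_nth (X q) 0) (fps_nth (Y q) 0) (fps_nth (Z q) 0)"
      "eval_tpoly fps_const F ?\<gamma> = 0"
    unfolding is_local_param_def Let_def v by auto
  show "\<not> (fps_nth (X q) 0 = 0 \<and> fps_nth (Y q) 0 = 0 \<and> fps_nth (Z q) 0 = 0)" using *(1) by auto
  show "q = pt (fps_nth (X q) 0) (fps_nth (Y q) 0) (fps_nth (Z q) 0)" using *(2) by (simp add: pt_def)
  show "\<not> (fps_nth (X q) 1 = c * fps_nth (X q) 0 \<and> fps_nth (Y q) 1 = c * fps_nth (Y q) 0
      \<and> fps_nth (Z q) 1 = c * fps_nth (Z q) 0)"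
    using *(3)[of c] by (auto simp: scale_vec3 vec3_eq_iff vector_3)
  show "X q ^ 4 + Y q ^ 4 + Z q ^ 4 + fps_const a * X q ^ 2 * Y q ^ 2 = 0"
    using *(4) by (simp add: eval_tpoly_quartic X_def Y_def Z_def)
qed

lemma XYZ_0:
  assumes "q \<in> C"
  shows "fps_nth (X q) 0 ^ 4 + fps_nth (Y q) 0 ^ 4 + fps_nth (Z q) 0 ^ 4 + a * fps_nth (X q) 0 ^ 2 * fps_nth (Y q) 0 ^ 2 = 0"
  using arg_cong[OF local_param_XYZ(4)[OF assms], of "\<lambda>f. fps_nth f 0"]
  by (simp add: fps_nth_power_0)

lemma XYZ_1:
  assumes "q \<in> C"
  defines "x0 \<equiv> fps_nth (X q) 0" and "y0 \<equiv> fps_nth (Y q) 0" and "z0 \<equiv> fps_nth (Z q) 0"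
  shows "(4 * x0 ^ 3 + 2 * a * x0 * y0 ^ 2) * fps_nth (X q) 1 + (4 * y0 ^ 3 + 2 * a * x0 ^ 2 * y0) * fps_nth (Y q) 1
    + 4 * z0 ^ 3 * fps_nth (Z q) 1 = 0"
proof -
  have p1: "fps_nth (f ^ n) 1 = of_nat n * (fps_nth f 0) ^ (n - 1) * fps_nth f 1" for f :: "complex fps" and n
    by (rule fps_power_first)
  have "fps_nth (X q ^ 4 + Y q ^ 4 + Z q ^ 4 + fps_const a * X q ^ 2 * Y q ^ 2) 1
    = (4 * x0 ^ 3 + 2 * a * x0 * y0 ^ 2) * fps_nth (X q) 1 + (4 * y0 ^ 3 + 2 * a * x0 ^ 2 * y0) * fps_nth (Y q) 1
    + 4 * z0 ^ 3 * fps_nth (Z q) 1"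
    unfolding fps_add_nth fps_mult_nth_1 fps_mult_nth_0 fps_nth_power_0 p1 x0_def y0_def z0_def
    by (simp add: algebra_simps)
  then show ?thesis using local_param_XYZ(4)[OF assms(1)] by simp
qed

lemma Z_0_imp_Y_0:
  assumes "q \<in> C" "fps_nth (Z q) 0 = 0"
  shows "fps_nth (Y q) 0 \<noteq> 0"
  using local_param_XYZ(1)[OF assms(1)] XYZ_0[OF assms(1)] assms(2) by auto

text \<open>The line joining \<open>[0 : 0 : 1]\<close> to a point of the curve is transversal unless it is one of the
  four hyperflex tangents, which meet the curve in a point with \<open>z = 0\<close>.\<close>

lemma subdegree_line:
  assumes q: "q \<in> C" and nz: "\<not> (\<alpha> = 0 \<and> \<beta> = 0)"
    and van: "\<alpha> * fps_nth (X q) 0 + \<beta> * fps_nth (Y q) 0 = 0"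
  shows "subdegree (fps_const \<alpha> * X q + fps_const \<beta> * Y q) = (if fps_nth (Z q) 0 = 0 then 4 else 1)"
    and "fps_nth (Z q) 0 = 0 \<Longrightarrow> subdegree (Z q) = 1"
proof -
  define x0 y0 z0 where "x0 = fps_nth (X q) 0" and "y0 = fps_nth (Y q) 0" and "z0 = fps_nth (Z q) 0"
  define x1 y1 z1 where "x1 = fps_nth (X q) 1" and "y1 = fps_nth (Y q) 1" and "z1 = fps_nth (Z q) 1"
  note defs = x0_def y0_def z0_def x1_def y1_def z1_def
  have indep: "\<not> (x1 = c * x0 \<and> y1 = c * y0 \<and> z1 = c * z0)" for c
    using local_param_XYZ(3)[OF q] by (simp add: defs)
  have eq0: "x0 ^ 4 + y0 ^ 4 + z0 ^ 4 + a * x0 ^ 2 * y0 ^ 2 = 0" using XYZ_0[OF q] by (simp add: defs)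
  let ?W = "fps_const \<alpha> * X q + fps_const \<beta> * Y q"
  have W0: "fps_nth ?W 0 = 0" using van by simp
  have case0: "subdegree ?W = 4 \<and> subdegree (Z q) = 1" if "z0 = 0"
  proof -
    have y0: "y0 \<noteq> 0" using Z_0_imp_Y_0[OF q] that by (simp add: defs)
    define e where "e = x0 / y0"
    have x0: "x0 = e * y0" using y0 by (simp add: e_def)
    have "y0 ^ 4 * (e ^ 4 + a * e ^ 2 + 1) = 0" using eq0 that unfolding x0 by (simp add: algebra_simps power_mult_distrib numeral_eq_Suc)
    then have root_e: "e ^ 4 + a * e ^ 2 + 1 = 0" using y0 by simp
    note e = biquadratic_root[OF a2 root_e]
    have "(\<alpha> * e + \<beta>) * y0 = 0" using van by (simp add: defs[symmetric] x0 algebra_simps)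
    then have \<beta>: "\<beta> = - (\<alpha> * e)" using y0 by (simp add: eq_neg_iff_add_eq_0 add.commute)
    then have "\<alpha> \<noteq> 0" using nz by auto
    define V where "V = X q - fps_const e * Y q"
    have W: "?W = fps_const \<alpha> * V"
      by (simp add: V_def \<beta> algebra_simps flip: fps_const_mult fps_const_neg)
    \<comment> \<open>The other three linear factors of \<open>f\<close>. They do not vanish at the
      point because the roots of \<open>f\<close> are simple, so \<open>V * U = - (Z q ^ 4)\<close>
      determines the order of \<open>V\<close>.\<close>
    define U where "U = (X q + fps_const e * Y q) * (X q - fps_const (1 / e) * Y q) * (X q + fps_const (1 / e) * Y q)"
    have "fps_nth U 0 = 2 * e * (e ^ 2 - (1 / e) ^ 2) * y0 ^ 3"
      unfolding U_def by (simp add: defs[symmetric] x0 power2_eq_square power3_eq_cube algebra_simps)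
    moreover have "e ^ 2 - (1 / e) ^ 2 = (e ^ 4 - 1) / e ^ 2"
      using e(1) by (simp add: field_simps numeral_eq_Suc)
    ultimately have U0: "fps_nth U 0 \<noteq> 0" using e y0 by simp
    have VU: "V * U = - (Z q ^ 4)"
    proof -
      have "V * U = X q ^ 4 + Y q ^ 4 + fps_const a * X q ^ 2 * Y q ^ 2"
        unfolding V_def U_def biquadratic_factor[OF root_e] by (simp only: mult.assoc)
      then show ?thesis using local_param_XYZ(4)[OF q] by algebra
    qed
    have e1: "fps_nth V 1 = x1 - e * y1" by (simp add: V_def defs)
    have "V \<noteq> 0"
    proof
      assume "V = 0"
      then have "Z q ^ 4 = 0" using VU by simp
      then have "Z q = 0" by simp
      then show False using indep[of "y1 / y0"] e1 \<open>V = 0\<close> y0 x0 that by (simp add: defs)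
    qed
    have "subdegree (V * U) = subdegree V" using \<open>V \<noteq> 0\<close> U0 by (subst subdegree_mult) auto
    then have 4: "subdegree V = 4 * subdegree (Z q)" using VU by simp
    have "Z q \<noteq> 0" using VU \<open>V \<noteq> 0\<close> U0 by auto
    have "subdegree (Z q) \<noteq> 0" using \<open>Z q \<noteq> 0\<close> that by (metis nth_subdegree_nonzero z0_def)
    \<comment> \<open>Now \<open>V\<close> has order at least 4, so the velocity must show in
      \<open>Z\<close>, which therefore has order exactly 1.\<close>
    then have "fps_nth V 1 = 0" using 4 by (intro nth_less_subdegree_zero) linarith
    then have "z1 \<noteq> 0" using indep[of "y1 / y0"] e1 y0 x0 that by auto
    then have "subdegree (Z q) \<le> 1" by (intro subdegree_leI) (simp add: defs)
    then have "subdegree (Z q) = 1" using \<open>subdegree (Z q) \<noteq> 0\<close> by simp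
    then show ?thesis using 4 \<open>\<alpha> \<noteq> 0\<close> \<open>V \<noteq> 0\<close> unfolding W by simp
  qed
  have case1: "subdegree ?W = 1" if "z0 \<noteq> 0"
  proof -
    have xy: "\<not> (x0 = 0 \<and> y0 = 0)" using eq0 that by auto
    \<comment> \<open>Otherwise \<open>(x1, y1)\<close> is proportional to \<open>(x0, y0)\<close>;
      the differentiated equation combined with Euler's relation then forces the same factor for
      \<open>z\<close>, against the nonzero velocity.\<close>
    have "fps_nth ?W 1 \<noteq> 0"
    proof
      assume "fps_nth ?W 1 = 0"
      then have l1: "\<alpha> * x1 + \<beta> * y1 = 0" by (simp add: defs)
      have l0: "\<alpha> * x0 + \<beta> * y0 = 0" using van by (simp add: defs)
      obtain c where c: "x1 = c * x0" "y1 = c * y0"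
      proof -
        have det: "x0 * y1 = y0 * x1"
          using nz l0 l1 by algebra
        show ?thesis
        proof (cases "x0 = 0")
          case True
          then have "y0 \<noteq> 0" using xy by simp
          then show ?thesis using that[of "y1 / y0"] det True by auto
        next
          case False
          then show ?thesis using that[of "x1 / x0"] det by (simp add: field_simps)
        qed
      qed
      have "(4 * x0 ^ 3 + 2 * a * x0 * y0 ^ 2) * x1 + (4 * y0 ^ 3 + 2 * a * x0 ^ 2 * y0) * y1 + 4 * z0 ^ 3 * z1 = 0"
        using XYZ_1[OF q] by (simp add: defs)
      then have "4 * z0 ^ 3 * (z1 - c * z0) = 0" using eq0 unfolding c by algebra
      then show False using indep[of c] c that by simp
    qed
    then have "subdegree ?W = 1"
      using W0 by (intro subdegreeI) auto
    then show ?thesis .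
  qed
  show "subdegree ?W = (if fps_nth (Z q) 0 = 0 then 4 else 1)"
    using case0 case1 by (auto simp: z0_def)
  show "fps_nth (Z q) 0 = 0 \<Longrightarrow> subdegree (Z q) = 1"
    using case0 by (auto simp: z0_def)
qed

text \<open>These are affine coordinates with the line \<open>x = s y\<close> at infinity. The
  numerator \<open>x + s y\<close> of \<open>u\<close> gives \<open>x / l = (1 + u) / 2\<close> and
  \<open>y / l = (u - 1) / (2 s)\<close>. In \<open>\<kappa>\<close> the coefficient of
  \<open>u ^ 4\<close> is a multiple of \<open>s ^ 4 + a * s ^ 2 + 1\<close> and vanishes.\<close>

definition l where "l q = fps_to_fls (X q - fps_const s * Y q)"
definition u where "u q = fps_to_fls (X q + fps_const s * Y q) / l q"
definition w where "w q = fps_to_fls (Z q) / l q"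
definition x_of_u where "x_of_u = [:1 / 2, 1 / 2 :: complex:]"
definition y_of_u where "y_of_u = [:- (1 / (2 * s)), 1 / (2 * s):]"
definition \<kappa> where "\<kappa> = - (x_of_u ^ 4 + y_of_u ^ 4 + smult a (x_of_u ^ 2 * y_of_u ^ 2))"
definition inf where "inf = pt s 1 0"

lemma inf_in: "inf \<in> C"
  unfolding inf_def using root_s by (subst mem_curve_quartic_iff) (auto simp: algebra_simps)

text \<open>Substituting \<open>x = s y\<close> into the equation leaves \<open>z ^ 4 = 0\<close>,
  so the line meets the curve only at \<open>inf\<close>.\<close>

lemma l_0_iff:
  assumes "q \<in> C"
  shows "fps_nth (X q) 0 - s * fps_nth (Y q) 0 = 0 \<longleftrightarrow> q = inf"
proof
  assume "q = inf"
  then have "pt s 1 0 = pt (fps_nth (X q) 0) (fps_nth (Y q) 0) (fps_nth (Z q) 0)"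
    using local_param_XYZ(2)[OF assms] by (simp add: inf_def)
  then show "fps_nth (X q) 0 - s * fps_nth (Y q) 0 = 0"
    using local_param_XYZ(1)[OF assms] by (subst (asm) pt_eq_iff) auto
next
  define x0 y0 z0 where "x0 = fps_nth (X q) 0" and "y0 = fps_nth (Y q) 0" and "z0 = fps_nth (Z q) 0"
  assume "fps_nth (X q) 0 - s * fps_nth (Y q) 0 = 0"
  then have x0: "x0 = s * y0" by (simp add: x0_def y0_def)
  have "x0 ^ 4 + y0 ^ 4 + z0 ^ 4 + a * x0 ^ 2 * y0 ^ 2 = 0"
    using XYZ_0[OF assms] by (simp add: x0_def y0_def z0_def)
  then have "z0 ^ 4 = 0" using root_s unfolding x0 by algebra
  then have "z0 = 0" by simp
  then have "y0 \<noteq> 0" using Z_0_imp_Y_0[OF assms] by (simp add: y0_def z0_def)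
  have "q = pt (s * y0) y0 0"
    using local_param_XYZ(2)[OF assms] x0 \<open>z0 = 0\<close> by (simp add: x0_def y0_def z0_def)
  then show "q = inf"
    using \<open>y0 \<noteq> 0\<close> by (auto simp: inf_def pt_eq_iff intro!: exI[of _ "1 / y0"])
qed

lemma l_nonzero: "q \<in> C \<Longrightarrow> l q \<noteq> 0"
  and subdegree_l: "q \<in> C \<Longrightarrow> fls_subdegree (l q) = (if q = inf then 4 else 0)"
proof -
  assume q: "q \<in> C"
  have "subdegree (X q - fps_const s * Y q) = (if q = inf then 4 else 0) \<and> X q - fps_const s * Y q \<noteq> 0"
  proof (cases "q = inf")
    case True
    then have v: "fps_nth (X q) 0 - s * fps_nth (Y q) 0 = 0" using l_0_iff[OF q] by simp
    have z: "fps_nth (Z q) 0 = 0"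
    proof -
      have "pt s 1 0 = pt (fps_nth (X q) 0) (fps_nth (Y q) 0) (fps_nth (Z q) 0)"
        using local_param_XYZ(2)[OF q] True by (simp add: inf_def)
      then show ?thesis using local_param_XYZ(1)[OF q] by (subst (asm) pt_eq_iff) auto
    qed
    have "subdegree (fps_const 1 * X q + fps_const (- s) * Y q) = 4"
      using subdegree_line(1)[OF q, of 1 "- s"] v z by simp
    then have "subdegree (X q - fps_const s * Y q) = 4" by (simp flip: fps_const_neg)
    then show ?thesis using True by auto
  next
    case False
    then have "fps_nth (X q - fps_const s * Y q) 0 \<noteq> 0" using l_0_iff[OF q] by simp
    then show ?thesis using False by auto
  qed
  then show "l q \<noteq> 0" "fls_subdegree (l q) = (if q = inf then 4 else 0)"
    unfolding l_def fls_subdegree_fls_to_fps fps_to_fls_eq_0_iff by simp_all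
qed

lemma X_eq: "q \<in> C \<Longrightarrow> fps_to_fls (X q) = l q * evp x_of_u (u q)"
  and Y_eq: "q \<in> C \<Longrightarrow> fps_to_fls (Y q) = l q * evp y_of_u (u q)"
  and Z_eq: "q \<in> C \<Longrightarrow> fps_to_fls (Z q) = l q * w q"
proof -
  assume q: "q \<in> C"
  have lu: "l q * u q = fps_to_fls (X q + fps_const s * Y q)"
    using l_nonzero[OF q] by (simp add: u_def)
  have "l q * evp x_of_u (u q) = fls_const (1 / 2) * (l q + l q * u q)"
    by (simp add: x_of_u_def algebra_simps)
  also have "\<dots> = fps_to_fls (fps_const (1 / 2) * (X q - fps_const s * Y q + (X q + fps_const s * Y q)))"
    unfolding lu unfolding l_def by (simp add: fls_times_fps_to_fls)
  also have "fps_const (1 / 2) * (X q - fps_const s * Y q + (X q + fps_const s * Y q)) = (fps_const (1/2) * 2) * X q"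
    by (simp add: algebra_simps)
  also have "fps_const (1 / 2) * 2 = (1 :: complex fps)" by (simp add: numeral_fps_const)
  finally show "fps_to_fls (X q) = l q * evp x_of_u (u q)" by simp
  have "l q * evp y_of_u (u q) = fls_const (1 / (2 * s)) * (l q * u q - l q)"
    by (simp add: y_of_u_def algebra_simps)
  also have "\<dots> = fps_to_fls (fps_const (1 / (2 * s)) * ((X q + fps_const s * Y q) - (X q - fps_const s * Y q)))"
    unfolding lu unfolding l_def by (simp add: fls_times_fps_to_fls)
  also have "fps_const (1 / (2 * s)) * ((X q + fps_const s * Y q) - (X q - fps_const s * Y q)) = (fps_const (1 / (2 * s)) * (2 * fps_const s)) * Y q"
    by (simp add: algebra_simps)
  also have "fps_const (1 / (2 * s)) * (2 * fps_const s) = 1"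
    using s_nonzero by (simp add: numeral_fps_const)
  finally show "fps_to_fls (Y q) = l q * evp y_of_u (u q)" by simp
  show "fps_to_fls (Z q) = l q * w q" using l_nonzero[OF q] by (simp add: w_def)
qed

lemma w_power4:
  assumes "q \<in> C"
  shows "w q ^ 4 = evp \<kappa> (u q)"
proof -
  let ?x = "evp x_of_u (u q)" and ?y = "evp y_of_u (u q)"
  have "fps_to_fls (X q ^ 4 + Y q ^ 4 + Z q ^ 4 + fps_const a * X q ^ 2 * Y q ^ 2) = 0"
    using local_param_XYZ(4)[OF assms] by simp
  then have "l q ^ 4 * (?x ^ 4 + ?y ^ 4 + w q ^ 4 + fls_const a * ?x ^ 2 * ?y ^ 2) = 0"
    by (simp add: fls_times_fps_to_fls fps_to_fls_power X_eq[OF assms] Y_eq[OF assms] Z_eq[OF assms]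
      algebra_simps power_mult_distrib flip: power_add)
  then have "?x ^ 4 + ?y ^ 4 + w q ^ 4 + fls_const a * ?x ^ 2 * ?y ^ 2 = 0"
    using l_nonzero[OF assms] by simp
  then show ?thesis by (simp add: \<kappa>_def algebra_simps eq_neg_iff_add_eq_0)
qed

lemma u_w_finite:
  assumes "q \<in> C" "q \<noteq> inf"
  shows "fls_subdegree (u q) \<ge> 0" "fls_subdegree (w q) \<ge> 0"
    and "u q $$ 0 = (fps_nth (X q) 0 + s * fps_nth (Y q) 0) / (fps_nth (X q) 0 - s * fps_nth (Y q) 0)"
    and "w q $$ 0 = fps_nth (Z q) 0 / (fps_nth (X q) 0 - s * fps_nth (Y q) 0)"
proof -
  have l0: "fls_subdegree (l q) = 0" "l q \<noteq> 0" using subdegree_l l_nonzero assms by auto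
  have ge: "fls_subdegree (fps_to_fls f / l q) \<ge> 0" for f
    using l0 by (cases "f = 0") (simp_all add: fls_divide_subdegree fls_subdegree_fls_to_fps)
  have nth: "(fps_to_fls f / l q) $$ 0 = fps_nth f 0 / (fps_nth (X q) 0 - s * fps_nth (Y q) 0)" for f
  proof -
    have "(fps_to_fls f / l q * l q) $$ 0 = (fps_to_fls f / l q) $$ 0 * l q $$ 0"
      by (rule fls_nth_0_mult) (use ge l0 in auto)
    moreover have "l q $$ 0 = fps_nth (X q) 0 - s * fps_nth (Y q) 0" by (simp add: l_def)
    ultimately show ?thesis using l0(2) l_0_iff[OF assms(1)] assms(2) by (simp add: field_simps)
  qed
  show "fls_subdegree (u q) \<ge> 0" "fls_subdegree (w q) \<ge> 0"
    unfolding u_def w_def by (rule ge)+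
  show "u q $$ 0 = (fps_nth (X q) 0 + s * fps_nth (Y q) 0) / (fps_nth (X q) 0 - s * fps_nth (Y q) 0)"
    unfolding u_def nth by simp
  show "w q $$ 0 = fps_nth (Z q) 0 / (fps_nth (X q) 0 - s * fps_nth (Y q) 0)"
    unfolding w_def nth by simp
qed

text \<open>\<open>u - c\<close> is the quotient by \<open>l\<close> of the equation of the line
  joining \<open>[0 : 0 : 1]\<close> to the point, whose order is given by
  \<open>subdegree_line\<close>.\<close>

lemma subdegree_u_minus_value:
  assumes "q \<in> C" "q \<noteq> inf"
  shows "fls_subdegree (u q - fls_const (u q $$ 0)) = (if fps_nth (Z q) 0 = 0 then 4 else 1)"
proof -
  define c where "c = u q $$ 0"
  have l: "l q \<noteq> 0" "fls_subdegree (l q) = 0" using l_nonzero subdegree_l assms by auto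
  have "fps_nth (X q) 0 - s * fps_nth (Y q) 0 \<noteq> 0" using l_0_iff[OF assms(1)] assms(2) by simp
  then have "c * (fps_nth (X q) 0 - s * fps_nth (Y q) 0) = fps_nth (X q) 0 + s * fps_nth (Y q) 0"
    using u_w_finite(3)[OF assms] by (simp add: c_def)
  then have "(1 - c) * fps_nth (X q) 0 + (s * (1 + c)) * fps_nth (Y q) 0 = 0"
    by (simp add: algebra_simps)
  moreover have "\<not> (1 - c = 0 \<and> s * (1 + c) = 0)" using s_nonzero by (auto simp: )
  ultimately have sd: "subdegree (fps_const (1 - c) * X q + fps_const (s * (1 + c)) * Y q) = (if fps_nth (Z q) 0 = 0 then 4 else 1)"
    by (intro subdegree_line(1)[OF assms(1)])
  let ?V = "fps_const (1 - c) * X q + fps_const (s * (1 + c)) * Y q"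
  have V: "?V = X q + fps_const s * Y q - fps_const c * (X q - fps_const s * Y q)"
    by (simp add: algebra_simps flip: fps_const_add fps_const_mult fps_const_sub)
  have "u q - fls_const c = fps_to_fls ?V / l q"
    unfolding V using l(1) by (simp add: u_def l_def diff_divide_distrib fls_times_fps_to_fls)
  moreover have "?V \<noteq> 0" using sd by (metis subdegree_0 zero_neq_numeral zero_neq_one)
  then have "fps_to_fls ?V \<noteq> 0" by (rule fps_to_fls_nonzeroI)
  ultimately show ?thesis
    using l sd
    by (simp add: c_def[symmetric] fls_divide_subdegree fls_subdegree_fls_to_fps del: fps_to_fls_plus)
qed

lemma finite_point:
  assumes "poly \<kappa> u0 = w0 ^ 4"
  shows "\<exists>q\<in>C. q \<noteq> inf \<and> u q $$ 0 = u0 \<and> w q $$ 0 = w0"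
proof -
  \<comment> \<open>The coordinate vector is normalized by \<open>x - s y = 1\<close>, so its third
    entry is \<open>w\<close> itself.\<close>
  define x y where "x = poly x_of_u u0" and "y = poly y_of_u u0"
  have xy: "x - s * y = 1" "x + s * y = u0"
    using s_nonzero by (simp_all add: x_def y_def x_of_u_def y_of_u_def field_simps)
  then have nz: "\<not> (x = 0 \<and> y = 0 \<and> w0 = 0)" by auto
  define q where "q = pt x y w0"
  have "- (x ^ 4 + y ^ 4 + a * (x ^ 2 * y ^ 2)) = w0 ^ 4"
    using assms by (simp add: \<kappa>_def x_def y_def)
  then have "x ^ 4 + y ^ 4 + w0 ^ 4 + a * x ^ 2 * y ^ 2 = 0" by algebra
  then have q: "q \<in> C" unfolding q_def using nz by (simp add: mem_curve_quartic_iff)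
  have "pt x y w0 = pt (fps_nth (X q) 0) (fps_nth (Y q) 0) (fps_nth (Z q) 0)"
    using local_param_XYZ(2)[OF q] by (simp add: q_def)
  then obtain k where k: "k \<noteq> 0" "fps_nth (X q) 0 = k * x" "fps_nth (Y q) 0 = k * y" "fps_nth (Z q) 0 = k * w0"
    using nz local_param_XYZ(1)[OF q] by (subst (asm) pt_eq_iff) auto
  have L: "fps_nth (X q) 0 - s * fps_nth (Y q) 0 = k" "fps_nth (X q) 0 + s * fps_nth (Y q) 0 = k * u0"
    using xy unfolding k by algebra+
  have "q \<noteq> inf" using l_0_iff[OF q] L k(1) by simp
  then show ?thesis
    using q u_w_finite(3,4)[OF q] L k by (intro bexI[of _ q]) auto
qed

sublocale cover: cyclic_quartic_cover C u w \<kappa> inf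
proof
  have Zinf: "fps_nth (Z inf) 0 = 0"
  proof -
    have "pt s 1 0 = pt (fps_nth (X inf) 0) (fps_nth (Y inf) 0) (fps_nth (Z inf) 0)"
      using local_param_XYZ(2)[OF inf_in] by (simp add: inf_def)
    then show ?thesis using local_param_XYZ(1)[OF inf_in] by (subst (asm) pt_eq_iff) auto
  qed
  have l: "l inf \<noteq> 0" "fls_subdegree (l inf) = 4" using l_nonzero subdegree_l inf_in by auto
  have "fps_nth (X inf) 0 = s * fps_nth (Y inf) 0" using l_0_iff[OF inf_in] by simp
  then have M: "fps_nth (X inf + fps_const s * Y inf) 0 \<noteq> 0"
    using Z_0_imp_Y_0[OF inf_in Zinf] s_nonzero by simp
  then have "subdegree (X inf + fps_const s * Y inf) = 0" "X inf + fps_const s * Y inf \<noteq> 0"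
    by (simp, metis fps_zero_nth)
  then show "fls_subdegree (u inf) = - 4"
    using l unfolding u_def by (subst fls_divide_subdegree) (auto simp: fls_subdegree_fls_to_fps simp del: fps_to_fls_plus)
  have "subdegree (Z inf) = 1"
    using subdegree_line(2)[OF inf_in, of 1 "- s"] \<open>fps_nth (X inf) 0 = s * fps_nth (Y inf) 0\<close> Zinf by simp
  moreover from this have "Z inf \<noteq> 0" by auto
  ultimately show "fls_subdegree (w inf) = - 3"
    using l unfolding w_def by (subst fls_divide_subdegree) (auto simp: fls_subdegree_fls_to_fps)
next
  fix q assume q: "q \<in> C" "q \<noteq> inf" "w q $$ 0 \<noteq> 0"
  then have "fps_nth (Z q) 0 \<noteq> 0" using u_w_finite(4)[OF q(1,2)] by auto
  then show "fls_subdegree (u q - fls_const (u q $$ 0)) = 1"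
    using subdegree_u_minus_value[OF q(1,2)] by simp
next
  fix q assume q: "q \<in> C" "q \<noteq> inf" "w q $$ 0 = 0"
  then have Z: "fps_nth (Z q) 0 = 0" using u_w_finite(4)[OF q(1,2)] l_0_iff[OF q(1)] by auto
  have "subdegree (Z q) = 1"
    using subdegree_line(2)[OF q(1), of "fps_nth (Y q) 0" "- fps_nth (X q) 0"] Z Z_0_imp_Y_0[OF q(1) Z] by simp
  moreover from this have "Z q \<noteq> 0" by auto
  ultimately have "fls_subdegree (w q) = 1"
    using l_nonzero[OF q(1)] subdegree_l[OF q(1)] q(2)
    unfolding w_def by (subst fls_divide_subdegree) (auto simp: fls_subdegree_fls_to_fps)
  then show "fls_subdegree (u q - fls_const (u q $$ 0)) = 4 \<and> fls_subdegree (w q) = 1"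
    using subdegree_u_minus_value[OF q(1,2)] Z by simp
qed (use w_power4 inf_in u_w_finite finite_point in auto)

end

section \<open>The function field and the canonical divisor\<close>

lemma fps_to_fls_eval_tpoly:
  fixes \<gamma> :: "complex fps^3"
  shows "fps_to_fls (eval_tpoly fps_const A \<gamma>) = eval_tpoly fls_const A (\<chi> m. fps_to_fls (\<gamma> $ m))"
proof -
  have "fps_to_fls (sum f S) = (\<Sum>x\<in>S. fps_to_fls (f x))" for f :: "nat \<times> nat \<times> nat \<Rightarrow> complex fps" and S
    by (induction S rule: infinite_finite_induct) simp_all
  then show ?thesis
    unfolding eval_tpoly_def by (simp add: split_def fls_times_fps_to_fls fps_to_fls_power)
qed

lemma expansion_add: "expansion F (A + B) q = expansion F A q + expansion F B q"
  and expansion_mult: "expansion F (A * B) q = expansion F A q * expansion F B q"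
  unfolding expansion_def by (simp_all add: eval_tpoly_add eval_tpoly_mult fls_times_fps_to_fls)

text \<open>Both \<open>t\<close> and \<open>c\<close> lie in the one-dimensional annihilator of two
  independent vectors: every minor of \<open>x, y\<close> times every minor of \<open>t, c\<close>
  is zero.\<close>

lemma orthogonal_parallel:
  fixes t1 :: complex
  assumes "t1 * x1 + t2 * x2 + t3 * x3 = 0" "t1 * y1 + t2 * y2 + t3 * y3 = 0"
    and "c1 * x1 + c2 * x2 + c3 * x3 = 0" "c1 * y1 + c2 * y2 + c3 * y3 = 0"
    and "x1 * y2 - x2 * y1 \<noteq> 0 \<or> x1 * y3 - x3 * y1 \<noteq> 0 \<or> x2 * y3 - x3 * y2 \<noteq> 0"
  shows "t1 * c2 = t2 * c1" "t1 * c3 = t3 * c1" "t2 * c3 = t3 * c2"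
proof -
  have "D * (t1 * c2 - t2 * c1) = 0 \<and> D * (t1 * c3 - t3 * c1) = 0 \<and> D * (t2 * c3 - t3 * c2) = 0"
    if "D = x1 * y2 - x2 * y1 \<or> D = x1 * y3 - x3 * y1 \<or> D = x2 * y3 - x3 * y2" for D
    using that assms(1-4) by (elim disjE; intro conjI; algebra)
  then show "t1 * c2 = t2 * c1" "t1 * c3 = t3 * c1" "t2 * c3 = t3 * c2"
    using assms(5) by (metis mult_eq_0_iff right_minus_eq)+
qed

context smooth_quartic
begin

text \<open>The local parameter is \<open>l\<close> times the vector of affine coordinates. In a
  quotient of two forms of equal degree the powers of \<open>l\<close> cancel.\<close>

lemma expansion_homogeneous:
  assumes "q \<in> C" "homogeneous d A"
  shows "expansion F A q = l q ^ d * eval_tpoly fls_const A (vec3 (evp x_of_u (u q)) (evp y_of_u (u q)) (w q))"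
proof -
  have "(\<chi> m. fps_to_fls (local_param F q $ m)) = l q *s vec3 (evp x_of_u (u q)) (evp y_of_u (u q)) (w q)"
    using X_eq[OF assms(1)] Y_eq[OF assms(1)] Z_eq[OF assms(1)]
    by (simp add: vec_eq_iff forall_3 vector_3 X_def Y_def Z_def)
  then show ?thesis
    by (simp add: expansion_def fps_to_fls_eval_tpoly eval_tpoly_scale[OF assms(2)])
qed

lemma regular_eval_tpoly:
  "cover.regular (\<lambda>q. eval_tpoly fls_const A (vec3 (evp x_of_u (u q)) (evp y_of_u (u q)) (w q)))"
proof (induction A rule: tpoly_induct)
  case zero
  then show ?case using cover.regular_const[of 0] by simp
next
  case (single i j k c)
  have "cover.regular (\<lambda>q. fls_const c * evp x_of_u (u q) ^ i * evp y_of_u (u q) ^ j * w q ^ k)"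
    by (intro cover.regular_mult cover.regular_power cover.regular_evp cover.regular_w cover.regular_const)
  then show ?case by (simp add: eval_tpoly_single vector_3)
next
  case (add A B)
  have "eval_tpoly fls_const (A + B) v = eval_tpoly fls_const A v + eval_tpoly fls_const B v" for v
    by (rule eval_tpoly_add) (simp_all add: fls_plus_const)
  then show ?case using cover.regular_add[OF add] by simp
qed

text \<open>\<open>h\<close> is a form of degree \<open>d\<close> divided by the \<open>d\<close>-th
  power of the line at infinity; this is homogenization, the way back from affine functions to
  forms.\<close>

definition is_form :: "nat \<Rightarrow> (proj_plane \<Rightarrow> complex fls) \<Rightarrow> bool" where
  "is_form d h \<longleftrightarrow> (\<exists>A. homogeneous d A \<and> (\<forall>q\<in>C. expansion F A q = l q ^ d * h q))"

lemma is_form_add: "is_form d h \<Longrightarrow> is_form d k \<Longrightarrow> is_form d (\<lambda>q. h q + k q)"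
  unfolding is_form_def using homogeneous_add expansion_add by (metis distrib_left)

lemma is_form_mult:
  assumes "is_form d h" "is_form e k"
  shows "is_form (d + e) (\<lambda>q. h q * k q)"
proof -
  obtain A B where "homogeneous d A" "\<forall>q\<in>C. expansion F A q = l q ^ d * h q"
      "homogeneous e B" "\<forall>q\<in>C. expansion F B q = l q ^ e * k q"
    using assms by (auto simp: is_form_def)
  then show ?thesis
    unfolding is_form_def
    by (intro exI[of _ "A * B"]) (auto simp: homogeneous_mult expansion_mult power_add)
qed

definition lin :: "complex^3 \<Rightarrow> proj_plane \<Rightarrow> complex fps" where
  "lin c q = (\<Sum>m\<in>UNIV. fps_const (c $ m) * local_param F q $ m)"

lemma lin_eq: "lin c q = fps_const (c $ 1) * X q + fps_const (c $ 2) * Y q + fps_const (c $ 3) * Z q"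
  by (simp add: lin_def sum_3 X_def Y_def Z_def)

definition lin_uw :: "complex^3 \<Rightarrow> proj_plane \<Rightarrow> complex fls" where
  "lin_uw c q = fls_const (c $ 1) * evp x_of_u (u q) + fls_const (c $ 2) * evp y_of_u (u q) + fls_const (c $ 3) * w q"

lemma fps_to_fls_lin: "q \<in> C \<Longrightarrow> fps_to_fls (lin c q) = l q * lin_uw c q"
  by (simp add: lin_eq lin_uw_def X_eq Y_eq Z_eq fls_times_fps_to_fls algebra_simps)

text \<open>Rewrites the basis \<open>1, u, w\<close> in terms of \<open>x, y, z\<close>, using
  \<open>1 = (x - s y) / l\<close> and \<open>u = (x + s y) / l\<close>.\<close>

lemma lin_uw_vec3:
  "lin_uw (vec3 (c0 + c1) (s * (c1 - c0)) c2) q = fls_const c0 + fls_const c1 * u q + fls_const c2 * w q"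
proof -
  have h: "fls_const (1 / 2) * (2 :: complex fls) = 1" by (simp flip: fls_const_numeral)
  have sy: "fls_const s * evp y_of_u (u q) = fls_const (1 / 2) * (u q - 1)"
    using s_nonzero by (simp add: y_of_u_def algebra_simps flip: mult.assoc)
  have "fls_const (s * (c1 - c0)) = (fls_const c1 - fls_const c0) * fls_const s"
    by (simp add: fls_const_mult_const fls_minus_const mult.commute)
  then have y: "fls_const (s * (c1 - c0)) * evp y_of_u (u q) = (fls_const c1 - fls_const c0) * (fls_const (1 / 2) * (u q - 1))"
    by (simp only: mult.assoc sy)
  have x: "evp x_of_u (u q) = fls_const (1 / 2) * (u q + 1)"
    by (simp add: x_of_u_def algebra_simps)
  have "fls_const (c0 + c1) * evp x_of_u (u q) + fls_const (s * (c1 - c0)) * evp y_of_u (u q)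
    = (fls_const (1 / 2) * 2) * (fls_const c0 + fls_const c1 * u q)"
    unfolding y x by (simp add: algebra_simps flip: fls_plus_const)
  then show ?thesis by (simp add: lin_uw_def vector_3 h)
qed

lemma is_form_lin_uw: "is_form 1 (lin_uw c)"
proof -
  let ?A = "Poly_Mapping.single (1, 0, 0) (c $ 1) + Poly_Mapping.single (0, 1, 0) (c $ 2)
    + Poly_Mapping.single (0, 0, 1) (c $ 3) :: tpoly"
  have "homogeneous 1 ?A" by (intro homogeneous_add homogeneous_single) auto
  moreover have "expansion F ?A q = fps_to_fls (lin c q)" for q
    by (simp add: expansion_def eval_tpoly_add eval_tpoly_single lin_eq X_def Y_def Z_def)
  ultimately show ?thesis unfolding is_form_def using fps_to_fls_lin by auto
qed

lemma is_form_linear: "is_form 1 (\<lambda>q. fls_const c0 + fls_const c1 * u q + fls_const c2 * w q)"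
proof -
  have "lin_uw (vec3 (c0 + c1) (s * (c1 - c0)) c2) = (\<lambda>q. fls_const c0 + fls_const c1 * u q + fls_const c2 * w q)"
    by (rule ext) (rule lin_uw_vec3)
  then show ?thesis using is_form_lin_uw by metis
qed

lemma is_form_le:
  assumes "is_form d h" "d \<le> e"
  shows "is_form e h"
  using assms(2)
proof (induction e rule: dec_induct)
  case (step n)
  \<comment> \<open>The constant 1 is the linear form \<open>x - s y\<close> over \<open>l\<close>,
    so it can be used to raise the degree.\<close>
  show ?case using is_form_mult[OF step(3) is_form_linear[of 1 0 0]] by simp
qed (rule assms)

lemma regular_imp_is_form:
  assumes "cover.regular h"
  shows "\<exists>d. is_form d h"
proof -
  define P where "P h \<longleftrightarrow> (\<exists>d. is_form d h)" for h
  have add: "P (\<lambda>q. h q + k q)" if "P h" "P k" for h k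
    using that is_form_le is_form_add unfolding P_def by (metis max.cobounded1 max.cobounded2)
  have mult: "P (\<lambda>q. h q * k q)" if "P h" "P k" for h k
    using that is_form_mult unfolding P_def by blast
  have const: "P (\<lambda>q. fls_const c)" for c
    using is_form_linear[of c 0 0] unfolding P_def by auto
  have u: "P u" using is_form_linear[of 0 1 0] unfolding P_def by auto
  have w: "P w" using is_form_linear[of 0 0 1] unfolding P_def by auto
  have poly: "P (\<lambda>q. evp p (u q))" for p
  proof (induction p)
    case 0
    then show ?case using const[of 0] by simp
  next
    case (pCons c p)
    then show ?case using add[OF const[of c] mult[OF u pCons(2)]] by simp
  qed
  have pw: "P (\<lambda>q. evp p (u q) * w q ^ n)" for p n
  proof (induction n)
    case (Suc n)
    then show ?case using mult[OF Suc w] by (simp add: mult.assoc mult.commute[of "w _"])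
  qed (simp add: poly)
  obtain Q where Q: "\<And>q. q \<in> C \<Longrightarrow> h q = cover.ev Q q" using assms by (auto simp: cover.regular_def)
  have "P (\<lambda>q. evp (Q 0) (u q) * w q ^ 0 + evp (Q 1) (u q) * w q ^ 1 + evp (Q 2) (u q) * w q ^ 2 + evp (Q 3) (u q) * w q ^ 3)"
    by (intro add pw)
  then have "P (cover.ev Q)" by (simp add: cover.ev_eq[abs_def])
  then obtain d where "is_form d (cover.ev Q)" by (auto simp: P_def)
  then have "is_form d h" using Q unfolding is_form_def by auto
  then show ?thesis ..
qed

text \<open>Dehomogenizing by \<open>l\<close> and homogenizing again match the two descriptions.
  What needs care is the denominator: nonzero as a normal form on one side, nonzero in value at some
  point of the curve on the other.\<close>

lemma function_field_iff:
  "\<phi> \<in> function_field F \<longleftrightarrow> (\<exists>h. cover.rational h \<and> \<phi> = (\<lambda>q. if q \<in> C then h q else 0))"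
proof
  assume "\<phi> \<in> function_field F"
  then obtain d A B v where A: "homogeneous d A" and B: "homogeneous d B"
    and v: "v \<noteq> 0" "value_at F v = 0" "value_at B v \<noteq> 0"
    and \<phi>: "\<phi> = (\<lambda>p. if p \<in> C then expansion F A p / expansion F B p else 0)"
    unfolding function_field_def by auto
  let ?h = "\<lambda>A q. eval_tpoly fls_const A (vec3 (evp x_of_u (u q)) (evp y_of_u (u q)) (w q))"
  obtain N where N: "\<And>q. q \<in> C \<Longrightarrow> ?h A q = cover.ev N q"
    using regular_eval_tpoly[of A] unfolding cover.regular_def by blast
  obtain D where D: "\<And>q. q \<in> C \<Longrightarrow> ?h B q = cover.ev D q"
    using regular_eval_tpoly[of B] unfolding cover.regular_def by blast
  have "\<not> cover.quad_zero D"
  proof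
    assume z: "cover.quad_zero D"
    define q where "q = abs_proj_plane v"
    have q: "q \<in> C" using v by (auto simp: q_def curve_def)
    define v0 where "v0 = vec3 (fps_nth (X q) 0) (fps_nth (Y q) 0) (fps_nth (Z q) 0)"
    have v0: "v0 \<noteq> 0" "q = abs_proj_plane v0"
      using local_param_XYZ(1,2)[OF q] by (simp_all add: v0_def pt_def)
    then obtain c where c: "c \<noteq> 0" "v0 = c *s v"
      using abs_proj_plane_eq_iff[OF v(1) v0(1)] by (auto simp: q_def)
    have "expansion F B q = 0"
      using expansion_homogeneous[OF q B] D[OF q] cover.ev_quad_zero[OF z] by simp
    then have "fps_nth (eval_tpoly fps_const B (local_param F q)) 0 = 0" by (simp add: expansion_def)
    moreover have "(\<chi> m. fps_nth (local_param F q $ m) 0) = v0"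
      by (simp add: v0_def vec_eq_iff forall_3 vector_3 X_def Y_def Z_def)
    ultimately have "value_at B v0 = 0" by (simp add: nth_0_eval_tpoly)
    moreover have "value_at B v0 = c ^ d * value_at B v" unfolding c(2) by (rule eval_tpoly_scale[OF B])
    ultimately show False using v(3) c by simp
  qed
  moreover have "expansion F A q / expansion F B q = cover.ev N q / cover.ev D q" if "q \<in> C" for q
    using expansion_homogeneous[OF that A] expansion_homogeneous[OF that B] N[OF that] D[OF that] l_nonzero[OF that]
    by simp
  ultimately show "\<exists>h. cover.rational h \<and> \<phi> = (\<lambda>q. if q \<in> C then h q else 0)"
    unfolding cover.rational_def \<phi>
    by (intro exI[of _ "\<lambda>q. cover.ev N q / cover.ev D q"]) auto
next
  assume "\<exists>h. cover.rational h \<and> \<phi> = (\<lambda>q. if q \<in> C then h q else 0)"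
  then obtain h where h: "cover.rational h" and \<phi>: "\<phi> = (\<lambda>q. if q \<in> C then h q else 0)" by blast
  then obtain N D where D: "\<not> cover.quad_zero D" and hND: "\<And>q. q \<in> C \<Longrightarrow> h q = cover.ev N q / cover.ev D q"
    unfolding cover.rational_def by blast
  obtain d e where "is_form d (cover.ev N)" "is_form e (cover.ev D)"
    using regular_imp_is_form cover.regular_ev by blast
  then have "is_form (max d e) (cover.ev N)" "is_form (max d e) (cover.ev D)"
    by (auto elim: is_form_le)
  then obtain A B where A: "homogeneous (max d e) A" "\<And>q. q \<in> C \<Longrightarrow> expansion F A q = l q ^ max d e * cover.ev N q"
    and B: "homogeneous (max d e) B" "\<And>q. q \<in> C \<Longrightarrow> expansion F B q = l q ^ max d e * cover.ev D q"
    unfolding is_form_def by blast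
  \<comment> \<open>A point where the homogenized denominator is nonzero: its norm is a polynomial
    \<open>b\<close> in \<open>u\<close>, so any point over a non-root of \<open>b\<close> will
    do.\<close>
  obtain E b where E: "b \<noteq> 0" "\<And>q. q \<in> C \<Longrightarrow> cover.ev D q * cover.ev E q = evp b (u q)"
    using D by (rule cover.norm_exists) (rule that)
  have "finite {x. poly b x = 0}" using E(1) by (rule poly_roots_finite)
  then obtain u0 where u0: "poly b u0 \<noteq> 0"
    using infinite_UNIV_char_0[where 'a = complex] by (metis (mono_tags) UNIV_eq_I mem_Collect_eq)
  obtain w0 where "w0 ^ 4 = poly \<kappa> u0" by (rule fourth_root_exists)
  then obtain q where q: "q \<in> C" "q \<noteq> inf" "u q $$ 0 = u0" using finite_point by metis
  have "cover.ev D q $$ 0 * cover.ev E q $$ 0 = poly b u0"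
    using arg_cong[OF E(2)[OF q(1)], of "\<lambda>f. f $$ 0"] q u_w_finite(1)[OF q(1,2)]
    by (simp add: fls_nth_0_mult cover.ev_finite(1) evp_nth_0)
  then have "cover.ev D q $$ 0 \<noteq> 0" using u0 by auto
  moreover have l0: "l q $$ 0 \<noteq> 0" "fls_subdegree (l q) \<ge> 0"
    using l_0_iff[OF q(1)] q(2) subdegree_l[OF q(1)] by (auto simp: l_def)
  ultimately have "expansion F B q $$ 0 \<noteq> 0"
    using B(2)[OF q(1)] by (simp add: fls_nth_0_mult fls_nth_0_power fls_subdegree_power_ge_0 cover.ev_finite(1) q)
  then have "fps_nth (eval_tpoly fps_const B (local_param F q)) 0 \<noteq> 0" by (simp add: expansion_def)
  moreover define v0 where "v0 = vec3 (fps_nth (X q) 0) (fps_nth (Y q) 0) (fps_nth (Z q) 0)"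
  moreover have "(\<chi> m. fps_nth (local_param F q $ m) 0) = v0"
    by (simp add: v0_def vec_eq_iff forall_3 vector_3 X_def Y_def Z_def)
  ultimately have "value_at B v0 \<noteq> 0" by (simp add: nth_0_eval_tpoly)
  moreover have "v0 \<noteq> 0" "value_at F v0 = 0"
    using local_param_XYZ(1)[OF q(1)] XYZ_0[OF q(1)] by (simp_all add: v0_def value_at_quartic vector_3)
  moreover have "\<phi> = (\<lambda>p. if p \<in> C then expansion F A p / expansion F B p else 0)"
    unfolding \<phi> using A(2) B(2) hND l_nonzero by auto
  ultimately show "\<phi> \<in> function_field F"
    unfolding function_field_def using A(1) B(1) by blast
qed

text \<open>Each differential is a rational \<open>g\<close> times \<open>du / w\<^sup>3\<close>,
  whose orders are those of \<open>l\<close>. Every canonical divisor is therefore that of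
  \<open>g\<close> plus the line section cut out by \<open>l\<close>.\<close>

lemma canonical_divisor_form:
  assumes "is_canonical_divisor F K"
  obtains g where "cover.rational g" "\<And>q. q \<in> C \<Longrightarrow> g q \<noteq> 0"
    "\<And>q. q \<in> C \<Longrightarrow> K q = fls_subdegree (g q) + fls_subdegree (l q)"
proof -
  obtain \<phi> \<psi> p where ff: "\<phi> \<in> function_field F" "\<psi> \<in> function_field F"
    and p: "p \<in> C" "\<psi> p * fls_deriv (\<phi> p) \<noteq> 0"
    and K: "K = (\<lambda>p. if p \<in> C then fls_subdegree (\<psi> p * fls_deriv (\<phi> p)) else 0)"
    using assms unfolding is_canonical_divisor_def by blast
  obtain h where h: "cover.rational h" "\<phi> = (\<lambda>q. if q \<in> C then h q else 0)"
    using ff(1) function_field_iff by blast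
  obtain k where k: "cover.rational k" "\<psi> = (\<lambda>q. if q \<in> C then k q else 0)"
    using ff(2) function_field_iff by blast
  obtain g where g: "cover.rational g" "\<And>q. q \<in> C \<Longrightarrow> fls_deriv (h q) = g q * (fls_deriv (u q) / w q ^ 3)"
    using h(1) by (rule cover.rational_deriv) (rule that)
  have r: "cover.rational (\<lambda>q. k q * g q)" using k(1) g(1) by (rule cover.rational_mult)
  have "k p * g p \<noteq> 0" using p(2) g(2)[OF p(1)] by (auto simp: h(2) k(2) p(1))
  then have nz: "k q * g q \<noteq> 0" if "q \<in> C" for q using cover.rational_nonzero[OF r p(1) _ that] by simp
  have "K q = fls_subdegree (k q * g q) + fls_subdegree (l q)" if "q \<in> C" for q
  proof -
    have "fls_deriv (u q) / w q ^ 3 \<noteq> 0" using cover.deriv_u_nonzero[OF that] cover.w_nonzero[OF that] by simp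
    moreover have "K q = fls_subdegree (k q * g q * (fls_deriv (u q) / w q ^ 3))"
      using that g(2)[OF that] by (simp add: K h(2) k(2) mult.assoc)
    ultimately show ?thesis
      using nz[OF that] cover.subdegree_differential[OF that] subdegree_l[OF that]
      by (subst (asm) fls_subdegree_mult) simp_all
  qed
  with r nz show ?thesis by (rule that)
qed

text \<open>The differential \<open>du\<close> is a witness, so the choice made in
  \<open>canonical_divisor\<close> is a genuine one.\<close>

lemma canonical_divisor: "is_canonical_divisor F (canonical_divisor F)"
proof -
  let ?\<phi> = "\<lambda>q. if q \<in> C then u q else 0" and ?\<psi> = "\<lambda>q. if q \<in> C then 1 else 0"
  have ff: "?\<phi> \<in> function_field F" "?\<psi> \<in> function_field F"
    unfolding function_field_iff
    using cover.regular_imp_rational[OF cover.regular_u] cover.regular_imp_rational[OF cover.regular_const[of 1]] by auto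
  have nz: "?\<psi> inf * fls_deriv (?\<phi> inf) \<noteq> 0"
    using inf_in cover.deriv_u_nonzero by simp
  have "is_canonical_divisor F (\<lambda>p. if p \<in> C then fls_subdegree (?\<psi> p * fls_deriv (?\<phi> p)) else 0)"
    unfolding is_canonical_divisor_def
    by (intro bexI[of _ ?\<phi>] bexI[of _ ?\<psi>] conjI bexI[of _ inf] refl ff nz inf_in)
  then show ?thesis
    unfolding canonical_divisor_def by (rule someI[of "is_canonical_divisor F"])
qed

section \<open>Gaps\<close>

lemma lin_nonzero:
  assumes "q \<in> C" "c \<noteq> 0"
  shows "lin c q \<noteq> 0"
proof
  assume "lin c q = 0"
  then have z: "lin_uw c q = 0" using fps_to_fls_lin[OF assms(1), of c] l_nonzero[OF assms(1)] by simp
  have "lin_uw c q = cover.ev (cover.quad (smult (c $ 1) x_of_u + smult (c $ 2) y_of_u) [:c $ 3:] 0 0) q"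
    by (simp add: lin_uw_def cover.ev_quad)
  then have "cover.quad_zero (cover.quad (smult (c $ 1) x_of_u + smult (c $ 2) y_of_u) [:c $ 3:] 0 0)"
    using z cover.ev_nonzero[OF assms(1)] by metis
  then have *: "smult (c $ 1) x_of_u + smult (c $ 2) y_of_u = 0" "c $ 3 = 0" by simp_all
  \<comment> \<open>At \<open>u = 1\<close> the pair \<open>(x_of_u, y_of_u)\<close> is
    \<open>(1, 0)\<close>, at \<open>u = - 1\<close> it is \<open>(0, - 1 / s)\<close>.\<close>
  have "c $ 1 = 0" using arg_cong[OF *(1), of "\<lambda>p. poly p 1"] by (simp add: x_of_u_def y_of_u_def)
  moreover have "c $ 2 = 0"
    using arg_cong[OF *(1), of "\<lambda>p. poly p (- 1)"] s_nonzero by (simp add: x_of_u_def y_of_u_def)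
  ultimately have "c = 0" using *(2) by (simp add: vec_eq_iff forall_3)
  then show False using assms(2) by simp
qed

definition vanishing_forms :: "nat \<Rightarrow> proj_plane \<Rightarrow> (complex^3) set" where
  "vanishing_forms n p = {c. \<forall>i<n. fps_nth (lin c p) i = 0}"

lemma lin_add: "lin (c + d) q = lin c q + lin d q"
  by (simp add: lin_eq algebra_simps flip: fps_const_add)

lemma lin_scale: "lin (r *s c) q = fps_const r * lin c q"
  by (simp add: lin_eq algebra_simps flip: fps_const_mult)

lemma lin_0 [simp]: "lin 0 q = 0"
  by (simp add: lin_eq)

lemma subspace_vanishing_forms: "vec.subspace (vanishing_forms n p)"
  by (rule vec.subspaceI) (auto simp: vanishing_forms_def lin_add lin_scale)

lemma mem_vanishing_forms_iff:
  assumes "p \<in> C" "c \<noteq> 0"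
  shows "c \<in> vanishing_forms n p \<longleftrightarrow> n \<le> subdegree (lin c p)"
  using lin_nonzero[OF assms] unfolding vanishing_forms_def
  by (auto intro: subdegree_geI nth_less_subdegree_zero)

text \<open>Holomorphic differentials on a smooth plane quartic correspond to linear forms.\<close>

lemma RR_dim_K_minus:
  assumes p: "p \<in> C"
  shows "RR_dim F (K_minus F n p) = vec.dim (vanishing_forms n p)"
proof -
  obtain g where g: "cover.rational g" "\<And>q. q \<in> C \<Longrightarrow> g q \<noteq> 0"
    and K: "\<And>q. q \<in> C \<Longrightarrow> canonical_divisor F q = fls_subdegree (g q) + fls_subdegree (l q)"
    using canonical_divisor by (rule canonical_divisor_form) (rule that)
  \<comment> \<open>Multiplication by \<open>g\<close> moves the space of \<open>K - n p\<close> to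
    the functions with divisor at least \<open>n p\<close> minus that of \<open>l\<close>, and
    multiplication by \<open>l\<close> then yields linear forms vanishing to order \<open>n\<close>
    at \<open>p\<close>.\<close>
  define \<Phi> where "\<Phi> c = (\<lambda>q. if q \<in> C then lin_uw c q / g q else 0)" for c
  have rat: "cover.rational (lin_uw c)" for c
    unfolding lin_uw_def
    by (intro cover.regular_imp_rational cover.regular_add cover.regular_mult cover.regular_evp cover.regular_const cover.regular_w)
  have lin0: "lin_uw c q \<noteq> 0" if "q \<in> C" "c \<noteq> 0" for c q
    using lin_nonzero[OF that] fps_to_fls_lin[OF that(1), of c] by auto
  have sub: "int (subdegree (lin c q)) = fls_subdegree (l q) + fls_subdegree (lin_uw c q)" if "q \<in> C" "c \<noteq> 0" for c q
    using fps_to_fls_lin[OF that(1), of c] l_nonzero[OF that(1)] lin0[OF that]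
    by (metis fls_subdegree_fls_to_fps fls_subdegree_mult)
  have lin_uw_0: "lin_uw 0 q = 0" for q by (simp add: lin_uw_def)
  have linear: "Vector_Spaces.linear (*s) scale_ratfun \<Phi>"
  proof -
    interpret R: vector_space scale_ratfun by (rule vector_space_scale_ratfun)
    show ?thesis
      by unfold_locales
        (auto simp: \<Phi>_def fun_eq_iff scale_ratfun_def lin_uw_def algebra_simps add_divide_distrib
          simp flip: fls_plus_const fls_const_mult_const)
  qed
  have inj: "inj \<Phi>"
  proof (rule injI)
    fix c d assume "\<Phi> c = \<Phi> d"
    then have "lin_uw c p / g p = lin_uw d p / g p" using p by (auto simp: \<Phi>_def dest: fun_cong[of _ _ p])
    then have "lin_uw c p = lin_uw d p" using g(2)[OF p] by simp
    moreover have "lin_uw (c - d) p = lin_uw c p - lin_uw d p"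
      by (simp add: lin_uw_def algebra_simps flip: fls_minus_const)
    ultimately have "lin_uw (c - d) p = 0" by simp
    then show "c = d" using lin0[OF p, of "c - d"] by auto
  qed
  have "\<Phi> ` vanishing_forms n p = RR_space F (K_minus F n p)"
  proof (intro equalityI subsetI)
    fix \<phi> assume "\<phi> \<in> \<Phi> ` vanishing_forms n p"
    then obtain c where c: "c \<in> vanishing_forms n p" "\<phi> = \<Phi> c" by auto
    have ff: "\<phi> \<in> function_field F"
      unfolding function_field_iff c(2) \<Phi>_def
      using cover.rational_divide[OF rat[of c] g(1) p g(2)[OF p]] by blast
    show "\<phi> \<in> RR_space F (K_minus F n p)"
    proof (cases "c = 0")
      case True
      then have "\<phi> = (\<lambda>_. 0)" by (auto simp: c(2) \<Phi>_def lin_uw_0)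
      then show ?thesis using ff by (simp add: RR_space_def)
    next
      case False
      have "fls_subdegree (\<phi> q) \<ge> - K_minus F n p q" if q: "q \<in> C" for q
      proof -
        have "fls_subdegree (\<phi> q) = int (subdegree (lin c q)) - fls_subdegree (l q) - fls_subdegree (g q)"
          using q lin0[OF q False] g(2)[OF q] sub[OF q False] by (simp add: c(2) \<Phi>_def fls_divide_subdegree)
        moreover have "q = p \<Longrightarrow> int n \<le> int (subdegree (lin c q))"
          using mem_vanishing_forms_iff[OF p False] c(1) by simp
        ultimately show ?thesis using K[OF q] by (auto simp: K_minus_def)
      qed
      then show ?thesis using ff by (simp add: RR_space_def)
    qed
  next
    fix \<phi> assume \<phi>: "\<phi> \<in> RR_space F (K_minus F n p)"
    show "\<phi> \<in> \<Phi> ` vanishing_forms n p"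
    proof (cases "\<phi> = (\<lambda>_. 0)")
      case True
      then have "\<phi> = \<Phi> 0" by (auto simp: \<Phi>_def lin_uw_0)
      then show ?thesis by (auto simp: vanishing_forms_def)
    next
      case False
      obtain h where h: "cover.rational h" "\<phi> = (\<lambda>q. if q \<in> C then h q else 0)"
        using \<phi> function_field_iff unfolding RR_space_def by blast
      have ord: "fls_subdegree (h q) \<ge> - K_minus F n p q" if "q \<in> C" for q
        using \<phi> False that unfolding RR_space_def h(2) by auto
      obtain q0 where "q0 \<in> C" "h q0 \<noteq> 0" using False h(2) by fastforce
      then have h0: "h q \<noteq> 0" if "q \<in> C" for q using cover.rational_nonzero[OF h(1) _ _ that] by blast
      have hg: "fls_subdegree (h q * g q) \<ge> (if q = p then int n else 0) - fls_subdegree (l q)" if "q \<in> C" for q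
        using ord[OF that] K[OF that] h0[OF that] g(2)[OF that] by (auto simp: K_minus_def)
      \<comment> \<open>\<open>regular_sections\<close> applies since \<open>l\<close> has order 4
        at \<open>inf\<close> and order 0 elsewhere.\<close>
      obtain c0 c1 c2 where c: "\<And>q. q \<in> C \<Longrightarrow> h q * g q = fls_const c0 + fls_const c1 * u q + fls_const c2 * w q"
      proof (rule cover.regular_sections)
        show "cover.rational (\<lambda>q. h q * g q)" using h(1) g(1) by (rule cover.rational_mult)
        show "fls_subdegree (h q * g q) \<ge> 0" if "q \<in> C" "q \<noteq> inf" for q
          using hg[OF that(1)] subdegree_l[OF that(1)] that(2) by (auto split: if_splits)
        show "fls_subdegree (h inf * g inf) \<ge> - 4"
          using hg[OF inf_in] subdegree_l[OF inf_in] by (auto split: if_splits)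
      qed (rule that)
      define cc where "cc = vec3 (c0 + c1) (s * (c1 - c0)) c2"
      have hc: "h q * g q = lin_uw cc q" if "q \<in> C" for q
        using c[OF that] by (simp only: cc_def lin_uw_vec3)
      have "h q = lin_uw cc q / g q" if "q \<in> C" for q
        using hc[OF that] g(2)[OF that] by (metis nonzero_mult_div_cancel_right)
      then have "\<phi> = \<Phi> cc" by (auto simp: h(2) \<Phi>_def)
      moreover have "cc \<noteq> 0" using hc[OF p] h0[OF p] g(2)[OF p] lin_uw_0 by auto
      then have "cc \<in> vanishing_forms n p"
        using hg[OF p] hc[OF p] sub[OF p \<open>cc \<noteq> 0\<close>] by (simp add: mem_vanishing_forms_iff[OF p])
      ultimately show ?thesis by blast
    qed
  qed
  moreover have "vector_space.dim scale_ratfun (\<Phi> ` vanishing_forms n p) = vec.dim (vanishing_forms n p)"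
  proof -
    interpret R: vector_space scale_ratfun by (rule vector_space_scale_ratfun)
    interpret P: finite_dimensional_vector_space_pair_1 "(*s) :: complex \<Rightarrow> complex^3 \<Rightarrow> _" cart_basis scale_ratfun ..
    show ?thesis using linear inj by (intro P.dim_image_eq) (auto simp: inj_on_def)
  qed
  ultimately show ?thesis by (simp add: RR_dim_def)
qed

text \<open>The dimension drops from \<open>n\<close> to \<open>Suc n\<close> exactly when some
  linear form vanishes to order precisely \<open>n\<close>. The gap is \<open>Suc n\<close>, since a
  gap \<open>m\<close> compares the orders \<open>m - 1\<close> and \<open>m\<close>.\<close>

lemma gaps_eq:
  assumes "p \<in> C"
  shows "gaps F p = Suc ` {subdegree (lin c p) | c. c \<noteq> 0}"
proof -
  have "RR_dim F (K_minus F (Suc n) p) < RR_dim F (K_minus F n p) \<longleftrightarrow> (\<exists>c. c \<noteq> 0 \<and> subdegree (lin c p) = n)" for n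
  proof -
    have sub: "vanishing_forms (Suc n) p \<subseteq> vanishing_forms n p" by (auto simp: vanishing_forms_def)
    have "vec.dim (vanishing_forms (Suc n) p) < vec.dim (vanishing_forms n p) \<longleftrightarrow> vanishing_forms (Suc n) p \<noteq> vanishing_forms n p"
      using vec.subspace_dim_equal[OF subspace_vanishing_forms subspace_vanishing_forms sub] by (metis linorder_not_le order_less_irrefl)
    also have "\<dots> \<longleftrightarrow> (\<exists>c. c \<in> vanishing_forms n p \<and> c \<notin> vanishing_forms (Suc n) p)" using sub by blast
    also have "\<dots> \<longleftrightarrow> (\<exists>c. c \<noteq> 0 \<and> subdegree (lin c p) = n)"
    proof -
      have "0 \<in> vanishing_forms (Suc n) p" by (simp add: vanishing_forms_def)
      moreover have "c \<in> vanishing_forms n p \<and> c \<notin> vanishing_forms (Suc n) p \<longleftrightarrow> subdegree (lin c p) = n" if "c \<noteq> 0" for c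
        using mem_vanishing_forms_iff[OF assms that] by auto
      ultimately show ?thesis by metis
    qed
    finally show ?thesis by (simp add: RR_dim_K_minus[OF assms])
  qed
  then have "m \<ge> 1 \<and> RR_dim F (K_minus F m p) < RR_dim F (K_minus F (m - 1) p)
    \<longleftrightarrow> m \<in> Suc ` {subdegree (lin c p) | c. c \<noteq> 0}" for m
    by (cases m) auto
  then show ?thesis unfolding gaps_def by auto
qed

text \<open>A linear form has order 0 at \<open>p\<close> if it misses \<open>p\<close>, order 1 if
  it meets the curve transversally there, and otherwise it is a multiple of \<open>T\<close>,
  because base point and velocity are independent.\<close>

lemma gaps_tangent:
  assumes p: "p \<in> C" and T: "T \<noteq> 0" "subdegree (lin T p) \<ge> 2"
  shows "gaps F p = {1, 2, Suc (subdegree (lin T p))}"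
proof -
  define v0 v1 where "v0 = (\<chi> m. fps_nth (local_param F p $ m) 0)" and "v1 = (\<chi> m. fps_nth (local_param F p $ m) 1)"
  have v: "v0 = vec3 (fps_nth (X p) 0) (fps_nth (Y p) 0) (fps_nth (Z p) 0)"
    "v1 = vec3 (fps_nth (X p) 1) (fps_nth (Y p) 1) (fps_nth (Z p) 1)"
    by (simp_all add: v0_def v1_def vec_eq_iff forall_3 vector_3 X_def Y_def Z_def)
  have n0: "fps_nth (lin c p) 0 = c $ 1 * v0 $ 1 + c $ 2 * v0 $ 2 + c $ 3 * v0 $ 3"
    and n1: "fps_nth (lin c p) 1 = c $ 1 * v1 $ 1 + c $ 2 * v1 $ 2 + c $ 3 * v1 $ 3" for c
    by (simp_all add: lin_eq v vector_3)
  have ind: "v0 \<noteq> 0" "\<And>r. v1 \<noteq> r *s v0"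
    using local_param_XYZ(1,3)[OF p] by (simp_all add: v scale_vec3 vec3_eq_iff vector_3)
  have nz: "v0 $ 1 * v1 $ 2 - v0 $ 2 * v1 $ 1 \<noteq> 0 \<or> v0 $ 1 * v1 $ 3 - v0 $ 3 * v1 $ 1 \<noteq> 0 \<or> v0 $ 2 * v1 $ 3 - v0 $ 3 * v1 $ 2 \<noteq> 0"
  proof (rule ccontr)
    assume n: "\<not> ?thesis"
    consider "v0 $ 1 \<noteq> 0" | "v0 $ 2 \<noteq> 0" | "v0 $ 3 \<noteq> 0" using ind(1) by (auto simp: vec_eq_iff forall_3)
    then show False
    proof cases
      case 1
      then show False using ind(2)[of "v1 $ 1 / v0 $ 1"] n by (auto simp: vec_eq_iff forall_3 field_simps)
    next
      case 2
      then show False using ind(2)[of "v1 $ 2 / v0 $ 2"] n by (auto simp: vec_eq_iff forall_3 field_simps)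
    next
      case 3
      then show False using ind(2)[of "v1 $ 3 / v0 $ 3"] n by (auto simp: vec_eq_iff forall_3 field_simps)
    qed
  qed
  have T0: "fps_nth (lin T p) 0 = 0" "fps_nth (lin T p) 1 = 0"
    using T(2) by (auto intro!: nth_less_subdegree_zero)
  have sd: "subdegree (lin c p) \<in> {0, 1, subdegree (lin T p)}" if c: "c \<noteq> 0" for c
  proof (cases "fps_nth (lin c p) 0 = 0 \<and> fps_nth (lin c p) 1 = 0")
    case False
    then have "subdegree (lin c p) \<le> 1" by (metis le0 le_refl subdegree_leI zero_le_one order_trans)
    then show ?thesis by auto
  next
    case True
    have "T $ 1 * v0 $ 1 + T $ 2 * v0 $ 2 + T $ 3 * v0 $ 3 = 0" "T $ 1 * v1 $ 1 + T $ 2 * v1 $ 2 + T $ 3 * v1 $ 3 = 0"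
      "c $ 1 * v0 $ 1 + c $ 2 * v0 $ 2 + c $ 3 * v0 $ 3 = 0" "c $ 1 * v1 $ 1 + c $ 2 * v1 $ 2 + c $ 3 * v1 $ 3 = 0"
      using T0 True n0 n1 by metis+
    note orthogonal_parallel[OF this nz]
    then have par: "T $ i * c $ j = T $ j * c $ i" for i j
      using exhaust_3[of i] exhaust_3[of j] by auto
    obtain i where "T $ i \<noteq> 0" using T(1) by (auto simp: vec_eq_iff)
    then have ceq: "c = (c $ i / T $ i) *s T" using par by (simp add: vec_eq_iff field_simps)
    then have "c $ i / T $ i \<noteq> 0" using c by (metis vector_smult_lzero)
    then have "subdegree (lin c p) = subdegree (lin T p)"
      by (subst ceq) (simp add: lin_scale lin_nonzero[OF p T(1)])
    then show ?thesis by simp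
  qed
  have "\<exists>c. c \<noteq> 0 \<and> subdegree (lin c p) = 0"
  proof -
    obtain i where i: "v0 $ i \<noteq> 0" using ind(1) by (auto simp: vec_eq_iff)
    then have "fps_nth (lin (axis i 1) p) 0 \<noteq> 0"
      using exhaust_3[of i] by (auto simp: n0 axis_def)
    then show ?thesis by (intro exI[of _ "axis i 1"]) auto
  qed
  moreover have "\<exists>c. c \<noteq> 0 \<and> subdegree (lin c p) = 1"
  proof -
    have *: "\<exists>c. c \<noteq> 0 \<and> subdegree (lin c p) = 1"
      if "fps_nth (lin c p) 0 = 0" "fps_nth (lin c p) 1 \<noteq> 0" for c
    proof -
      have "subdegree (lin c p) = 1" using that by (intro subdegreeI) auto
      then show ?thesis by (intro exI[of _ c]) auto
    qed
    from nz show ?thesis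
    proof (elim disjE)
      assume "v0 $ 1 * v1 $ 2 - v0 $ 2 * v1 $ 1 \<noteq> 0"
      \<comment> \<open>The line joining \<open>p\<close> to a coordinate vertex; its first-order
        coefficient along the curve is exactly the minor assumed nonzero. The other two cases use
        the other vertices.\<close>
      then show ?thesis by (intro *[of "vec3 (- v0 $ 2) (v0 $ 1) 0"]) (auto simp: n0 n1 vector_3 algebra_simps simp del: One_nat_def)
    next
      assume "v0 $ 1 * v1 $ 3 - v0 $ 3 * v1 $ 1 \<noteq> 0"
      then show ?thesis by (intro *[of "vec3 (- v0 $ 3) 0 (v0 $ 1)"]) (auto simp: n0 n1 vector_3 algebra_simps simp del: One_nat_def)
    next
      assume "v0 $ 2 * v1 $ 3 - v0 $ 3 * v1 $ 2 \<noteq> 0"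
      then show ?thesis by (intro *[of "vec3 0 (- v0 $ 3) (v0 $ 2)"]) (auto simp: n0 n1 vector_3 algebra_simps simp del: One_nat_def)
    qed
  qed
  ultimately obtain d e where de: "d \<noteq> 0" "subdegree (lin d p) = 0" "e \<noteq> 0" "subdegree (lin e p) = 1" by blast
  have mem: "subdegree (lin c p) \<in> {subdegree (lin c p) | c. c \<noteq> 0}" if "c \<noteq> 0" for c
    using that by blast
  have "{0, 1, subdegree (lin T p)} \<subseteq> {subdegree (lin c p) | c. c \<noteq> 0}"
    using mem[OF de(1)] mem[OF de(3)] mem[OF T(1)] unfolding de by (simp only: insert_subset empty_subsetI simp_thms)
  moreover have "{subdegree (lin c p) | c. c \<noteq> 0} \<subseteq> {0, 1, subdegree (lin T p)}"
  proof
    fix m assume "m \<in> {subdegree (lin c p) | c. c \<noteq> 0}"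
    then obtain c where "c \<noteq> 0" "m = subdegree (lin c p)" by blast
    then show "m \<in> {0, 1, subdegree (lin T p)}" using sd[of c] by simp
  qed
  ultimately have "{subdegree (lin c p) | c. c \<noteq> 0} = {0, 1, subdegree (lin T p)}" by (rule equalityI[rotated])
  then show ?thesis unfolding gaps_eq[OF p] by (simp add: numeral_2_eq_2)
qed

text \<open>The gaps \<open>1, 2, m + 1\<close> contribute
  \<open>0 + 0 + (m + 1 - 3)\<close>.\<close>

lemma weight_tangent:
  assumes "p \<in> C" "T \<noteq> 0" "subdegree (lin T p) \<ge> 2"
  shows "weight F p = int (subdegree (lin T p)) - 2"
proof -
  have "sorted_list_of_set (set [1, 2, Suc (subdegree (lin T p))]) = [1, 2, Suc (subdegree (lin T p))]"
    using assms(3) by (intro sorted_list_of_set.idem_if_sorted_distinct) auto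
  then have "sorted_list_of_set {1, 2, Suc (subdegree (lin T p))} = [1, 2, Suc (subdegree (lin T p))]"
    by (simp only: list.set)
  then show ?thesis
    unfolding weight_def gaps_tangent[OF assms] Let_def by (simp add: numeral_3_eq_3)
qed

section \<open>Tangent lines and flexes\<close>

lemma lin_vec3: "lin (vec3 c1 c2 c3) q = fps_const c1 * X q + fps_const c2 * Y q + fps_const c3 * Z q"
  by (simp add: lin_eq vector_3)

text \<open>\<open>tangent_line\<close> uses the chosen representative of \<open>p\<close>, whereas
  \<open>T\<close> uses the start of the local parameter. The gradient is homogeneous of degree 3,
  so the two differ by the cube of a nonzero scalar.\<close>

lemma line_mult_tangent_line:
  assumes "p \<in> C"
  defines "T \<equiv> gradient F (vec3 (fps_nth (X p) 0) (fps_nth (Y p) 0) (fps_nth (Z p) 0))"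
  shows "line_mult F p (tangent_line F p) = subdegree (lin T p)" "tangent_line F p \<noteq> 0"
proof -
  let ?v = "vec3 (fps_nth (X p) 0) (fps_nth (Y p) 0) (fps_nth (Z p) 0)"
  have "?v \<noteq> 0" "abs_proj_plane ?v = abs_proj_plane (rep_proj_plane p)"
    using local_param_XYZ(1,2)[OF assms(1)] by (simp_all add: pt_def)
  then obtain c where c: "c \<noteq> 0" "rep_proj_plane p = c *s ?v"
    using abs_proj_plane_eq_iff[OF _ rep_proj_plane_nonzero] by blast
  have "tangent_line F p = c ^ 3 *s T"
    unfolding tangent_line_def c(2) T_def gradient_quartic
    by (simp add: scale_vec3 vec3_eq_iff vector_3 power2_eq_square power3_eq_cube algebra_simps)
  moreover have "T \<noteq> 0"
  proof -
    have "value_at F ?v = 0" using XYZ_0[OF assms(1)] by (simp add: value_at_quartic vector_3)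
    then show ?thesis
      using smooth_quartic[OF a2] \<open>?v \<noteq> 0\<close> unfolding smooth_plane_curve_def T_def by blast
  qed
  moreover have "line_mult F p l = subdegree (lin l p)" for l by (simp add: line_mult_def lin_def)
  ultimately show "line_mult F p (tangent_line F p) = subdegree (lin T p)" "tangent_line F p \<noteq> 0"
    using c(1) lin_nonzero[OF assms(1)] by (simp_all add: lin_scale)
qed

text \<open>The Hessian determinant of the binary form \<open>f\<close>, divided by 12.\<close>

definition hess :: "complex \<Rightarrow> complex \<Rightarrow> complex" where
  "hess x y = 2 * a * (x ^ 4 + y ^ 4) + (12 - a ^ 2) * x ^ 2 * y ^ 2"

text \<open>Here the gradient has no \<open>z\<close> component, so the tangent passes through
  \<open>[0 : 0 : 1]\<close> and \<open>subdegree_line\<close> applies; Euler's relation gives the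
  incidence.\<close>

lemma line_mult_tangent_z_0:
  assumes p: "p \<in> C" and z: "fps_nth (Z p) 0 = 0"
  shows "line_mult F p (tangent_line F p) = 4"
proof -
  define x y where "x = fps_nth (X p) 0" and "y = fps_nth (Y p) 0"
  define fx fy where "fx = 4 * x ^ 3 + 2 * a * x * y ^ 2" and "fy = 4 * y ^ 3 + 2 * a * x ^ 2 * y"
  have f: "x ^ 4 + y ^ 4 + a * x ^ 2 * y ^ 2 = 0" using XYZ_0[OF p] z by (simp add: x_def y_def)
  have "\<not> (fx = 0 \<and> fy = 0)"
  proof
    assume "fx = 0 \<and> fy = 0"
    then have "2 * x ^ 3 + a * x * y ^ 2 = 0" "2 * y ^ 3 + a * x ^ 2 * y = 0" unfolding fx_def fy_def by algebra+
    then have "x = 0 \<and> y = 0" using gradient_quartic_eq_0_imp[OF a2] by blast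
    then show False using local_param_XYZ(1)[OF p] z by (simp add: x_def y_def)
  qed
  moreover have "fx * x + fy * y = 0" using f unfolding fx_def fy_def by algebra
  ultimately have "subdegree (fps_const fx * X p + fps_const fy * Y p) = 4"
    using subdegree_line(1)[OF p, of fx fy] z by (simp add: x_def y_def)
  then show ?thesis
    unfolding line_mult_tangent_line(1)[OF p] gradient_quartic
    by (simp add: lin_vec3 vector_3 z x_def[symmetric] y_def[symmetric] fx_def[symmetric] fy_def[symmetric])
qed

text \<open>In the coordinates \<open>(x, y) = U (x\<^sub>0, y\<^sub>0) + V (f\<^sub>y, - f\<^sub>x)\<close> adapted to the tangent direction
  at \<open>(x\<^sub>0, y\<^sub>0)\<close>, the binary form \<open>f\<close> has no \<open>U\<^sup>3 V\<close> term. Its \<open>U\<^sup>2 V\<^sup>2\<close> coefficient is a multiple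
  of the Hessian and its \<open>U V\<^sup>3\<close> coefficient a multiple of the Jacobian of \<open>f\<close> and its Hessian.
  On the curve the tangent form is a unit times \<open>f - f(x\<^sub>0, y\<^sub>0) U\<^sup>4\<close>.\<close>

lemma line_mult_tangent_z_nonzero:
  assumes p: "p \<in> C" and z: "fps_nth (Z p) 0 \<noteq> 0"
  defines "x \<equiv> fps_nth (X p) 0" and "y \<equiv> fps_nth (Y p) 0"
  shows "line_mult F p (tangent_line F p)
    = (if hess x y \<noteq> 0 then 2 else if x * y * (x ^ 4 - y ^ 4) \<noteq> 0 then 3 else 4)"
proof -
  define z0 where "z0 = fps_nth (Z p) 0"
  define f0 where "f0 = x ^ 4 + y ^ 4 + a * x ^ 2 * y ^ 2"
  define A B where "A = 4 * y ^ 3 + 2 * a * x ^ 2 * y" and "B = - (4 * x ^ 3 + 2 * a * x * y ^ 2)"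
  have f0z: "f0 = - (z0 ^ 4)"
    using XYZ_0[OF p] unfolding f0_def z0_def x_def y_def by algebra
  then have f0: "f0 \<noteq> 0" using z by (simp add: z0_def)
  \<comment> \<open>\<open>C2\<close>, \<open>C3\<close>, \<open>C4\<close> are the coefficients of
    \<open>U\<^sup>2 V\<^sup>2\<close>, \<open>U V\<^sup>3\<close>, \<open>V\<^sup>4\<close> in
    \<open>f (U x + V A) (U y + V B)\<close>, where \<open>(A, B)\<close> is
    \<open>(f\<^sub>y, - f\<^sub>x)\<close>.\<close>
  define C2 where "C2 = 6 * x ^ 2 * A ^ 2 + 6 * y ^ 2 * B ^ 2 + a * (x ^ 2 * B ^ 2 + 4 * x * y * A * B + y ^ 2 * A ^ 2)"
  define C3 where "C3 = 4 * x * A ^ 3 + 4 * y * B ^ 3 + a * (2 * x * A * B ^ 2 + 2 * y * A ^ 2 * B)"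
  define C4 where "C4 = A ^ 4 + B ^ 4 + a * A ^ 2 * B ^ 2"
  have C2: "C2 = 8 * f0 * hess x y"
    unfolding C2_def A_def B_def f0_def hess_def by algebra
  have C3: "C3 = - 64 * (4 - a ^ 2) * f0 * (x * y * (x ^ 4 - y ^ 4))"
    unfolding C3_def A_def B_def f0_def by algebra
  \<comment> \<open>This caps the contact at 4. If both coefficients vanish, the gradient of
    \<open>f\<close> at \<open>(A, B)\<close> annihilates \<open>(x, y)\<close> and
    \<open>(A, B)\<close>, which are independent with determinant \<open>- 4 * f0\<close>. So
    \<open>(A, B)\<close> is a singular zero of \<open>f\<close>, hence 0, which contradicts that
    determinant.\<close>
  have C34: "C4 \<noteq> 0" if "C3 = 0"
  proof
    assume "C4 = 0"
    define GA GB where "GA = 2 * A ^ 3 + a * A * B ^ 2" and "GB = 2 * B ^ 3 + a * A ^ 2 * B"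
    have "GA * x + GB * y = 0" using that unfolding C3_def GA_def GB_def by algebra
    moreover have "GA * A + GB * B = 0" using \<open>C4 = 0\<close> unfolding C4_def GA_def GB_def by algebra
    moreover have "x * B - y * A = - 4 * f0" unfolding A_def B_def f0_def by algebra
    ultimately have "f0 * GA = 0" "f0 * GB = 0" by algebra+
    then have "GA = 0" "GB = 0" using f0 by simp_all
    then have "A = 0 \<and> B = 0" using gradient_quartic_eq_0_imp[OF a2] unfolding GA_def GB_def by blast
    then show False using \<open>x * B - y * A = - 4 * f0\<close> f0 by simp
  qed
  \<comment> \<open>\<open>U\<close> and \<open>V\<close> come from Cramer's rule for
    \<open>X = U x + V A\<close>, \<open>Y = U y + V B\<close>. The series \<open>P\<close> is the
    part of the tangent form in \<open>x\<close> and \<open>y\<close>, and \<open>Zt\<close> below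
    is its part in \<open>z\<close>.\<close>
  define c where "c = fps_const (1 / (4 * f0))"
  define P where "P = fps_const (- B) * X p + fps_const A * Y p"
  define U where "U = c * P"
  define V where "V = fps_const (y / (4 * f0)) * X p + fps_const (- x / (4 * f0)) * Y p"
  define W where "W = fps_const C2 * U ^ 2 + fps_const C3 * U * V + fps_const C4 * V ^ 2"
  define Zt where "Zt = fps_const (4 * z0 ^ 3) * Z p"
  have BA: "- B * x + A * y = 4 * f0" unfolding A_def B_def f0_def by algebra
  have c: "c * fps_const (4 * f0) = 1" using f0 by (simp add: c_def)
  have V: "V = c * (fps_const y * X p - fps_const x * Y p)"
  proof -
    have "fps_const (y / (4 * f0)) = c * fps_const y" "fps_const (- x / (4 * f0)) = - (c * fps_const x)"
      by (simp_all add: c_def)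
    then show ?thesis unfolding V_def by (simp only:) (simp add: algebra_simps)
  qed
  have K: "fps_const (4 * f0) = - fps_const B * fps_const x + fps_const A * fps_const y"
    unfolding BA[symmetric] by (simp flip: fps_const_mult fps_const_add fps_const_neg)
  have Pd: "P = - fps_const B * X p + fps_const A * Y p" by (simp add: P_def flip: fps_const_neg)
  have XU: "X p = U * fps_const x + V * fps_const A"
  proof -
    have "U * fps_const x + V * fps_const A = (c * fps_const (4 * f0)) * X p"
      unfolding U_def Pd V K by algebra
    then show ?thesis by (simp add: c)
  qed
  have YU: "Y p = U * fps_const y + V * fps_const B"
  proof -
    have "U * fps_const y + V * fps_const B = (c * fps_const (4 * f0)) * Y p"
      unfolding U_def Pd V K by algebra
    then show ?thesis by (simp add: c)
  qed
  have key: "X p ^ 4 + Y p ^ 4 + fps_const a * X p ^ 2 * Y p ^ 2 = fps_const f0 * U ^ 4 + V ^ 2 * W"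
  proof -
    define x' y' A' B' a' where "x' = fps_const x" and "y' = fps_const y" and "A' = fps_const A"
      and "B' = fps_const B" and "a' = fps_const a"
    have d: "fps_const f0 = x' ^ 4 + y' ^ 4 + a' * x' ^ 2 * y' ^ 2"
      "fps_const C2 = 6 * x' ^ 2 * A' ^ 2 + 6 * y' ^ 2 * B' ^ 2 + a' * (x' ^ 2 * B' ^ 2 + 4 * x' * y' * A' * B' + y' ^ 2 * A' ^ 2)"
      "fps_const C3 = 4 * x' * A' ^ 3 + 4 * y' * B' ^ 3 + a' * (2 * x' * A' * B' ^ 2 + 2 * y' * A' ^ 2 * B')"
      "fps_const C4 = A' ^ 4 + B' ^ 4 + a' * A' ^ 2 * B' ^ 2"
      by (simp_all add: f0_def C2_def C3_def C4_def x'_def y'_def A'_def B'_def a'_def numeral_fps_const fps_const_power)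
    have AB: "A' = 4 * y' ^ 3 + 2 * a' * x' ^ 2 * y'" "B' = - (4 * x' ^ 3 + 2 * a' * x' * y' ^ 2)"
      by (simp_all add: x'_def y'_def A'_def B'_def a'_def A_def B_def numeral_fps_const fps_const_power)
    \<comment> \<open>This expression is the coefficient of \<open>U\<^sup>3 V\<close>; it vanishes
      by the choice of \<open>(A, B)\<close>.\<close>
    have "(4 * x' ^ 3 + 2 * a' * x' * y' ^ 2) * A' + (4 * y' ^ 3 + 2 * a' * x' ^ 2 * y') * B' = 0"
      unfolding AB by (simp add: algebra_simps)
    then show ?thesis
      unfolding W_def XU YU d x'_def[symmetric] y'_def[symmetric] A'_def[symmetric] B'_def[symmetric] a'_def[symmetric]
      by algebra
  qed
  have U0: "fps_nth U 0 = 1"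
    using BA f0 by (simp add: U_def c_def P_def x_def[symmetric] y_def[symmetric])
  have P0: "fps_nth P 0 = 4 * f0"
    using BA by (simp add: P_def x_def[symmetric] y_def[symmetric])
  have xy: "\<not> (x = 0 \<and> y = 0)" using f0 by (auto simp: f0_def)
  have nz: "\<not> (y / (4 * f0) = 0 \<and> - x / (4 * f0) = 0)" using xy f0 by auto
  have van: "y / (4 * f0) * fps_nth (X p) 0 + - x / (4 * f0) * fps_nth (Y p) 0 = 0"
    by (simp add: x_def[symmetric] y_def[symmetric])
  have sV: "subdegree V = 1"
    unfolding V_def subdegree_line(1)[OF p nz van] using z by simp
  then have V0: "fps_nth V 0 = 0" "V \<noteq> 0" and V1: "fps_nth V 1 \<noteq> 0"
    by (auto intro: nth_less_subdegree_zero) (metis One_nat_def nth_subdegree_nonzero subdegree_0 zero_neq_one)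
  \<comment> \<open>As \<open>U\<close> starts with 1 and \<open>V\<close> has order 1, the first
    nonzero one of \<open>C2\<close>, \<open>C3\<close>, \<open>C4\<close> fixes the order of
    \<open>W\<close>.\<close>
  have sW: "W \<noteq> 0 \<and> subdegree W = (if hess x y \<noteq> 0 then 0 else if x * y * (x ^ 4 - y ^ 4) \<noteq> 0 then 1 else 2)"
  proof -
    have sU: "subdegree U = 0" "U \<noteq> 0" using U0 by auto
    have a4: "4 - a ^ 2 \<noteq> 0" using a2 by simp
    show ?thesis
    proof (cases "hess x y = 0")
      case False
      then have "fps_nth W 0 \<noteq> 0" using f0 by (simp add: W_def U0 V0 fps_nth_power_0 C2)
      then show ?thesis using False by auto
    next
      case True
      then have W: "W = V * (fps_const C3 * U + fps_const C4 * V)"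
        by (simp add: W_def C2 power2_eq_square algebra_simps)
      show ?thesis
      proof (cases "x * y * (x ^ 4 - y ^ 4) = 0")
        case False
        then have "fps_nth (fps_const C3 * U + fps_const C4 * V) 0 \<noteq> 0"
          using a4 f0 by (simp add: U0 V0 C3)
        then have "subdegree (fps_const C3 * U + fps_const C4 * V) = 0" "fps_const C3 * U + fps_const C4 * V \<noteq> 0"
          by (blast intro: subdegree_eq_0, metis fps_zero_nth)
        then show ?thesis using True False sV V0 unfolding W by simp
      next
        case J: True
        then have "C3 = 0" using C3 by simp
        then show ?thesis using C34[OF \<open>C3 = 0\<close>] True J sV V0 unfolding W by simp
      qed
    qed
  qed
  \<comment> \<open>The left side is \<open>Zt ^ 4 - P ^ 4\<close>. At the point
    \<open>Zt = - 4 * f0\<close> and \<open>P = 4 * f0\<close>, so only the factor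
    \<open>Zt + P\<close>, the tangent form, vanishes there. The factor \<open>256 * f0 ^ 3\<close>
    comes from \<open>4 ^ 4\<close> and \<open>z0 ^ 12 = - (f0 ^ 3)\<close>.\<close>
  have prod: "(Zt + P) * ((Zt - P) * (Zt ^ 2 + P ^ 2)) = fps_const (256 * f0 ^ 3) * (V ^ 2 * W)"
  proof -
    have "Zt ^ 4 = fps_const (256 * z0 ^ 12) * Z p ^ 4"
      by (simp add: Zt_def power_mult_distrib fps_const_power power_mult[symmetric])
    moreover have "z0 ^ 12 = - (f0 ^ 3)" unfolding f0z by (simp add: power_mult[symmetric])
    ultimately have "Zt ^ 4 = fps_const (256 * f0 ^ 3) * (- (Z p ^ 4))"
      by (simp flip: fps_const_neg)
    also have "- (Z p ^ 4) = fps_const f0 * U ^ 4 + V ^ 2 * W"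
      using local_param_XYZ(4)[OF p] key by algebra
    finally have Z4: "Zt ^ 4 = fps_const (256 * f0 ^ 3) * (fps_const f0 * U ^ 4 + V ^ 2 * W)" .
    have "P = fps_const (4 * f0) * U" unfolding U_def using c by (metis mult.assoc mult.commute mult_1)
    then have "P ^ 4 = fps_const (256 * f0 ^ 3) * (fps_const f0 * U ^ 4)"
      by (simp add: power_mult_distrib fps_const_power numeral_eq_Suc ac_simps)
    moreover have "(Zt + P) * ((Zt - P) * (Zt ^ 2 + P ^ 2)) = Zt ^ 4 - P ^ 4"
      by (simp add: algebra_simps numeral_eq_Suc)
    ultimately show ?thesis by (simp add: Z4 algebra_simps)
  qed
  let ?R = "(Zt - P) * (Zt ^ 2 + P ^ 2)"
  have "fps_nth ?R 0 = (4 * z0 ^ 4 - 4 * f0) * ((4 * z0 ^ 4) ^ 2 + (4 * f0) ^ 2)"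
    by (simp add: P0 Zt_def fps_nth_power_0 z0_def[symmetric] power_mult_distrib numeral_eq_Suc)
  also have "\<dots> = - 256 * f0 ^ 3" unfolding f0z by (simp add: algebra_simps numeral_eq_Suc)
  finally have R0: "fps_nth ?R 0 \<noteq> 0" using f0 by simp
  then have sR: "subdegree ?R = 0" "?R \<noteq> 0" by (blast intro: subdegree_eq_0, metis fps_zero_nth)
  have "256 * f0 ^ 3 \<noteq> 0" using f0 by simp
  then have "(Zt + P) * ?R \<noteq> 0" unfolding prod using V0 sW by simp
  then have "Zt + P \<noteq> 0" by auto
  have "subdegree (Zt + P) + subdegree ?R = subdegree (fps_const (256 * f0 ^ 3) * (V ^ 2 * W))"
    unfolding prod[symmetric] using \<open>Zt + P \<noteq> 0\<close> sR(2) by (rule subdegree_mult[symmetric])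
  also have "\<dots> = 2 + subdegree W"
    using V0 sV sW \<open>256 * f0 ^ 3 \<noteq> 0\<close> by simp
  finally have "subdegree (Zt + P) = 2 + subdegree W" using sR by simp
  moreover have "lin (gradient F (vec3 x y z0)) p = Zt + P"
    by (simp add: gradient_quartic vector_3 lin_vec3 Zt_def P_def A_def B_def)
  ultimately have "line_mult F p (tangent_line F p) = 2 + subdegree W"
    using line_mult_tangent_line(1)[OF p] by (simp add: x_def y_def z0_def)
  then show ?thesis using sW by auto
qed

lemma hess_scale: "hess (k * x) (k * y) = k ^ 4 * hess x y"
  unfolding hess_def by algebra

lemma line_mult_tangent_affine:
  assumes "pt x y 1 \<in> C"
  shows "line_mult F (pt x y 1) (tangent_line F (pt x y 1))
    = (if hess x y \<noteq> 0 then 2 else if x * y * (x ^ 4 - y ^ 4) \<noteq> 0 then 3 else 4)"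
proof -
  let ?p = "pt x y 1"
  have "pt x y 1 = pt (fps_nth (X ?p) 0) (fps_nth (Y ?p) 0) (fps_nth (Z ?p) 0)"
    by (rule local_param_XYZ(2)[OF assms])
  then obtain k where k: "k \<noteq> 0" "fps_nth (X ?p) 0 = k * x" "fps_nth (Y ?p) 0 = k * y" "fps_nth (Z ?p) 0 = k * 1"
    using local_param_XYZ(1)[OF assms] by (subst (asm) pt_eq_iff) auto
  show ?thesis
    using line_mult_tangent_z_nonzero[OF assms] k by (simp add: hess_scale power_mult_distrib)
qed

section \<open>Classification of the points by contact with the tangent\<close>

lemma curve_cases:
  assumes "p \<in> C"
  obtains x y where "p = pt x y 1" "x ^ 4 + y ^ 4 + 1 + a * x ^ 2 * y ^ 2 = 0"
    | e where "p = pt e 1 0" "e ^ 4 + a * e ^ 2 + 1 = 0"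
proof -
  obtain x y z where p: "p = pt x y z" "\<not> (x = 0 \<and> y = 0 \<and> z = 0)" by (rule proj_plane_cases)
  show ?thesis
  proof (cases "z = 0")
    case False
    then have pe: "p = pt (x / z) (y / z) 1" unfolding p(1) by (rule pt_normalize)
    have "(x / z) ^ 4 + (y / z) ^ 4 + 1 + a * (x / z) ^ 2 * (y / z) ^ 2 = 0"
      using assms unfolding pe by (subst (asm) mem_curve_quartic_iff) simp_all
    with pe show ?thesis by (rule that(1))
  next
    case True
    have eq: "x ^ 4 + y ^ 4 + a * x ^ 2 * y ^ 2 = 0" using assms p True by (simp add: mem_curve_quartic_iff)
    then have y: "y \<noteq> 0" using p(2) True by auto
    then have pe: "p = pt (x / y) 1 0"
      unfolding p(1) True by (subst pt_eq_iff) (auto intro!: exI[of _ "1 / y"])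
    have "(x / y) ^ 4 + 1 ^ 4 + 0 ^ 4 + a * (x / y) ^ 2 * 1 ^ 2 = 0"
      using assms unfolding pe by (subst (asm) mem_curve_quartic_iff) simp_all
    then have "(x / y) ^ 4 + a * (x / y) ^ 2 + 1 = 0" by (simp add: algebra_simps)
    with pe show ?thesis by (rule that(2))
  qed
qed

lemma mem_C_affine_iff: "pt x y 1 \<in> C \<longleftrightarrow> x ^ 4 + y ^ 4 + 1 + a * x ^ 2 * y ^ 2 = 0"
  by (simp add: mem_curve_quartic_iff)

lemma mem_C_infinite_iff: "pt e 1 0 \<in> C \<longleftrightarrow> e ^ 4 + a * e ^ 2 + 1 = 0"
  by (simp add: mem_curve_quartic_iff algebra_simps)

lemma line_mult_tangent_infinite:
  assumes "pt e 1 0 \<in> C"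
  shows "line_mult F (pt e 1 0) (tangent_line F (pt e 1 0)) = 4"
proof (rule line_mult_tangent_z_0[OF assms])
  let ?p = "pt e 1 0"
  have "pt e 1 0 = pt (fps_nth (X ?p) 0) (fps_nth (Y ?p) 0) (fps_nth (Z ?p) 0)"
    by (rule local_param_XYZ(2)[OF assms])
  then show "fps_nth (Z ?p) 0 = 0"
    using local_param_XYZ(1)[OF assms] by (subst (asm) pt_eq_iff) auto
qed

lemma pt_0_neq_affine: "pt e 1 0 \<noteq> pt x y 1"
  by (subst pt_eq_iff) auto

definition affine_flexes :: "(complex \<times> complex) set" where
  "affine_flexes = {(x, y). x ^ 4 + y ^ 4 + 1 + a * x ^ 2 * y ^ 2 = 0 \<and> hess x y = 0}"

definition infinite_points :: "proj_plane set" where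
  "infinite_points = (\<lambda>e. pt e 1 0) ` {e. e ^ 4 + a * e ^ 2 + 1 = 0}"

lemma ordinary_flexes_eq:
  "ordinary_flexes F = (\<lambda>(x, y). pt x y 1) ` {(x, y) \<in> affine_flexes. x * y * (x ^ 4 - y ^ 4) \<noteq> 0}"
proof (intro equalityI subsetI)
  fix p assume "p \<in> ordinary_flexes F"
  then have p: "p \<in> C" "line_mult F p (tangent_line F p) = 3" by (auto simp: ordinary_flexes_def)
  from p(1) show "p \<in> (\<lambda>(x, y). pt x y 1) ` {(x, y) \<in> affine_flexes. x * y * (x ^ 4 - y ^ 4) \<noteq> 0}"
  proof (cases rule: curve_cases)
    case (1 x y)
    then show ?thesis
      using p line_mult_tangent_affine[of x y]
      by (intro image_eqI[of _ _ "(x, y)"]) (auto simp: affine_flexes_def split: if_splits)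
  next
    case (2 e)
    then show ?thesis using p line_mult_tangent_infinite[of e] by auto
  qed
next
  fix p assume "p \<in> (\<lambda>(x, y). pt x y 1) ` {(x, y) \<in> affine_flexes. x * y * (x ^ 4 - y ^ 4) \<noteq> 0}"
  then show "p \<in> ordinary_flexes F"
    by (auto simp: ordinary_flexes_def affine_flexes_def mem_C_affine_iff line_mult_tangent_affine)
qed

lemma hyperflexes_eq:
  "hyperflexes F = infinite_points \<union> (\<lambda>(x, y). pt x y 1) ` {(x, y) \<in> affine_flexes. x * y * (x ^ 4 - y ^ 4) = 0}"
proof (intro equalityI subsetI)
  fix p assume "p \<in> hyperflexes F"
  then have p: "p \<in> C" "line_mult F p (tangent_line F p) = 4" by (auto simp: hyperflexes_def)
  from p(1) show "p \<in> infinite_points \<union> (\<lambda>(x, y). pt x y 1) ` {(x, y) \<in> affine_flexes. x * y * (x ^ 4 - y ^ 4) = 0}"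
  proof (cases rule: curve_cases)
    case (1 x y)
    then show ?thesis
      using p line_mult_tangent_affine[of x y]
      by (intro UnI2 image_eqI[of _ _ "(x, y)"]) (auto simp: affine_flexes_def split: if_splits)
  next
    case (2 e)
    then show ?thesis by (auto simp: infinite_points_def)
  qed
next
  fix p assume "p \<in> infinite_points \<union> (\<lambda>(x, y). pt x y 1) ` {(x, y) \<in> affine_flexes. x * y * (x ^ 4 - y ^ 4) = 0}"
  then show "p \<in> hyperflexes F"
    by (auto simp: hyperflexes_def affine_flexes_def mem_C_affine_iff line_mult_tangent_affine
      infinite_points_def mem_C_infinite_iff line_mult_tangent_infinite)
qed

lemma weierstrass_points_eq: "weierstrass_points F = ordinary_flexes F \<union> hyperflexes F"
proof -
  have "weight F p > 0 \<longleftrightarrow> line_mult F p (tangent_line F p) = 3 \<or> line_mult F p (tangent_line F p) = 4"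
    if p: "p \<in> C" for p
  proof -
    have lm: "line_mult F p (tangent_line F p) = 2 \<or> line_mult F p (tangent_line F p) = 3 \<or> line_mult F p (tangent_line F p) = 4"
      using line_mult_tangent_z_0[OF p] line_mult_tangent_z_nonzero[OF p] by (cases "fps_nth (Z p) 0 = 0") auto
    have "weight F p = int (line_mult F p (tangent_line F p)) - 2"
      using weight_tangent[OF p line_mult_tangent_line(2)[OF p]] lm
      by (simp add: line_mult_def lin_def) linarith
    then show ?thesis using lm by auto
  qed
  then show ?thesis
    unfolding weierstrass_points_def ordinary_flexes_def hyperflexes_def by blast
qed

end

section \<open>Orbits\<close>

definition orb :: "proj_plane \<Rightarrow> proj_plane set" where
  "orb p = (\<lambda>m. mon_map m p) ` mon_index"

lemma self_in_orb: "p \<in> orb p"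
proof -
  have "(False, 1, 1) \<in> mon_index" by (simp add: mon_index_def)
  moreover have "p = mon_map (False, 1, 1) p" by (simp add: mon_map_one)
  ultimately show ?thesis unfolding orb_def by (rule image_eqI[rotated])
qed

lemma orb_mono: "q \<in> orb p \<Longrightarrow> orb q \<subseteq> orb p"
proof
  fix r assume "q \<in> orb p" "r \<in> orb q"
  then obtain m n where mn: "m \<in> mon_index" "n \<in> mon_index" "q = mon_map m p" "r = mon_map n q"
    by (auto simp: orb_def)
  then have "r = mon_map (mon_mult n m) p" by (simp add: mon_map_mult)
  then show "r \<in> orb p" using mon_mult_closed[OF mn(2,1)] by (auto simp: orb_def)
qed

lemma orb_eq:
  assumes "q \<in> orb p"
  shows "orb q = orb p"
proof
  obtain m where m: "m \<in> mon_index" "q = mon_map m p" using assms by (auto simp: orb_def)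
  have "mon_map (mon_inv m) q = p"
    using mon_map_inv(1)[OF m(1)] m(2) by (metis comp_apply id_apply)
  then have "p \<in> orb q" using mon_inv_closed[OF m(1)] unfolding orb_def by (metis imageI)
  then show "orb p \<subseteq> orb q" by (rule orb_mono)
qed (rule orb_mono[OF assms])

lemma orbits_sym_group:
  assumes "E \<subseteq> curve A"
  shows "orbits sym_group E (curve_action A) = orb ` E"
proof -
  have "orbit sym_group (curve_action A) p = orb p" if "p \<in> E" for p
    using assms that by (auto simp: orbit_def curve_action_def carrier_sym_group orb_def)
  then show ?thesis unfolding orbits_def by blast
qed

lemma orb_image_orb: "orb ` orb p = {orb p}"
  using orb_eq self_in_orb by blast

lemma biquadratic_root_exists:
  assumes "A \<noteq> (0::complex)"
  obtains e where "A * e ^ 4 + B * e ^ 2 + D = 0"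
proof
  define r where "r = csqrt (B ^ 2 - 4 * A * D)"
  define t where "t = (- B + r) / (2 * A)"
  have r: "r ^ 2 = B ^ 2 - 4 * A * D" by (simp add: r_def)
  have t: "2 * A * t = - B + r" using assms by (simp add: t_def)
  have "4 * A * (A * t ^ 2 + B * t + D) = 0" using r t by algebra
  then have "A * t ^ 2 + B * t + D = 0" using assms by simp
  moreover have "csqrt t ^ 4 = t ^ 2" using power_mult[of "csqrt t" 2 2] by simp
  ultimately show "A * csqrt t ^ 4 + B * csqrt t ^ 2 + D = 0" by simp
qed

lemma mon_index_powers:
  assumes "(t, \<alpha>, \<delta>) \<in> mon_index"
  shows "(\<alpha> * v) ^ 4 = v ^ 4" "(\<delta> * \<alpha> * v) ^ 4 = v ^ 4" "(\<alpha> * v) ^ 2 * (\<delta> * \<alpha> * v') ^ 2 = v ^ 2 * v' ^ 2"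
    "\<alpha> \<noteq> 0" "\<delta> \<noteq> 0"
proof -
  have r: "\<alpha> ^ 4 = 1" "\<delta> ^ 2 = 1" "\<delta> ^ 4 = 1"
    using assms by (auto simp: mon_index_def power4_eq_1_if_power2)
  then show "(\<alpha> * v) ^ 4 = v ^ 4" "(\<delta> * \<alpha> * v) ^ 4 = v ^ 4" by (simp_all add: power_mult_distrib)
  have "(\<alpha> * v) ^ 2 * (\<delta> * \<alpha> * v') ^ 2 = \<alpha> ^ 4 * \<delta> ^ 2 * (v ^ 2 * v' ^ 2)" by algebra
  then show "(\<alpha> * v) ^ 2 * (\<delta> * \<alpha> * v') ^ 2 = v ^ 2 * v' ^ 2" using r by simp
  show "\<alpha> \<noteq> 0" "\<delta> \<noteq> 0" using r by auto
qed

context smooth_quartic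
begin

lemma roots_eq: "{e. e ^ 4 + a * e ^ 2 + 1 = 0} = {s, - s, 1 / s, - 1 / s}"
proof -
  have "e ^ 4 + a * e ^ 2 + 1 = 0 \<longleftrightarrow> e = s \<or> e = - s \<or> e = 1 / s \<or> e = - 1 / s" for e
  proof -
    have "s ^ 2 * (e ^ 4 + a * e ^ 2 + 1) = (e - s) * (e + s) * (s * e - 1) * (s * e + 1)"
      using root_s by algebra
    then have "e ^ 4 + a * e ^ 2 + 1 = 0 \<longleftrightarrow> (e - s) * (e + s) * (s * e - 1) * (s * e + 1) = 0"
      using s_nonzero by (metis mult_eq_0_iff power_not_zero)
    also have "\<dots> \<longleftrightarrow> e - s = 0 \<or> e + s = 0 \<or> s * e - 1 = 0 \<or> s * e + 1 = 0"
      by (simp only: mult_eq_0_iff disj_assoc)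
    also have "e + s = 0 \<longleftrightarrow> e = - s" by (simp only: eq_neg_iff_add_eq_0)
    also have "s * e + 1 = 0 \<longleftrightarrow> s * e = - 1" by (simp only: eq_neg_iff_add_eq_0)
    also have "s * e = - 1 \<longleftrightarrow> e = - 1 / s" by (simp only: nonzero_eq_divide_eq[OF s_nonzero] mult.commute)
    also have "s * e - 1 = 0 \<longleftrightarrow> e = 1 / s" by (simp only: nonzero_eq_divide_eq[OF s_nonzero] mult.commute right_minus_eq)
    also have "e - s = 0 \<longleftrightarrow> e = s" by simp
    finally show ?thesis .
  qed
  then show ?thesis by auto
qed

lemma card_infinite_points: "card infinite_points = 4"
proof -
  have inj: "inj_on (\<lambda>e. pt e 1 0) A" for A by (rule inj_onI) (auto simp: pt_eq_iff)
  have s4: "s ^ 4 \<noteq> 1" by (rule biquadratic_root(2)[OF a2 root_s])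
  have s2: "s * s \<noteq> 1" "s * s \<noteq> - 1"
  proof -
    have "s ^ 4 = (s * s) * (s * s)" by (simp add: numeral_eq_Suc)
    then show "s * s \<noteq> 1" "s * s \<noteq> - 1" using s4 by auto
  qed
  then have "- (s * s) \<noteq> 1" by (metis minus_minus)
  have ne: "s \<noteq> - s" "s \<noteq> 1 / s" "s \<noteq> - 1 / s" "- s \<noteq> 1 / s" "- s \<noteq> - 1 / s" "1 / s \<noteq> - 1 / s"
    using s2 \<open>- (s * s) \<noteq> 1\<close> s_nonzero by (auto simp: field_simps)
  have "card {s, - s, 1 / s, - 1 / s} = 4"
    using ne by (simp only: card_insert_if finite_insert finite.emptyI insert_iff empty_iff simp_thms if_False card.empty)
  then show ?thesis unfolding infinite_points_def roots_eq by (simp only: card_image[OF inj])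
qed

text \<open>On the line \<open>z = 0\<close> the factor \<open>\<alpha>\<close> is a common scalar,
  so the group acts on \<open>e = x / y\<close> through \<open>\<delta> e\<close> and
  \<open>\<delta> / e\<close> alone. These carry \<open>s\<close> to each of the four roots.\<close>

lemma infinite_points_eq_orb: "infinite_points = orb (pt s 1 0)"
proof
  have I: "(False, 1, 1) \<in> mon_index" "(False, 1, -1) \<in> mon_index" "(True, 1, 1) \<in> mon_index" "(True, 1, -1) \<in> mon_index"
    by (auto simp: mon_index_def)
  have "pt (- s) 1 0 = pt s (- 1) 0" "pt (1 / s) 1 0 = pt 1 s 0" "pt (- 1 / s) 1 0 = pt 1 (- s) 0"
    using s_nonzero by (subst pt_eq_iff; auto intro: exI[of _ "-1"] exI[of _ s] exI[of _ "- s"])+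
  then have "pt s 1 0 = mon_map (False, 1, 1) (pt s 1 0)" "pt (- s) 1 0 = mon_map (False, 1, - 1) (pt s 1 0)"
      "pt (1 / s) 1 0 = mon_map (True, 1, 1) (pt s 1 0)" "pt (- 1 / s) 1 0 = mon_map (True, 1, - 1) (pt s 1 0)"
    using I by (simp_all add: mon_map_pt)
  then show "infinite_points \<subseteq> orb (pt s 1 0)"
    unfolding infinite_points_def roots_eq orb_def using I by blast
  show "orb (pt s 1 0) \<subseteq> infinite_points"
  proof
    fix p assume "p \<in> orb (pt s 1 0)"
    then obtain t \<alpha> \<delta> where m: "(t, \<alpha>, \<delta>) \<in> mon_index" and p: "p = mon_map (t, \<alpha>, \<delta>) (pt s 1 0)"
      by (auto simp: orb_def)
    note nz = mon_index_powers(4,5)[OF m]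
    have peq: "p = pt (\<alpha> * (if t then 1 else s)) (\<delta> * \<alpha> * (if t then s else 1)) 0"
      unfolding p by (rule mon_map_pt[OF m]) simp
    define e where "e = (\<alpha> * (if t then 1 else s)) / (\<delta> * \<alpha> * (if t then s else 1))"
    have "p = pt e 1 0"
      unfolding peq using nz s_nonzero
      by (subst pt_eq_iff) (auto simp: e_def intro!: exI[of _ "1 / (\<delta> * \<alpha> * (if t then s else 1))"])
    moreover have "p \<in> C"
      unfolding p using m by (rule mon_map_curve_quartic) (use root_s in \<open>simp add: mem_C_infinite_iff\<close>)
    ultimately show "p \<in> infinite_points" by (auto simp: infinite_points_def mem_C_infinite_iff)
  qed
qed

text \<open>The predicate is instantiated with \<open>z \<noteq> 0\<close> for ordinary flexes and
  with \<open>z = 0\<close> for affine hyperflexes; both cases share the invariance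
  argument.\<close>

definition affine_set :: "(complex \<Rightarrow> bool) \<Rightarrow> proj_plane set" where
  "affine_set P = (\<lambda>(x, y). pt x y 1) ` {(x, y) \<in> affine_flexes. P (x * y * (x ^ 4 - y ^ 4))}"

lemma affine_setI: "(x, y) \<in> affine_flexes \<Longrightarrow> P (x * y * (x ^ 4 - y ^ 4)) \<Longrightarrow> pt x y 1 \<in> affine_set P"
  unfolding affine_set_def by (rule image_eqI[of _ _ "(x, y)"]) auto

lemma orb_subset_affine_set:
  assumes "(x, y) \<in> affine_flexes" "P = (\<lambda>z. z = 0) \<or> P = (\<lambda>z. z \<noteq> 0)" "P (x * y * (x ^ 4 - y ^ 4))"
  shows "orb (pt x y 1) \<subseteq> affine_set P"
proof
  fix p assume "p \<in> orb (pt x y 1)"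
  then obtain t \<alpha> \<delta> where m: "(t, \<alpha>, \<delta>) \<in> mon_index" and p: "p = mon_map (t, \<alpha>, \<delta>) (pt x y 1)"
    by (auto simp: orb_def)
  define x' y' where "x' = \<alpha> * (if t then y else x)" and "y' = \<delta> * \<alpha> * (if t then x else y)"
  have p: "p = pt x' y' 1"
    unfolding p x'_def y'_def by (rule mon_map_pt[OF m]) simp
  have pw: "x' ^ 4 = (if t then y else x) ^ 4" "y' ^ 4 = (if t then x else y) ^ 4" "x' ^ 2 * y' ^ 2 = x ^ 2 * y ^ 2"
    unfolding x'_def y'_def mon_index_powers(1-3)[OF m] by (auto simp: mult.commute)
  have "x' * y' = 0 \<longleftrightarrow> x * y = 0" using mon_index_powers(4,5)[OF m] by (auto simp: x'_def y'_def)
  then have "x' * y' * (x' ^ 4 - y' ^ 4) = 0 \<longleftrightarrow> x * y * (x ^ 4 - y ^ 4) = 0" by (auto simp: pw)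
  then have "P (x' * y' * (x' ^ 4 - y' ^ 4))" using assms(2,3) by auto
  moreover have "(x', y') \<in> affine_flexes"
    using assms(1) by (cases t) (simp_all add: affine_flexes_def hess_def pw mult.assoc add.commute add.left_commute)
  ultimately show "p \<in> affine_set P" unfolding p by (rule affine_setI[rotated])
qed

lemma affine_setE:
  assumes "p \<in> affine_set P"
  obtains x y where "p = pt x y 1" "(x, y) \<in> affine_flexes" "P (x * y * (x ^ 4 - y ^ 4))"
  using assms unfolding affine_set_def by auto

lemma ordinary_flexes_affine_set: "ordinary_flexes F = affine_set (\<lambda>z. z \<noteq> 0)"
  by (simp add: ordinary_flexes_eq affine_set_def)

lemma hyperflexes_affine_set: "hyperflexes F = infinite_points \<union> affine_set (\<lambda>z. z = 0)"
  by (simp add: hyperflexes_eq affine_set_def)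

lemma in_orbI: "m \<in> mon_index \<Longrightarrow> q = mon_map m p \<Longrightarrow> q \<in> orb p"
  unfolding orb_def by (rule image_eqI)

text \<open>As \<open>hess\<close> is quadratic in \<open>x\<^sup>2 / y\<^sup>2\<close> with reciprocal roots, any two flexes have \<open>x\<^sup>2 / y\<^sup>2\<close>
  equal or reciprocal.\<close>

lemma ordinary_flex_orbit:
  assumes xy: "(x, y) \<in> affine_flexes" "x * y * (x ^ 4 - y ^ 4) \<noteq> 0"
    and xy': "(x', y') \<in> affine_flexes" "x' * y' * (x' ^ 4 - y' ^ 4) \<noteq> 0"
  shows "pt x' y' 1 \<in> orb (pt x y 1)"
proof -
  have nz: "x \<noteq> 0" "y \<noteq> 0" "x' \<noteq> 0" "y' \<noteq> 0" using xy xy' by auto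
  have f: "x ^ 4 + y ^ 4 + a * x ^ 2 * y ^ 2 = - 1" "x' ^ 4 + y' ^ 4 + a * x' ^ 2 * y' ^ 2 = - 1"
    using xy xy' by (simp_all add: affine_flexes_def eq_neg_iff_add_eq_0 algebra_simps)
  have h: "hess x y = 0" "hess x' y' = 0" using xy xy' by (simp_all add: affine_flexes_def)
  have "a \<noteq> 0" using h(1) nz by (auto simp: hess_def)
  \<comment> \<open>Eliminating \<open>12 - a ^ 2\<close> from the two Hessian equations leaves a
    product, whose factors are the cases of reciprocal and of equal squared ratios.\<close>
  have "2 * a * ((x ^ 2 * x' ^ 2 - y ^ 2 * y' ^ 2) * (x ^ 2 * y' ^ 2 - y ^ 2 * x' ^ 2)) = 0"
    using h unfolding hess_def by algebra
  then have "(x * x') ^ 2 = (y * y') ^ 2 \<or> (x * y') ^ 2 = (y * x') ^ 2"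
    using \<open>a \<noteq> 0\<close> by (auto simp: power_mult_distrib)
  then show ?thesis
  proof
    assume eq: "(x * x') ^ 2 = (y * y') ^ 2"
    define \<alpha> \<delta> where "\<alpha> = x' / y" and "\<delta> = y * y' / (x * x')"
    have x': "x' = \<alpha> * y" and y': "y' = \<delta> * \<alpha> * x" using nz by (simp_all add: \<alpha>_def \<delta>_def)
    have d: "\<delta> ^ 2 = 1" using eq nz by (simp add: \<delta>_def power_divide)
    \<comment> \<open>The group element scales \<open>f\<close> by \<open>\<alpha> ^ 4\<close>,
      while \<open>f\<close> is \<open>- 1\<close> at both points; this makes
      \<open>\<alpha>\<close> a fourth root of unity.\<close>
    have "\<alpha> ^ 4 * (x ^ 4 + y ^ 4 + a * x ^ 2 * y ^ 2) = x' ^ 4 + y' ^ 4 + a * x' ^ 2 * y' ^ 2"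
      unfolding x' y' using d by algebra
    then have "\<alpha> ^ 4 = 1" using f by simp
    then have m: "(True, \<alpha>, \<delta>) \<in> mon_index" using d by (simp add: mon_index_def)
    show ?thesis by (rule in_orbI[OF m]) (simp add: mon_map_pt[OF m] x' y')
  next
    assume eq: "(x * y') ^ 2 = (y * x') ^ 2"
    define \<alpha> \<delta> where "\<alpha> = x' / x" and "\<delta> = x * y' / (y * x')"
    have x': "x' = \<alpha> * x" and y': "y' = \<delta> * \<alpha> * y" using nz by (simp_all add: \<alpha>_def \<delta>_def)
    have d: "\<delta> ^ 2 = 1" using eq nz by (simp add: \<delta>_def power_divide)
    have "\<alpha> ^ 4 * (x ^ 4 + y ^ 4 + a * x ^ 2 * y ^ 2) = x' ^ 4 + y' ^ 4 + a * x' ^ 2 * y' ^ 2"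
      unfolding x' y' using d by algebra
    then have "\<alpha> ^ 4 = 1" using f by simp
    then have m: "(False, \<alpha>, \<delta>) \<in> mon_index" using d by (simp add: mon_index_def)
    show ?thesis by (rule in_orbI[OF m]) (simp add: mon_map_pt[OF m] x' y')
  qed
qed

text \<open>For \<open>a = 0\<close> the Hessian is a multiple of \<open>x ^ 2 * y ^ 2\<close>, so
  the flexes lie on the axes. For the other two values it is a multiple of a square. In all cases
  its zeros are also zeros of \<open>x * y * (x ^ 4 - y ^ 4)\<close>, so every affine flex is a
  hyperflex.\<close>

lemma special_flexes:
  assumes "a = 0 \<or> a = 6 \<or> a = - 6"
  shows "affine_set (\<lambda>z. z \<noteq> 0) = {}"
    and "\<exists>p. affine_set (\<lambda>z. z = 0) = orb p"
    and "card (affine_set (\<lambda>z. z = 0)) = 8"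
proof -
  have inj: "inj_on (\<lambda>(x, y). pt x y 1) B" for B by (auto simp: inj_on_def)
  have fi: "(x, y) \<in> affine_flexes \<longleftrightarrow> x ^ 4 + y ^ 4 + 1 + a * x ^ 2 * y ^ 2 = 0 \<and> hess x y = 0" for x y
    by (simp add: affine_flexes_def)
  have card4: "card {x::complex. x ^ 4 = c} = 4" if "c \<noteq> 0" for c
    using card_nth_roots[OF that, of 4] by simp
  have "affine_set (\<lambda>z. z \<noteq> 0) = {} \<and> (\<exists>p. affine_set (\<lambda>z. z = 0) = orb p) \<and> card (affine_set (\<lambda>z. z = 0)) = 8"
  proof (cases "a = 0")
    case True
    have fi0: "(x, y) \<in> affine_flexes \<longleftrightarrow> y = 0 \<and> x ^ 4 = - 1 \<or> x = 0 \<and> y ^ 4 = - 1" for x y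
      unfolding fi hess_def by (auto simp: True eq_neg_iff_add_eq_0)
    obtain r :: complex where r: "r ^ 4 = - 1" by (rule fourth_root_exists)
    then have "r \<noteq> 0" by auto
    have "affine_set (\<lambda>z. z = 0) \<subseteq> orb (pt r 0 1)"
    proof
      fix p assume "p \<in> affine_set (\<lambda>z. z = 0)"
      then obtain x y where p: "p = pt x y 1" "(x, y) \<in> affine_flexes" by (rule affine_setE)
      from p(2) consider "y = 0" "x ^ 4 = - 1" | "x = 0" "y ^ 4 = - 1" unfolding fi0 by blast
      then show "p \<in> orb (pt r 0 1)"
      proof cases
        case 1
        then have m: "(False, x / r, 1) \<in> mon_index" using r by (simp add: mon_index_def power_divide)
        show ?thesis by (rule in_orbI[OF m]) (use 1 p \<open>r \<noteq> 0\<close> in \<open>simp add: mon_map_pt[OF m]\<close>)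
      next
        case 2
        then have m: "(True, y / r, 1) \<in> mon_index" using r by (simp add: mon_index_def power_divide)
        show ?thesis by (rule in_orbI[OF m]) (use 2 p \<open>r \<noteq> 0\<close> in \<open>simp add: mon_map_pt[OF m]\<close>)
      qed
    qed
    moreover have "orb (pt r 0 1) \<subseteq> affine_set (\<lambda>z. z = 0)"
      by (rule orb_subset_affine_set) (use r in \<open>simp_all add: fi0\<close>)
    moreover have "affine_set (\<lambda>z. z \<noteq> 0) = {}" by (auto simp: affine_set_def fi0)
    moreover have "card (affine_set (\<lambda>z. z = 0)) = 8"
    proof -
      let ?R = "{x::complex. x ^ 4 = - 1}"
      have fin: "finite ?R" using card4[of "- 1"] by (intro card_ge_0_finite) simp
      have "{(x, y) \<in> affine_flexes. x * y * (x ^ 4 - y ^ 4) = 0} = ?R \<times> {0} \<union> {0} \<times> ?R"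
        by (auto simp: fi0)
      moreover have "card (?R \<times> {0} \<union> {0} \<times> ?R) = card (?R \<times> {0::complex}) + card ({0::complex} \<times> ?R)"
        using fin by (intro card_Un_disjoint) auto
      ultimately show ?thesis
        using card4[of "- 1"] by (simp add: affine_set_def card_image[OF inj] card_cartesian_product)
    qed
    ultimately show ?thesis by blast
  next
    case False
    \<comment> \<open>The sign \<open>\<kappa>'\<close> treats 6 and -6 together: the Hessian
      equation becomes \<open>x ^ 2 = \<kappa>' * y ^ 2\<close> and the curve equation
      \<open>8 * y ^ 4 + 1 = 0\<close>. Each of the four values of \<open>y\<close> has two values
      of \<open>x\<close>.\<close>
    define \<kappa>' where "\<kappa>' = a / 6"
    have \<kappa>: "\<kappa>' ^ 2 = 1" "a = 6 * \<kappa>'" "\<kappa>' \<noteq> 0" using False assms by (auto simp: \<kappa>'_def)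
    define k where "k = csqrt \<kappa>'"
    have k: "k ^ 2 = \<kappa>'" "k \<noteq> 0" using \<kappa> by (auto simp: k_def)
    have fi1: "(x, y) \<in> affine_flexes \<longleftrightarrow> x ^ 2 = \<kappa>' * y ^ 2 \<and> y ^ 4 = - (1 / 8)" for x y
    proof -
      have "hess x y = 12 * \<kappa>' * (x ^ 2 - \<kappa>' * y ^ 2) ^ 2"
        unfolding hess_def using \<kappa>(1,2) by algebra
      then have h: "hess x y = 0 \<longleftrightarrow> x ^ 2 = \<kappa>' * y ^ 2" using \<kappa>(3) by simp
      have "x ^ 4 + y ^ 4 + 1 + a * x ^ 2 * y ^ 2 = 8 * y ^ 4 + 1" if "x ^ 2 = \<kappa>' * y ^ 2"
        using that \<kappa>(1,2) by algebra
      moreover have "8 * y ^ 4 + 1 = 0 \<longleftrightarrow> y ^ 4 = - (1 / 8)"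
        by (auto simp: field_simps eq_neg_iff_add_eq_0)
      ultimately show ?thesis unfolding fi h by metis
    qed
    have x4: "x ^ 4 = y ^ 4" if "x ^ 2 = \<kappa>' * y ^ 2" for x y using that \<kappa>(1) by algebra
    obtain r :: complex where r: "r ^ 4 = - (1 / 8)" by (rule fourth_root_exists)
    then have "r \<noteq> 0" by auto
    have "affine_set (\<lambda>z. z = 0) \<subseteq> orb (pt (k * r) r 1)"
    proof
      fix p assume "p \<in> affine_set (\<lambda>z. z = 0)"
      then obtain x y where p: "p = pt x y 1" "(x, y) \<in> affine_flexes" by (rule affine_setE)
      then have xy: "x ^ 2 = \<kappa>' * y ^ 2" "y ^ 4 = - (1 / 8)" by (simp_all add: fi1)
      then have nz: "y \<noteq> 0" "x \<noteq> 0" using \<kappa>(3) by auto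
      define \<alpha> \<delta> where "\<alpha> = x / (k * r)" and "\<delta> = y * k / x"
      have x: "x = \<alpha> * (k * r)" and y: "y = \<delta> * \<alpha> * r" using nz k(2) \<open>r \<noteq> 0\<close> by (simp_all add: \<alpha>_def \<delta>_def)
      have k4: "k ^ 4 = 1" using k(1) \<kappa>(1) by (metis mult_2 numeral_Bit0 one_power2 power2_eq_square power_add)
      have "\<alpha> ^ 4 = 1" using x4[OF xy(1)] xy(2) r k4 by (simp add: \<alpha>_def power_divide power_mult_distrib)
      moreover have "\<delta> ^ 2 = 1" using xy(1) k(1) nz \<kappa>(3) by (simp add: \<delta>_def power_divide power_mult_distrib)
      ultimately have m: "(False, \<alpha>, \<delta>) \<in> mon_index" by (simp add: mon_index_def)
      show "p \<in> orb (pt (k * r) r 1)" by (rule in_orbI[OF m]) (simp add: mon_map_pt[OF m] p x[symmetric] y[symmetric])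
    qed
    moreover have "orb (pt (k * r) r 1) \<subseteq> affine_set (\<lambda>z. z = 0)"
      by (rule orb_subset_affine_set)
        (use r k x4[of "k * r" r] in \<open>simp_all add: fi1 power_mult_distrib\<close>)
    moreover have "affine_set (\<lambda>z. z \<noteq> 0) = {}" by (auto simp: affine_set_def fi1 dest!: x4)
    moreover have "card (affine_set (\<lambda>z. z = 0)) = 8"
    proof -
      let ?R = "{y::complex. y ^ 4 = - (1 / 8)}"
      let ?g = "\<lambda>(y, \<delta>). (\<delta> * k * y, y)"
      have nz: "y \<noteq> 0" if "y \<in> ?R" for y using that by auto
      have "{(x, y) \<in> affine_flexes. x * y * (x ^ 4 - y ^ 4) = 0} = {(x, y). x ^ 2 = \<kappa>' * y ^ 2 \<and> y ^ 4 = - (1 / 8)}"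
        using x4 by (auto simp: fi1)
      also have "\<dots> = ?g ` (?R \<times> {1, - 1})"
      proof (intro equalityI subsetI)
        fix z assume "z \<in> {(x, y). x ^ 2 = \<kappa>' * y ^ 2 \<and> y ^ 4 = - (1 / 8)}"
        then obtain x y where z: "z = (x, y)" "x ^ 2 = (k * y) ^ 2" "y ^ 4 = - (1 / 8)"
          by (auto simp: k power_mult_distrib)
        then have "x = k * y \<or> x = - (k * y)" by (simp only: power2_eq_iff)
        then show "z \<in> ?g ` (?R \<times> {1, - 1})"
          using z(1,3) by (elim disjE) (force intro: image_eqI[of _ _ "(y, 1)"] image_eqI[of _ _ "(y, - 1)"])+
      qed (auto simp: k power_mult_distrib)
      finally have eq: "{(x, y) \<in> affine_flexes. x * y * (x ^ 4 - y ^ 4) = 0} = ?g ` (?R \<times> {1, - 1})" .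
      have "inj_on ?g (?R \<times> {1, - 1})" using nz k(2) by (auto simp: inj_on_def)
      then show ?thesis
        using card4[of "- (1 / 8)"] unfolding affine_set_def eq
        by (simp add: card_image[OF inj] card_image card_cartesian_product)
    qed
    ultimately show ?thesis by blast
  qed
  then show "affine_set (\<lambda>z. z \<noteq> 0) = {}" "\<exists>p. affine_set (\<lambda>z. z = 0) = orb p" "card (affine_set (\<lambda>z. z = 0)) = 8"
    by blast+
qed

text \<open>A common zero of the Hessian and \<open>x * y * (x ^ 4 - y ^ 4)\<close> would force
  \<open>a = 0\<close> on the axes, \<open>(a - 6) * (a + 2) = 0\<close> on
  \<open>x ^ 2 = y ^ 2\<close>, or \<open>(a + 6) * (a - 2) = 0\<close> on
  \<open>x ^ 2 = - (y ^ 2)\<close>. So all affine flexes are ordinary, and the orbit of any of them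
  is free.\<close>

lemma generic_flexes:
  assumes "a \<noteq> 0" "a \<noteq> 6" "a \<noteq> - 6"
  shows "affine_set (\<lambda>z. z = 0) = {}"
    and "\<exists>p. affine_set (\<lambda>z. z \<noteq> 0) = orb p"
    and "card (affine_set (\<lambda>z. z \<noteq> 0)) = 16"
proof -
  have ne: "x * y * (x ^ 4 - y ^ 4) \<noteq> 0" if "(x, y) \<in> affine_flexes" for x y
  proof
    assume z: "x * y * (x ^ 4 - y ^ 4) = 0"
    have f: "x ^ 4 + y ^ 4 + 1 + a * x ^ 2 * y ^ 2 = 0" and h: "hess x y = 0"
      using that by (simp_all add: affine_flexes_def)
    have xy: "x \<noteq> 0" "y \<noteq> 0" using f h assms(1) by (auto simp: hess_def)
    then have "x ^ 4 = y ^ 4" using z by simp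
    then have "(x ^ 2 - y ^ 2) * (x ^ 2 + y ^ 2) = 0" by algebra
    then have "x ^ 2 = y ^ 2 \<or> x ^ 2 = - (y ^ 2)" by (auto simp: eq_neg_iff_add_eq_0)
    then show False
    proof
      assume "x ^ 2 = y ^ 2"
      then have "y ^ 4 * ((a - 6) * (a + 2)) = 0" using h unfolding hess_def by algebra
      then show False using xy assms a2 by (auto simp: eq_neg_iff_add_eq_0[symmetric])
    next
      assume "x ^ 2 = - (y ^ 2)"
      then have "y ^ 4 * ((a + 6) * (a - 2)) = 0" using h unfolding hess_def by algebra
      then show False using xy assms a2 by (auto simp: eq_neg_iff_add_eq_0[symmetric])
    qed
  qed
  then show "affine_set (\<lambda>z. z = 0) = {}" by (auto simp: affine_set_def)
  obtain e where e: "(2 * a) * e ^ 4 + (12 - a ^ 2) * e ^ 2 + 2 * a = 0"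
    using assms(1) by (rule_tac biquadratic_root_exists[of "2 * a" "12 - a ^ 2" "2 * a"]) auto
  \<comment> \<open>The Hessian root \<open>e\<close> is not a root of \<open>f\<close>, since
    eliminating \<open>e ^ 4\<close> would leave \<open>12 - 3 * a ^ 2 = 0\<close> or
    \<open>e = 0\<close>. Hence the ratio \<open>e\<close> is attained at a point with
    \<open>z \<noteq> 0\<close>.\<close>
  have g: "e ^ 4 + 1 + a * e ^ 2 \<noteq> 0"
  proof
    assume "e ^ 4 + 1 + a * e ^ 2 = 0"
    then have "(12 - 3 * a ^ 2) * e ^ 2 = 0" using e by algebra
    then have "e = 0" using a2 by auto
    then show False using e assms(1) by simp
  qed
  \<comment> \<open>The scale is chosen so that \<open>f\<close> takes the value \<open>- 1\<close>
    at \<open>(e * y, y)\<close>.\<close>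
  obtain y where y: "y ^ 4 = - 1 / (e ^ 4 + 1 + a * e ^ 2)" by (rule fourth_root_exists)
  then have y1: "y ^ 4 * (e ^ 4 + 1 + a * e ^ 2) = - 1" using g by simp
  have aff: "(e * y, y) \<in> affine_flexes"
  proof -
    have "(e * y) ^ 4 + y ^ 4 + 1 + a * (e * y) ^ 2 * y ^ 2 = 0" using y1 by algebra
    moreover have "hess (e * y) y = 0" unfolding hess_def using e by algebra
    ultimately show ?thesis by (simp add: affine_flexes_def)
  qed
  have eq: "affine_set (\<lambda>z. z \<noteq> 0) = orb (pt (e * y) y 1)"
  proof
    show "orb (pt (e * y) y 1) \<subseteq> affine_set (\<lambda>z. z \<noteq> 0)"
      by (rule orb_subset_affine_set[OF aff]) (use ne[OF aff] in simp_all)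
    show "affine_set (\<lambda>z. z \<noteq> 0) \<subseteq> orb (pt (e * y) y 1)"
    proof
      fix p assume "p \<in> affine_set (\<lambda>z. z \<noteq> 0)"
      then obtain x' y' where "p = pt x' y' 1" "(x', y') \<in> affine_flexes" by (rule affine_setE)
      then show "p \<in> orb (pt (e * y) y 1)"
        using ordinary_flex_orbit[OF aff ne[OF aff]] ne by blast
    qed
  qed
  then show "\<exists>p. affine_set (\<lambda>z. z \<noteq> 0) = orb p" by blast
  show "card (affine_set (\<lambda>z. z \<noteq> 0)) = 16"
  proof -
    have "inj_on (\<lambda>m. mon_map m (pt (e * y) y 1)) mon_index"
      using ne[OF aff] by (intro mon_map_orbit_inj) auto
    then show ?thesis unfolding eq orb_def by (simp add: card_image card_mon_index)
  qed
qed

end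

theorem theorem3p6:
  fixes a :: complex
  assumes "(a^2 - 1) * (a^2 - 4) \<noteq> 0"
  shows "smooth_plane_curve 4 (quartic a)
    \<and> Coset.order sym_group = 16
    \<and> group_action sym_group (curve (quartic a)) (curve_action (quartic a))
    \<and> weierstrass_points (quartic a) = ordinary_flexes (quartic a) \<union> hyperflexes (quartic a)
    \<and> (if a = 0 \<or> a = 6 \<or> a = -6 then
         ordinary_flexes (quartic a) = {}
         \<and> card (hyperflexes (quartic a)) = 12
         \<and> (\<exists>O1 O2. orbits sym_group (hyperflexes (quartic a)) (curve_action (quartic a)) = {O1, O2}
              \<and> card O1 = 4 \<and> card O2 = 8)
       else
         card (ordinary_flexes (quartic a)) = 16
         \<and> orbits sym_group (ordinary_flexes (quartic a)) (curve_action (quartic a))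
             = {ordinary_flexes (quartic a)}
         \<and> card (hyperflexes (quartic a)) = 4
         \<and> orbits sym_group (hyperflexes (quartic a)) (curve_action (quartic a))
             = {hyperflexes (quartic a)})"
proof -
  have a2: "a ^ 2 \<noteq> 4" using assms by auto
  obtain s where s: "1 * s ^ 4 + a * s ^ 2 + 1 = 0" by (rule biquadratic_root_exists[of 1 a 1]) simp_all
  interpret smooth_quartic a s by unfold_locales (use a2 s in simp_all)
  have act: "group_action sym_group C (curve_action F)"
    using group_action_restrict_sym_group[of C] mon_map_curve_quartic
    by (simp add: curve_action_def[abs_def])
  have sub: "hyperflexes F \<subseteq> C" "ordinary_flexes F \<subseteq> C" by (auto simp: hyperflexes_def ordinary_flexes_def)
  \<comment> \<open>For every \<open>a\<close> the four points with \<open>z = 0\<close> are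
    hyperflexes and form one orbit. The affine flexes add eight hyperflexes in the exceptional cases
    and are sixteen ordinary flexes otherwise.\<close>
  have rest: "if a = 0 \<or> a = 6 \<or> a = -6 then
         ordinary_flexes F = {}
         \<and> card (hyperflexes F) = 12
         \<and> (\<exists>O1 O2. orbits sym_group (hyperflexes F) (curve_action F) = {O1, O2}
              \<and> card O1 = 4 \<and> card O2 = 8)
       else
         card (ordinary_flexes F) = 16
         \<and> orbits sym_group (ordinary_flexes F) (curve_action F) = {ordinary_flexes F}
         \<and> card (hyperflexes F) = 4
         \<and> orbits sym_group (hyperflexes F) (curve_action F) = {hyperflexes F}"
  proof (cases "a = 0 \<or> a = 6 \<or> a = -6")
    case True
    note special = special_flexes[OF True]
    obtain p where p: "affine_set (\<lambda>z. z = 0) = orb p" using special(2) by blast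
    have "infinite_points \<inter> affine_set (\<lambda>z. z = 0) = {}"
      by (auto simp: infinite_points_def pt_0_neq_affine[symmetric] elim!: affine_setE)
    moreover have "finite infinite_points" "finite (affine_set (\<lambda>z. z = 0))"
      using card_infinite_points special(3) by (auto intro: card_ge_0_finite)
    ultimately have "card (hyperflexes F) = 12"
      unfolding hyperflexes_affine_set using card_infinite_points special(3) by (simp add: card_Un_disjoint)
    moreover have "orbits sym_group (hyperflexes F) (curve_action F) = {infinite_points, affine_set (\<lambda>z. z = 0)}"
      unfolding orbits_sym_group[OF sub(1)] unfolding hyperflexes_affine_set p infinite_points_eq_orb
      by (simp add: image_Un orb_image_orb insert_commute)
    ultimately show ?thesis
      using True special card_infinite_points ordinary_flexes_affine_set by auto
  next
    case False
    then have "a \<noteq> 0" "a \<noteq> 6" "a \<noteq> - 6" by auto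
    note generic = generic_flexes[OF this]
    have H: "hyperflexes F = infinite_points" using generic(1) by (simp add: hyperflexes_affine_set)
    obtain p where p: "ordinary_flexes F = orb p" using generic(2) ordinary_flexes_affine_set by auto
    have "orbits sym_group (ordinary_flexes F) (curve_action F) = {ordinary_flexes F}"
      using orbits_sym_group[OF sub(2)] by (simp only: p orb_image_orb)
    moreover have "orbits sym_group (hyperflexes F) (curve_action F) = {hyperflexes F}"
      using orbits_sym_group[OF sub(1)] by (simp only: H infinite_points_eq_orb orb_image_orb)
    ultimately show ?thesis
      using False generic(3) H card_infinite_points ordinary_flexes_affine_set by simp
  qed
  show ?thesis
    using smooth_quartic[OF a2] order_sym_group act weierstrass_points_eq rest by blast
qed

end
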